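(* Let $\Gamma\subset\mathrm{SL}_2(\mathbb{Z})$ be a subgroup of finite index, $\rho:\Gamma\to\mathrm{GL}(V(\rho))$ a representation on a finite dimensional complex vector space, $k\in\mathbb{Z}$ and $d\in\mathbb{Z}_{\ge0}$. For any nonzero polyharmonic weak Maaß form $f$ for $\rho$ of weight $k$ and exact depth $d$, the corresponding quiver representation $V_f=\mathbb{E}(M(\varphi_f))$ is cyclic. In particular, the Harish-Chandra module $M(\varphi_f)$ is indecomposable.
   Context: **Maaß forms.** $\mathbb{H}=\{\tau=x+iy: y>0\}$, $(f|_k g)(\tau)=(c\tau+d)^{-k}f(g\tau)$ for $g=\begin{pmatrix}a&b\\c&d\end{pmatrix}\in\mathrm{SL}_2(\mathbb{R})$; $\mathrm{L}_k=-2iy^2\partial_{\bar\tau}$, $\mathrm{R}_k=2i\partial_\tau+ky^{-1}$, $\Delta_k=-\mathrm{R}_{k-2}\mathrm{L}_k$. A smooth $f:\mathbb{H}\to V(\rho)$ is a polyharmonic weak Maaß form for $\rho$ of weight $k$ and depth $d$ if (i) $f|_k\gamma=\rho(\gamma)f$ for all $\gamma\in\Gamma$, (ii) $\Delta_k^{d+1}f=0$, (iii) $\|(f|_k\gamma)(\tau)\|\ll\exp(ay)$ as $y\to\infty$ for some $a\in\mathbb{R}$, some norm on $V(\rho)$ and all $\gamma\in\mathrm{SL}_2(\mathbb{Z})$. A nonzero such $f$ has exact depth $d$ if $d=0$ or $\Delta_k^d f\neq0$. **Harish-Chandra modules.** $G=\mathrm{SL}_2(\mathbb{R})$, $K=\mathrm{SO}_2(\mathbb{R})$,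 $\mathfrak{g}=\mathrm{Lie}(G)\otimes_{\mathbb R}\mathbb{C}$ with basis $H=\begin{pmatrix}0&-i\\i&0\end{pmatrix}$, $X=\frac12\begin{pmatrix}1&i\\i&-1\end{pmatrix}$, $Y=\frac12\begin{pmatrix}1&-i\\-i&-1\end{pmatrix}$. For a $(\mathfrak{g},K)$-module $M$ put $M_n=\{v\in M: Hv=nv\}$. To $f$ attach $\varphi_f:G\to V(\rho)$, $\varphi_f(g)=(f|_kg)(i)$. $K$ and $\mathfrak{g}$ act by right translation on the space of smooth functions $\varphi: G\to V(\rho)$ with $\varphi(hg)=\rho(h)\varphi(g)$ ($h\in\Gamma$, $g\in G$) which are $K$-finite and finite under the center of $U(\mathfrak{g})$; $M(\varphi_f)$ is the $(\mathfrak{g},K)$-submodule generated by $\varphi_f$. Put $l=|k-1|$. Then $M=M(\varphi_f)$ is a Harish-Chandra module (finitely generated over $U(\mathfrak{g})$, direct sum of finite dimensional $M_n$, $n\in\mathbb{Z}$) with $M=\bigoplus_{i\in\mathbb{Z}}M_{-l-1+2i}$ on which $C-(l^2-1)$ is nilpotent, where $C=H^2-2H+4XY$. **Quiver representations.** The two-cyclic quiver has vertices $-,+$ and arrows $a:-\to+$, $b:+\to-$. The Gelfand quiver has vertices $-,\ast,+$, arrows $a_\pm:\pm\to\ast$, $b_\pm:\ast\to\pm$ and the relation $a_-b_-=a_+b_+$. Representations are finite dimensional and nilpotent (all sufficiently long paths act as zero). If $k=1$ (so $l=0$), $\mathbb{E}(M)$ is the representation of the two-cyclic quiver with $V_-=M_{-1}$,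 $V_+=M_1$, $a=X|_{M_{-1}}$, $b=Y|_{M_1}$. If $k\neq1$, $\mathbb{E}(M)$ is the representation of the Gelfand quiver with $V_-=M_{-l-1}$, $V_\ast=M_{-l+1}$, $V_+=M_{l+1}$, $a_-=X|_{M_{-l-1}}$, $b_-=Y|_{M_{-l+1}}$, $b_+=X^{l}|_{M_{-l+1}}$, $a_+=X_\ast^{-1}\circ Y|_{M_{l+1}}$, where $X_\ast=X^{l-1}:M_{-l+1}\to M_{l-1}$, which is an isomorphism. A representation $V$ is called cyclic if, as a module over the (completed) path algebra of the quiver with its relations, it admits an epimorphism $P\twoheadrightarrow V$ from an indecomposable projective module $P$; equivalently, it is generated by a single vector lying in one of the spaces $V_i$, $i$ a vertex. *)

theory Defs
  imports
    "HOL-Analysis.Analysis"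
    "HOL-Algebra.Coset"
    "HOL-Library.Function_Algebras"
    "Graph_Theory.Arc_Walk"
begin

section \<open>Groups\<close>

text \<open>Matrices are multiplied with \<open>**\<close>; the library operation \<open>*\<close> on the type
  \<open>real^2^2\<close> is the componentwise product.\<close>

definition SL2R :: "(real^2^2) monoid" where
  "SL2R = \<lparr>carrier = {A. det A = 1}, mult = (**), one = mat 1\<rparr>"

definition SL2Z :: "(real^2^2) monoid" where
  "SL2Z = SL2R\<lparr>carrier := {A. det A = 1 \<and> (\<forall>i j. A $ i $ j \<in> \<int>)}\<rparr>"

definition SO2R :: "(real^2^2) set" where
  "SO2R = {A. det A = 1 \<and> orthogonal_matrix A}"

definition GL :: "(complex^'n^'n) monoid" where
  "GL = \<lparr>carrier = {A. invertible A}, mult = (**), one = mat 1\<rparr>"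


section \<open>Smooth functions on open sets\<close>

primrec Ck_on ::
    "nat \<Rightarrow> 'a::euclidean_space set \<Rightarrow> ('a \<Rightarrow> 'b::real_normed_vector) \<Rightarrow> bool" where
  "Ck_on 0 S f \<longleftrightarrow> continuous_on S f"
| "Ck_on (Suc n) S f \<longleftrightarrow>
     (\<forall>x\<in>S. f differentiable at x) \<and>
     (\<forall>v. Ck_on n S (\<lambda>x. frechet_derivative f (at x) v))"

definition smooth_on_open ::
    "'a::euclidean_space set \<Rightarrow> ('a \<Rightarrow> 'b::real_normed_vector) \<Rightarrow> bool" where
  "smooth_on_open S f \<longleftrightarrow> open S \<and> (\<forall>n. Ck_on n S f)"


section \<open>Polyharmonic weak Maass forms\<close>

text \<open>Functions on the upper half plane are functions on \<open>complex\<close> whose values outside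
  \<open>upper_half_plane\<close> are irrelevant: every condition below only looks at points of this
  open set.\<close>

definition upper_half_plane :: "complex set" where
  "upper_half_plane = {\<tau>. Im \<tau> > 0}"

definition automorphy_factor :: "real^2^2 \<Rightarrow> complex \<Rightarrow> complex" where
  "automorphy_factor g \<tau> = of_real (g $ 2 $ 1) * \<tau> + of_real (g $ 2 $ 2)"

definition moebius_act :: "real^2^2 \<Rightarrow> complex \<Rightarrow> complex" where
  "moebius_act g \<tau> = (of_real (g $ 1 $ 1) * \<tau> + of_real (g $ 1 $ 2)) / automorphy_factor g \<tau>"

definition slash :: "int \<Rightarrow> (complex \<Rightarrow> complex^'n) \<Rightarrow> real^2^2 \<Rightarrow> complex \<Rightarrow> complex^'n" where
  "slash k f g \<tau> = (automorphy_factor g \<tau> powi (- k)) *s f (moebius_act g \<tau>)"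

definition d_tau :: "(complex \<Rightarrow> complex^'n) \<Rightarrow> complex \<Rightarrow> complex^'n" where
  "d_tau f \<tau> = (1 / 2) *s (frechet_derivative f (at \<tau>) 1 - \<i> *s frechet_derivative f (at \<tau>) \<i>)"

definition d_taubar :: "(complex \<Rightarrow> complex^'n) \<Rightarrow> complex \<Rightarrow> complex^'n" where
  "d_taubar f \<tau> = (1 / 2) *s (frechet_derivative f (at \<tau>) 1 + \<i> *s frechet_derivative f (at \<tau>) \<i>)"

definition raising_op :: "int \<Rightarrow> (complex \<Rightarrow> complex^'n) \<Rightarrow> complex \<Rightarrow> complex^'n" where
  "raising_op k f \<tau> = (2 * \<i>) *s d_tau f \<tau> + (of_int k * inverse (of_real (Im \<tau>))) *s f \<tau>"

definition lowering_op :: "int \<Rightarrow> (complex \<Rightarrow> complex^'n) \<Rightarrow> complex \<Rightarrow> complex^'n" where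
  "lowering_op k f \<tau> = (- 2 * \<i> * of_real ((Im \<tau>)\<^sup>2)) *s d_taubar f \<tau>"

definition laplace_op :: "int \<Rightarrow> (complex \<Rightarrow> complex^'n) \<Rightarrow> complex \<Rightarrow> complex^'n" where
  "laplace_op k f \<tau> = - raising_op (k - 2) (lowering_op k f) \<tau>"

definition complex_norm :: "(complex^'n \<Rightarrow> real) \<Rightarrow> bool" where
  "complex_norm N \<longleftrightarrow>
     (\<forall>v. N v \<ge> 0) \<and> (\<forall>v. N v = 0 \<longleftrightarrow> v = 0) \<and>
     (\<forall>v w. N (v + w) \<le> N v + N w) \<and> (\<forall>c v. N (c *s v) = cmod c * N v)"

text \<open>The bound in the third condition is uniform on the half strips
  \<open>\<bar>Re \<tau>\<bar> \<le> b\<close>, \<open>Im \<tau> \<ge> y0\<close>. It is not required uniformly in all of \<open>Re \<tau>\<close>: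
  as \<open>\<rho>\<close> need not be unitary, \<open>f (\<tau> + h) = \<rho> (T^h) (f \<tau>)\<close> may be unbounded in \<open>h\<close>.\<close>

definition polyharmonic_weak_maass_form ::
    "(real^2^2) set \<Rightarrow> (real^2^2 \<Rightarrow> complex^'n^'n) \<Rightarrow> int \<Rightarrow> nat \<Rightarrow> (complex \<Rightarrow> complex^'n) \<Rightarrow> bool" where
  "polyharmonic_weak_maass_form \<Gamma> \<rho> k d f \<longleftrightarrow>
     smooth_on_open upper_half_plane f \<and>
     (\<forall>\<gamma>\<in>\<Gamma>. \<forall>\<tau>\<in>upper_half_plane. slash k f \<gamma> \<tau> = \<rho> \<gamma> *v f \<tau>) \<and>
     (\<forall>\<tau>\<in>upper_half_plane. (laplace_op k ^^ (d + 1)) f \<tau> = 0) \<and>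
     (\<exists>a N. complex_norm N \<and>
        (\<forall>\<gamma>\<in>carrier SL2Z. \<forall>b. \<exists>C y0. \<forall>\<tau>. \<bar>Re \<tau>\<bar> \<le> b \<and> Im \<tau> \<ge> y0 \<longrightarrow>
           N (slash k f \<gamma> \<tau>) \<le> C * exp (a * Im \<tau>)))"

definition exact_depth :: "int \<Rightarrow> nat \<Rightarrow> (complex \<Rightarrow> complex^'n) \<Rightarrow> bool" where
  "exact_depth k d f \<longleftrightarrow>
     d = 0 \<or> (\<exists>\<tau>\<in>upper_half_plane. (laplace_op k ^^ d) f \<tau> \<noteq> 0)"


section \<open>The action of Lie algebra and maximal compact subgroup on functions on the group\<close>

text \<open>Functions on \<open>SL2R\<close> are functions on all matrices that vanish outside \<open>carrier SL2R\<close>,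
  so that equality on the group is equality of functions.\<close>

definition fscale :: "complex \<Rightarrow> ('g \<Rightarrow> complex^'n) \<Rightarrow> 'g \<Rightarrow> complex^'n" where
  "fscale c \<phi> = (\<lambda>g. c *s \<phi> g)"

global_interpretation fscale: vector_space fscale
  by unfold_locales
    (auto simp: fscale_def fun_eq_iff vec_eq_iff algebra_simps)

definition finite_dim :: "(complex \<Rightarrow> 'v::ab_group_add \<Rightarrow> 'v) \<Rightarrow> 'v set \<Rightarrow> bool" where
  "finite_dim sc S \<longleftrightarrow> (\<exists>B. finite B \<and> S \<subseteq> module.span sc B)"

definition group_lift :: "int \<Rightarrow> (complex \<Rightarrow> complex^'n) \<Rightarrow> real^2^2 \<Rightarrow> complex^'n" where
  "group_lift k f g = (if g \<in> carrier SL2R then slash k f g \<i> else 0)"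

text \<open>Smoothness on the closed submanifold \<open>SL2R\<close> of the matrix space: locally the
  restriction of a smooth function on an open set of matrices.\<close>

definition smooth_functions :: "(real^2^2 \<Rightarrow> complex^'n) set" where
  "smooth_functions = {\<phi>.
     (\<forall>g\<in>carrier SL2R. \<exists>U F. g \<in> U \<and> smooth_on_open U F \<and> (\<forall>h\<in>U \<inter> carrier SL2R. F h = \<phi> h)) \<and>
     (\<forall>g. g \<notin> carrier SL2R \<longrightarrow> \<phi> g = 0)}"

definition mat_exp :: "real^2^2 \<Rightarrow> real^2^2" where
  "mat_exp A = (\<Sum>n. (((**) A ^^ n) (mat 1)) /\<^sub>R fact n)"

text \<open>Right translation by a real Lie algebra element, its complex linear extension to
  the complexified Lie algebra, and right translation by group elements.\<close>

definition lie_deriv :: "real^2^2 \<Rightarrow> (real^2^2 \<Rightarrow> complex^'n) \<Rightarrow> real^2^2 \<Rightarrow> complex^'n" where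
  "lie_deriv A \<phi> g =
     (if g \<in> carrier SL2R
      then vector_derivative (\<lambda>t::real. \<phi> (g ** mat_exp (t *\<^sub>R A))) (at 0) else 0)"

definition sl2C :: "(complex^2^2) set" where
  "sl2C = {Z. trace Z = 0}"

definition gact :: "complex^2^2 \<Rightarrow> (real^2^2 \<Rightarrow> complex^'n) \<Rightarrow> real^2^2 \<Rightarrow> complex^'n" where
  "gact Z \<phi> = lie_deriv (\<chi> i j. Re (Z $ i $ j)) \<phi> + fscale \<i> (lie_deriv (\<chi> i j. Im (Z $ i $ j)) \<phi>)"

definition Kact :: "real^2^2 \<Rightarrow> (real^2^2 \<Rightarrow> complex^'n) \<Rightarrow> real^2^2 \<Rightarrow> complex^'n" where
  "Kact \<kappa> \<phi> g = \<phi> (g ** \<kappa>)"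

definition elt_H :: "complex^2^2" where
  "elt_H = vector [vector [0, - \<i>], vector [\<i>, 0]]"

definition elt_X :: "complex^2^2" where
  "elt_X = vector [vector [1 / 2, \<i> / 2], vector [\<i> / 2, - 1 / 2]]"

definition elt_Y :: "complex^2^2" where
  "elt_Y = vector [vector [1 / 2, - \<i> / 2], vector [- \<i> / 2, - 1 / 2]]"

text \<open>The universal enveloping algebra acts faithfully on smooth functions (for nonzero
  values), as the algebra of left invariant differential operators. It is represented by
  these operators; two of them are the same element iff they agree on \<open>smooth_functions\<close>,
  and accordingly the center is defined by commutation on \<open>smooth_functions\<close>.\<close>

inductive_set Ug :: "((real^2^2 \<Rightarrow> complex^'n) \<Rightarrow> (real^2^2 \<Rightarrow> complex^'n)) set" where
  one: "(\<lambda>\<phi>. \<phi>) \<in> Ug"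
| lie: "Z \<in> sl2C \<Longrightarrow> gact Z \<in> Ug"
| add: "D \<in> Ug \<Longrightarrow> E \<in> Ug \<Longrightarrow> (\<lambda>\<phi>. D \<phi> + E \<phi>) \<in> Ug"
| scale: "D \<in> Ug \<Longrightarrow> (\<lambda>\<phi>. fscale c (D \<phi>)) \<in> Ug"
| mult: "D \<in> Ug \<Longrightarrow> E \<in> Ug \<Longrightarrow> (\<lambda>\<phi>. D (E \<phi>)) \<in> Ug"

definition center_Ug :: "((real^2^2 \<Rightarrow> complex^'n) \<Rightarrow> (real^2^2 \<Rightarrow> complex^'n)) set" where
  "center_Ug = {D \<in> Ug. \<forall>E\<in>Ug. \<forall>\<phi>\<in>smooth_functions. D (E \<phi>) = E (D \<phi>)}"


section \<open>Harish-Chandra modules of functions on the group\<close>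

definition automorphic_functions ::
    "(real^2^2) set \<Rightarrow> (real^2^2 \<Rightarrow> complex^'n^'n) \<Rightarrow> (real^2^2 \<Rightarrow> complex^'n) set" where
  "automorphic_functions \<Gamma> \<rho> = {\<phi> \<in> smooth_functions.
     (\<forall>h\<in>\<Gamma>. \<forall>g\<in>carrier SL2R. \<phi> (h ** g) = \<rho> h *v \<phi> g) \<and>
     finite_dim fscale {Kact \<kappa> \<phi> | \<kappa>. \<kappa> \<in> SO2R} \<and>
     finite_dim fscale {D \<phi> | D. D \<in> center_Ug}}"

definition gK_submodule ::
    "(real^2^2) set \<Rightarrow> (real^2^2 \<Rightarrow> complex^'n^'n) \<Rightarrow> (real^2^2 \<Rightarrow> complex^'n) set \<Rightarrow> bool" where
  "gK_submodule \<Gamma> \<rho> M \<longleftrightarrow>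
     M \<subseteq> automorphic_functions \<Gamma> \<rho> \<and> module.subspace fscale M \<and>
     (\<forall>Z\<in>sl2C. \<forall>\<phi>\<in>M. gact Z \<phi> \<in> M) \<and> (\<forall>\<kappa>\<in>SO2R. \<forall>\<phi>\<in>M. Kact \<kappa> \<phi> \<in> M)"

definition generated_module ::
    "(real^2^2) set \<Rightarrow> (real^2^2 \<Rightarrow> complex^'n^'n) \<Rightarrow> (real^2^2 \<Rightarrow> complex^'n) \<Rightarrow>
     (real^2^2 \<Rightarrow> complex^'n) set" where
  "generated_module \<Gamma> \<rho> \<phi> = \<Inter>{M. gK_submodule \<Gamma> \<rho> M \<and> \<phi> \<in> M}"

definition weight_space ::
    "(real^2^2 \<Rightarrow> complex^'n) set \<Rightarrow> int \<Rightarrow> (real^2^2 \<Rightarrow> complex^'n) set" where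
  "weight_space M n = {v \<in> M. gact elt_H v = fscale (of_int n) v}"

definition harish_chandra_module ::
    "(real^2^2) set \<Rightarrow> (real^2^2 \<Rightarrow> complex^'n^'n) \<Rightarrow> (real^2^2 \<Rightarrow> complex^'n) set \<Rightarrow> bool" where
  "harish_chandra_module \<Gamma> \<rho> M \<longleftrightarrow>
     gK_submodule \<Gamma> \<rho> M \<and>
     (\<exists>S. finite S \<and> S \<subseteq> M \<and> M = module.span fscale {D v | D v. D \<in> Ug \<and> v \<in> S}) \<and>
     (\<forall>n. finite_dim fscale (weight_space M n)) \<and>
     (\<forall>v\<in>M. \<exists>!c. (\<forall>n. c n \<in> weight_space M n) \<and> finite {n. c n \<noteq> 0} \<and>
                 v = sum c {n. c n \<noteq> 0})"

definition indecomposable_module ::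
    "(real^2^2) set \<Rightarrow> (real^2^2 \<Rightarrow> complex^'n^'n) \<Rightarrow> (real^2^2 \<Rightarrow> complex^'n) set \<Rightarrow> bool" where
  "indecomposable_module \<Gamma> \<rho> M \<longleftrightarrow>
     M \<noteq> {0} \<and>
     (\<forall>A B. gK_submodule \<Gamma> \<rho> A \<and> gK_submodule \<Gamma> \<rho> B \<and>
            A \<inter> B = {0} \<and> {u + v | u v. u \<in> A \<and> v \<in> B} = M \<longrightarrow> A = {0} \<or> B = {0})"


section \<open>Representations of quivers with relations\<close>

text \<open>A quiver is a \<open>pre_digraph\<close>. A path is the list of its arrows in order of traversal,
  hence in the opposite of the order in which the composite map is written. A relation
  \<open>(p, q)\<close> says that the paths \<open>p\<close> and \<open>q\<close> act in the same way.\<close>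

record ('q, 'e, 'v) quiver_rep =
  vspace :: "'q \<Rightarrow> 'v set"
  arrow :: "'e \<Rightarrow> 'v \<Rightarrow> 'v"

definition path_map :: "('q, 'e, 'v) quiver_rep \<Rightarrow> 'e list \<Rightarrow> 'v \<Rightarrow> 'v" where
  "path_map V p = fold (arrow V) p"

definition nilpotent_quiver_rep ::
    "(complex \<Rightarrow> 'v::ab_group_add \<Rightarrow> 'v) \<Rightarrow> ('q, 'e) pre_digraph \<Rightarrow> ('e list \<times> 'e list) set \<Rightarrow>
     ('q, 'e, 'v) quiver_rep \<Rightarrow> bool" where
  "nilpotent_quiver_rep sc Q R V \<longleftrightarrow>
     (\<forall>i\<in>verts Q. module.subspace sc (vspace V i) \<and> finite_dim sc (vspace V i)) \<and>
     (\<forall>e\<in>arcs Q. arrow V e \<in> vspace V (tail Q e) \<rightarrow> vspace V (head Q e) \<and>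
        (\<forall>u\<in>vspace V (tail Q e). \<forall>v\<in>vspace V (tail Q e).
           arrow V e (u + v) = arrow V e u + arrow V e v) \<and>
        (\<forall>c. \<forall>v\<in>vspace V (tail Q e). arrow V e (sc c v) = sc c (arrow V e v))) \<and>
     (\<forall>(p, q)\<in>R. \<forall>i j. pre_digraph.awalk Q i p j \<and> pre_digraph.awalk Q i q j \<longrightarrow>
        (\<forall>v\<in>vspace V i. path_map V p v = path_map V q v)) \<and>
     (\<exists>N. \<forall>i p j. pre_digraph.awalk Q i p j \<and> length p \<ge> N \<longrightarrow>
        (\<forall>v\<in>vspace V i. path_map V p v = 0))"

definition quiver_subrep ::
    "(complex \<Rightarrow> 'v::ab_group_add \<Rightarrow> 'v) \<Rightarrow> ('q, 'e) pre_digraph \<Rightarrow> ('q, 'e, 'v) quiver_rep \<Rightarrow>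
     ('q \<Rightarrow> 'v set) \<Rightarrow> bool" where
  "quiver_subrep sc Q V W \<longleftrightarrow>
     (\<forall>i\<in>verts Q. module.subspace sc (W i) \<and> W i \<subseteq> vspace V i) \<and>
     (\<forall>e\<in>arcs Q. \<forall>v\<in>W (tail Q e). arrow V e v \<in> W (head Q e))"

definition cyclic_quiver_rep ::
    "(complex \<Rightarrow> 'v::ab_group_add \<Rightarrow> 'v) \<Rightarrow> ('q, 'e) pre_digraph \<Rightarrow> ('e list \<times> 'e list) set \<Rightarrow>
     ('q, 'e, 'v) quiver_rep \<Rightarrow> bool" where
  "cyclic_quiver_rep sc Q R V \<longleftrightarrow>
     nilpotent_quiver_rep sc Q R V \<and>
     (\<exists>i\<in>verts Q. \<exists>v\<in>vspace V i.
        \<forall>W. quiver_subrep sc Q V W \<and> v \<in> W i \<longrightarrow> (\<forall>j\<in>verts Q. W j = vspace V j))"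


section \<open>The two-cyclic quiver, the Gelfand quiver and the representation of a module\<close>

datatype vertex = V_minus | V_star | V_plus

datatype arrow_name = Arr_a | Arr_b | Arr_a_minus | Arr_b_minus | Arr_a_plus | Arr_b_plus

primrec arrow_source :: "arrow_name \<Rightarrow> vertex" where
  "arrow_source Arr_a = V_minus"
| "arrow_source Arr_b = V_plus"
| "arrow_source Arr_a_minus = V_minus"
| "arrow_source Arr_b_minus = V_star"
| "arrow_source Arr_a_plus = V_plus"
| "arrow_source Arr_b_plus = V_star"

primrec arrow_target :: "arrow_name \<Rightarrow> vertex" where
  "arrow_target Arr_a = V_plus"
| "arrow_target Arr_b = V_minus"
| "arrow_target Arr_a_minus = V_star"
| "arrow_target Arr_b_minus = V_minus"
| "arrow_target Arr_a_plus = V_star"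
| "arrow_target Arr_b_plus = V_plus"

definition two_cyclic_quiver :: "(vertex, arrow_name) pre_digraph" where
  "two_cyclic_quiver =
     \<lparr>verts = {V_minus, V_plus}, arcs = {Arr_a, Arr_b}, tail = arrow_source, head = arrow_target\<rparr>"

definition gelfand_quiver :: "(vertex, arrow_name) pre_digraph" where
  "gelfand_quiver =
     \<lparr>verts = {V_minus, V_star, V_plus}, arcs = {Arr_a_minus, Arr_b_minus, Arr_a_plus, Arr_b_plus},
      tail = arrow_source, head = arrow_target\<rparr>"

definition gelfand_relations :: "(arrow_name list \<times> arrow_name list) set" where
  "gelfand_relations = {([Arr_b_minus, Arr_a_minus], [Arr_b_plus, Arr_a_plus])}"

definition quiver_of_weight :: "int \<Rightarrow> (vertex, arrow_name) pre_digraph" where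
  "quiver_of_weight k = (if k = 1 then two_cyclic_quiver else gelfand_quiver)"

definition relations_of_weight :: "int \<Rightarrow> (arrow_name list \<times> arrow_name list) set" where
  "relations_of_weight k = (if k = 1 then {} else gelfand_relations)"

text \<open>The clauses for vertices and arrows that do not belong to the quiver at hand are
  dummies.\<close>

definition two_cyclic_rep_of ::
    "(real^2^2 \<Rightarrow> complex^'n) set \<Rightarrow> (vertex, arrow_name, real^2^2 \<Rightarrow> complex^'n) quiver_rep" where
  "two_cyclic_rep_of M =
     \<lparr>vspace = (\<lambda>i. case i of
        V_minus \<Rightarrow> weight_space M (- 1)
      | V_star \<Rightarrow> {0}
      | V_plus \<Rightarrow> weight_space M 1),
      arrow = (\<lambda>e. case e of
        Arr_a \<Rightarrow> gact elt_X
      | Arr_b \<Rightarrow> gact elt_Y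
      | _ \<Rightarrow> (\<lambda>v. 0))\<rparr>"

definition gelfand_rep_of ::
    "nat \<Rightarrow> (real^2^2 \<Rightarrow> complex^'n) set \<Rightarrow>
     (vertex, arrow_name, real^2^2 \<Rightarrow> complex^'n) quiver_rep" where
  "gelfand_rep_of l M =
     \<lparr>vspace = (\<lambda>i. case i of
        V_minus \<Rightarrow> weight_space M (- int l - 1)
      | V_star \<Rightarrow> weight_space M (- int l + 1)
      | V_plus \<Rightarrow> weight_space M (int l + 1)),
      arrow = (\<lambda>e. case e of
        Arr_a_minus \<Rightarrow> gact elt_X
      | Arr_b_minus \<Rightarrow> gact elt_Y
      | Arr_b_plus \<Rightarrow> gact elt_X ^^ l
      | Arr_a_plus \<Rightarrow> (\<lambda>v. inv_into (weight_space M (- int l + 1)) (gact elt_X ^^ (l - 1))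
                         (gact elt_Y v))
      | _ \<Rightarrow> (\<lambda>v. 0))\<rparr>"

definition rep_of_module ::
    "int \<Rightarrow> (real^2^2 \<Rightarrow> complex^'n) set \<Rightarrow>
     (vertex, arrow_name, real^2^2 \<Rightarrow> complex^'n) quiver_rep" where
  "rep_of_module k M = (if k = 1 then two_cyclic_rep_of M else gelfand_rep_of (nat \<bar>k - 1\<bar>) M)"

end

(* Let phi be the lift of f. On lifts of smooth functions on the upper half plane the elements X, Y
   act as the raising and lowering operators, and X Y - Y X is multiplication by the weight. Since
   k^2 - 2k = l^2 - 1, on the weight k the operator N = X Y = - Delta_k is a quarter of
   C - (l^2 - 1), so N^(d+1) phi = 0. With U the span of the N^j phi, the spaces X^i U and Y^i U
   (of weights k + 2i and k - 2i) are therefore stable under X and Y, and their sum is the module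
   generated by phi. The vector phi has weight k = 1 + l or k = 1 - l, hence lies at the vertex
   + or * of the quiver, where U is generated by phi under N, a composition of two arrows; the
   remaining vertices carry images of U. A decomposition of the module splits phi inside U, a
   cyclic module over the local ring C[N] / (N^(d+1)), so one summand contains phi. *)

theory Submission
  imports Defs
begin

section \<open>Iterated differentiability\<close>

text \<open>The obstacle: \<open>gact\<close> is built from \<open>vector_derivative\<close>, so it
  is known to be linear only where the derivatives along one-parameter curves exist, and
  \<open>f\<close> is constrained only on an open half plane. Hence smoothness is handled by
  \<open>Ck_on\<close> on open sets, and the algebra takes place in a locale whose operators are
  linear only on the span of the weight spaces. The algebra rests on one function of the weight,
  s(n) = ((n - 1)^2 - l^2) / 4: on weight n both X Y + s(n) and Y X + s(n + 2) are the same
  operator, a quarter of the shifted Casimir element, and it is nilpotent on the module. As s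
  vanishes exactly at n = 1 - l and n = 1 + l, X maps weight n - 2 bijectively to weight n for every
  other n. This makes X^(l - 1) invertible between the weights 1 - l and l - 1. At the two zeros the
  constant drops out, so both round trips at the vertex * are the Casimir operator, which is the
  relation of the Gelfand quiver. Finiteness under the center needs no description of the center: a
  central operator commutes with H and so preserves the finite dimensional weight spaces.
  Indecomposability is proved on the module itself, not transported from the quiver.\<close>

lemma frechet_derivative_eqI:
  "(f has_derivative f') (at x) \<Longrightarrow> frechet_derivative f (at x) = f'"
  by (metis frechet_derivative_at)

text \<open>Since \<open>S\<close> is open, the derivative at a point of \<open>S\<close> depends
  only on values inside \<open>S\<close>; values elsewhere never matter.\<close>

lemma Ck_on_cong:
  assumes "open S" "\<And>x. x \<in> S \<Longrightarrow> f x = g x" "Ck_on n S f"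
  shows "Ck_on n S g"
  using assms(2,3)
proof (induction n arbitrary: f g)
  case 0
  then show ?case using continuous_on_cong[of S S f g] by simp
next
  case (Suc n)
  have eq: "frechet_derivative f (at x) = frechet_derivative g (at x)" if "x \<in> S" for x
    by (rule frechet_derivative_transform_within_open[OF _ \<open>open S\<close> that])
      (use Suc.prems that in auto)
  have "g differentiable at x" if "x \<in> S" for x
  proof -
    have "(f has_derivative frechet_derivative f (at x)) (at x)"
      using Suc.prems(2) that frechet_derivative_works by auto
    from has_derivative_transform_within_open[OF this \<open>open S\<close> that Suc.prems(1)]
    show ?thesis by (auto simp: differentiable_def)
  qed
  moreover have "Ck_on n S (\<lambda>x. frechet_derivative g (at x) v)" for v
    by (rule Suc.IH[of "\<lambda>x. frechet_derivative f (at x) v"]) (use Suc.prems eq in auto)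
  ultimately show ?case by simp
qed

text \<open>Introduction rule for explicit derivatives: any \<open>f'\<close> valid on
  \<open>S\<close> may stand in for the chosen \<open>frechet_derivative\<close>.\<close>

lemma Ck_on_SucI:
  assumes "open S" "\<And>x. x \<in> S \<Longrightarrow> (f has_derivative f' x) (at x)"
    "\<And>v. Ck_on n S (\<lambda>x. f' x v)"
  shows "Ck_on (Suc n) S f"
proof -
  have "Ck_on n S (\<lambda>x. frechet_derivative f (at x) v)" for v
    by (rule Ck_on_cong[OF assms(1) _ assms(3)[of v]])
      (simp add: frechet_derivative_eqI[OF assms(2)])
  then show ?thesis using assms(2) by (auto simp: differentiable_def)
qed

lemma Ck_on_SucD:
  assumes "Ck_on (Suc n) S f"
  shows "x \<in> S \<Longrightarrow> (f has_derivative frechet_derivative f (at x)) (at x)"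
    and "Ck_on n S (\<lambda>x. frechet_derivative f (at x) v)"
  using assms frechet_derivative_works by auto

lemma Ck_on_mono: "Ck_on (Suc n) S f \<Longrightarrow> Ck_on n S f"
proof (induction n arbitrary: f)
  case 0
  then show ?case
    by (auto intro!: differentiable_imp_continuous_on
        simp: differentiable_on_def differentiable_at_withinI)
next
  case (Suc n)
  then show ?case by auto
qed

lemma Ck_on_const: "open S \<Longrightarrow> Ck_on n S (\<lambda>x. c)"
proof (induction n arbitrary: c)
  case (Suc n)
  then show ?case by (intro Ck_on_SucI[where f' = "\<lambda>x v. 0"]) auto
qed auto

lemma Ck_on_bounded_linear:
  assumes "bounded_linear L" "open S" "Ck_on n S f"
  shows "Ck_on n S (\<lambda>x. L (f x))"
  using assms(3)
proof (induction n arbitrary: f)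
  case 0
  then show ?case
    using bounded_linear.continuous_on[OF assms(1)] by auto
next
  case (Suc n)
  show ?case
    by (rule Ck_on_SucI[OF assms(2)
          bounded_linear.has_derivative[OF assms(1) Ck_on_SucD(1)[OF Suc.prems]]
          Suc.IH[OF Ck_on_SucD(2)[OF Suc.prems]]])
qed

lemma Ck_on_add:
  assumes "open S" "Ck_on n S f" "Ck_on n S g"
  shows "Ck_on n S (\<lambda>x. f x + g x)"
  using assms(2,3)
proof (induction n arbitrary: f g)
  case 0
  then show ?case by (auto intro: continuous_on_add)
next
  case (Suc n)
  show ?case
    by (rule Ck_on_SucI[OF assms(1)
          has_derivative_add[OF Ck_on_SucD(1)[OF Suc.prems(1)] Ck_on_SucD(1)[OF Suc.prems(2)]]
          Suc.IH[OF Ck_on_SucD(2)[OF Suc.prems(1)] Ck_on_SucD(2)[OF Suc.prems(2)]]])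
qed

lemma Ck_on_sum:
  assumes "open S" "finite I" "\<And>i. i \<in> I \<Longrightarrow> Ck_on n S (f i)"
  shows "Ck_on n S (\<lambda>x. \<Sum>i\<in>I. f i x)"
  using assms(2,3)
  by (induction I rule: finite_induct) (auto intro: Ck_on_const Ck_on_add assms(1))

lemma Ck_on_bilinear:
  assumes "bounded_bilinear B" "open S" "Ck_on n S f" "Ck_on n S g"
  shows "Ck_on n S (\<lambda>x. B (f x) (g x))"
  using assms(3,4)
proof (induction n arbitrary: f g)
  case 0
  then show ?case using bounded_bilinear.continuous_on[OF assms(1)] by auto
next
  case (Suc n)
  have "Ck_on n S (\<lambda>x. B (f x) (frechet_derivative g (at x) v) +
            B (frechet_derivative f (at x) v) (g x))" for v
    by (intro Ck_on_add assms(2) Suc.IH Ck_on_SucD(2) Suc.prems Ck_on_mono)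
  then show ?case
    by (intro Ck_on_SucI[OF assms(2)
          bounded_bilinear.FDERIV[OF assms(1) Ck_on_SucD(1)[OF Suc.prems(1)]
            Ck_on_SucD(1)[OF Suc.prems(2)]]])
qed

lemma Ck_on_compose:
  fixes g :: "'a::euclidean_space \<Rightarrow> 'b::euclidean_space"
    and f :: "'b \<Rightarrow> 'c::real_normed_vector"
  assumes "open S" "g ` S \<subseteq> T" "Ck_on n S g" "Ck_on n T f"
  shows "Ck_on n S (\<lambda>x. f (g x))"
  using assms(3,4)
proof (induction n arbitrary: f)
  case 0
  then show ?case
    using continuous_on_compose2[of T f S g] assms(2) by auto
next
  case (Suc n)
  have der: "((\<lambda>x. f (g x)) has_derivative
      (\<lambda>v. frechet_derivative f (at (g x)) (frechet_derivative g (at x) v))) (at x)"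
    if "x \<in> S" for x
    using diff_chain_at[OF Ck_on_SucD(1)[OF Suc.prems(1) that]
        Ck_on_SucD(1)[OF Suc.prems(2), of "g x"]] assms(2) that
    by (auto simp: o_def)
  have gn: "Ck_on n S g" using Suc.prems(1) Ck_on_mono by blast
  \<comment> \<open>The direction in which \<open>f\<close> is differentiated varies with
    \<open>x\<close>. Expanding it in the basis leaves fixed directions \<open>b\<close> with
    variable coefficients, to which the product rule and the induction hypothesis apply.\<close>
  have "Ck_on n S (\<lambda>x. \<Sum>b\<in>Basis. (frechet_derivative g (at x) v \<bullet> b) *\<^sub>R
          frechet_derivative f (at (g x)) b)" for v
    by (intro Ck_on_sum assms(1) finite_Basis Ck_on_bilinear[OF bounded_bilinear_scaleR]
        Ck_on_bounded_linear[OF bounded_linear_inner_left] Ck_on_SucD(2)[OF Suc.prems(1)]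
        Suc.IH[OF gn] Ck_on_SucD(2)[OF Suc.prems(2)])
  then have der': "Ck_on n S (\<lambda>x. frechet_derivative f (at (g x)) (frechet_derivative g (at x) v))" for v
  proof (rule Ck_on_cong[OF assms(1), rotated])
    fix x assume "x \<in> S"
    then have "linear (frechet_derivative f (at (g x)))"
      using Ck_on_SucD(1)[OF Suc.prems(2), of "g x"] assms(2)
      by (auto intro: has_derivative_linear)
    from linear_sum[OF this, of "\<lambda>b. (frechet_derivative g (at x) v \<bullet> b) *\<^sub>R b" Basis]
    show "(\<Sum>b\<in>Basis. (frechet_derivative g (at x) v \<bullet> b) *\<^sub>R frechet_derivative f (at (g x)) b)
        = frechet_derivative f (at (g x)) (frechet_derivative g (at x) v)"
      by (simp add: euclidean_representation linear_scale[OF \<open>linear (frechet_derivative f (at (g x)))\<close>])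
  qed
  show ?case
    by (rule Ck_on_SucI[OF assms(1) der der'])
qed

lemma Ck_on_id: "open S \<Longrightarrow> Ck_on n S (\<lambda>x. x)"
  by (cases n) (auto intro!: Ck_on_SucI[where f' = "\<lambda>x v. v"] Ck_on_const
      continuous_on_id simp del: Ck_on.simps(2))

lemma Ck_on_inverse:
  fixes g :: "'a::euclidean_space \<Rightarrow> 'b::real_normed_field"
  assumes "open S" "\<And>x. x \<in> S \<Longrightarrow> g x \<noteq> 0" "Ck_on n S g"
  shows "Ck_on n S (\<lambda>x. inverse (g x))"
  using assms(3)
proof (induction n)
  case 0
  then show ?case using assms(2) by (auto intro: continuous_on_inverse)
next
  case (Suc n)
  have gn: "Ck_on n S (\<lambda>x. inverse (g x))" using Suc Ck_on_mono by blast
  have "Ck_on n S (\<lambda>x. - (inverse (g x) * frechet_derivative g (at x) v * inverse (g x)))" for v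
    by (intro Ck_on_bounded_linear[OF bounded_linear_minus[OF bounded_linear_ident]] assms(1)
       Ck_on_bilinear[OF bounded_bilinear_mult] gn Ck_on_SucD(2)[OF Suc.prems])
  then show ?case
    by (intro Ck_on_SucI[OF assms(1) Deriv.has_derivative_inverse[OF assms(2) Ck_on_SucD(1)[OF Suc.prems]]])
qed

lemma Ck_on_power_int:
  fixes g :: "'a::euclidean_space \<Rightarrow> 'b::real_normed_field"
  assumes "open S" "\<And>x. x \<in> S \<Longrightarrow> g x \<noteq> 0" "Ck_on n S g"
  shows "Ck_on n S (\<lambda>x. g x powi m)"
proof -
  have pow: "Ck_on n S (\<lambda>x. h x ^ j)" if "Ck_on n S h" for h :: "'a \<Rightarrow> 'b" and j
    by (induction j) (auto intro!: Ck_on_const assms(1) Ck_on_bilinear[OF bounded_bilinear_mult] that)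
  show ?thesis
    using pow[OF assms(3), of "nat m"] pow[OF Ck_on_inverse[OF assms], of "nat (-m)"]
    by (cases "m \<ge> 0") (auto simp: power_int_def)
qed

section \<open>Symmetry of second derivatives\<close>

text \<open>The second difference of \<open>f\<close> over the parallelogram spanned by
  \<open>t u\<close> and \<open>t v\<close> is symmetric in \<open>u\<close> and \<open>v\<close>.
  Two applications of the mean value theorem turn it into \<open>t * t\<close> times a second
  derivative at a nearby point, in either order; continuity then compares both orders at
  \<open>x\<close>.\<close>

lemma symmetric_derivative_real:
  fixes f :: "'a::euclidean_space \<Rightarrow> real"
  assumes "open S" "Ck_on 2 S f" "x \<in> S"
  shows "frechet_derivative (\<lambda>y. frechet_derivative f (at y) u) (at x) v =
         frechet_derivative (\<lambda>y. frechet_derivative f (at y) v) (at x) u"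
proof -
  define P where "P u v y = frechet_derivative (\<lambda>y. frechet_derivative f (at y) u) (at y) v" for u v y
  note C2 = assms(2)[unfolded numeral_2_eq_2]
  have contP: "continuous_on S (P u v)" for u v
    using Ck_on_SucD(2)[OF Ck_on_SucD(2)[OF C2]] unfolding P_def by simp
  have key: "\<exists>y\<in>ball x e. f (x + t *\<^sub>R u + t *\<^sub>R v) - f (x + t *\<^sub>R u) - f (x + t *\<^sub>R v) + f x
          = t * t * P u v y"
    if e: "ball x e \<subseteq> S" and t: "t > 0" "t * norm u + t * norm v < e" for e t u v
  proof -
    have inb: "x + a *\<^sub>R u + b *\<^sub>R v \<in> ball x e" if "0 \<le> a" "a \<le> t" "0 \<le> b" "b \<le> t" for a b
    proof -
      have "norm (a *\<^sub>R u + b *\<^sub>R v) \<le> norm (a *\<^sub>R u) + norm (b *\<^sub>R v)"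
        by (rule norm_triangle_ineq)
      also have "\<dots> \<le> t * norm u + t * norm v"
        using that by (auto intro!: add_mono mult_right_mono)
      finally have "norm (a *\<^sub>R u + b *\<^sub>R v) < e" using t by simp
      moreover have "dist x (x + a *\<^sub>R u + b *\<^sub>R v) = norm (a *\<^sub>R u + b *\<^sub>R v)"
        by (simp add: dist_norm algebra_simps norm_minus_commute)
      ultimately show ?thesis by simp
    qed
    define \<phi> where "\<phi> a = f (x + a *\<^sub>R u + t *\<^sub>R v) - f (x + a *\<^sub>R u)" for a
    define Du where "Du y = frechet_derivative f (at y) u" for y
    have line: "((\<lambda>a. g (p + a *\<^sub>R w)) has_real_derivative g' w) (at a)"
      if "(g has_derivative g') (at (p + a *\<^sub>R w))" for g :: "'a \<Rightarrow> real" and g' p w a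
    proof -
      have "((\<lambda>a. p + a *\<^sub>R w) has_derivative (\<lambda>h. h *\<^sub>R w)) (at a)"
        by (auto intro!: derivative_eq_intros)
      from diff_chain_at[OF this that]
      have "((\<lambda>a. g (p + a *\<^sub>R w)) has_derivative (\<lambda>h. g' (h *\<^sub>R w))) (at a)"
        by (simp add: o_def)
      moreover have "(\<lambda>h. g' (h *\<^sub>R w)) = (*) (g' w)"
        using linear_scale[OF has_derivative_linear[OF that]] by (auto simp: fun_eq_iff)
      ultimately show ?thesis by (simp add: has_field_derivative_def)
    qed
    have d\<phi>: "(\<phi> has_real_derivative Du (x + a *\<^sub>R u + t *\<^sub>R v) - Du (x + a *\<^sub>R u)) (at a)"
      if "0 \<le> a" "a \<le> t" for a
    proof -
      have "x + a *\<^sub>R u + t *\<^sub>R v \<in> S" "x + a *\<^sub>R u \<in> S"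
        using inb[of a t] inb[of a 0] that t e by auto
      then have "((\<lambda>a. f ((x + t *\<^sub>R v) + a *\<^sub>R u)) has_real_derivative Du ((x + t *\<^sub>R v) + a *\<^sub>R u)) (at a)"
        "((\<lambda>a. f (x + a *\<^sub>R u)) has_real_derivative Du (x + a *\<^sub>R u)) (at a)"
        unfolding Du_def
        by (intro line[of f "frechet_derivative f (at p)" for p] Ck_on_SucD(1)[OF C2];
            simp add: algebra_simps)+
      from DERIV_diff[OF this] show ?thesis
        by (simp add: \<phi>_def[abs_def] algebra_simps)
    qed
    obtain a where a: "0 < a" "a < t"
      "\<phi> t - \<phi> 0 = t * (Du (x + a *\<^sub>R u + t *\<^sub>R v) - Du (x + a *\<^sub>R u))"
      using MVT2[OF t(1) d\<phi>] by auto
    have dD: "((\<lambda>b. Du ((x + a *\<^sub>R u) + b *\<^sub>R v)) has_real_derivative P u v (x + a *\<^sub>R u + b *\<^sub>R v)) (at b)"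
      if "0 \<le> b" "b \<le> t" for b
    proof -
      have "x + a *\<^sub>R u + b *\<^sub>R v \<in> S" using inb[of a b] that t a e by auto
      then show ?thesis
        unfolding P_def Du_def by (intro line Ck_on_SucD(1)[OF Ck_on_SucD(2)[OF C2]])
    qed
    obtain b where b: "0 < b" "b < t"
      "Du (x + a *\<^sub>R u + t *\<^sub>R v) - Du (x + a *\<^sub>R u) = t * P u v (x + a *\<^sub>R u + b *\<^sub>R v)"
      using MVT2[OF t(1) dD] by auto
    show ?thesis
      by (rule bexI[OF _ inb[of a b]]) (use a b in \<open>auto simp: \<phi>_def\<close>)
  qed
  have "P u v x = P v u x"
  proof (rule ccontr)
    assume ne: "P u v x \<noteq> P v u x"
    \<comment> \<open>Half the supposed gap: two values closer than \<open>r\<close> to the two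
      distinct numbers cannot coincide.\<close>
    define r where "r = \<bar>P u v x - P v u x\<bar> / 2"
    have r: "r > 0" using ne by (simp add: r_def)
    have "isCont (P u v) x" "isCont (P v u) x"
      using contP assms(1,3) continuous_on_eq_continuous_at by blast+
    then obtain e1 e2 where e12: "e1 > 0" "\<And>y. y \<in> ball x e1 \<Longrightarrow> \<bar>P u v y - P u v x\<bar> < r"
      "e2 > 0" "\<And>y. y \<in> ball x e2 \<Longrightarrow> \<bar>P v u y - P v u x\<bar> < r"
      using r unfolding continuous_at_eps_delta dist_real_def
      by (metis dist_commute mem_ball)
    obtain e0 where e0: "e0 > 0" "ball x e0 \<subseteq> S" using assms(1,3) openE by blast
    define e where "e = min e0 (min e1 e2)"
    \<comment> \<open>The summand 1 keeps \<open>q\<close> positive when \<open>u\<close> and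
      \<open>v\<close> are both zero. With \<open>t * q = e / 2\<close> the parallelogram stays
      inside the ball of radius \<open>e\<close>.\<close>
    define q where "q = norm u + norm v + 1"
    define t where "t = e / q / 2"
    have e: "e > 0" "ball x e \<subseteq> S" using e0 e12 by (auto simp: e_def)
    have q: "q > 0" unfolding q_def by (auto intro!: add_nonneg_pos)
    have t: "t > 0" unfolding t_def using e(1) q by simp
    have eqe: "t * q = e / 2" using q by (simp add: t_def)
    have lt: "t * norm u + t * norm v < e"
      using eqe t e(1) by (simp add: q_def algebra_simps)
    then have lt': "t * norm v + t * norm u < e" by simp
    obtain y where y: "y \<in> ball x e"
      "f (x + t *\<^sub>R u + t *\<^sub>R v) - f (x + t *\<^sub>R u) - f (x + t *\<^sub>R v) + f x = t * t * P u v y"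
      using key[OF e(2) t lt] by auto
    obtain z where z: "z \<in> ball x e"
      "f (x + t *\<^sub>R v + t *\<^sub>R u) - f (x + t *\<^sub>R v) - f (x + t *\<^sub>R u) + f x = t * t * P v u z"
      using key[OF e(2) t lt'] by auto
    have "t * t * P u v y = t * t * P v u z"
      unfolding y(2)[symmetric] z(2)[symmetric] by (simp add: algebra_simps)
    then have "P u v y = P v u z" using t by simp
    moreover have "\<bar>P u v y - P u v x\<bar> < r" "\<bar>P v u z - P v u x\<bar> < r"
      using y z e12 by (auto simp: e_def)
    ultimately show False unfolding r_def by (simp add: abs_if split: if_splits)
  qed
  then show ?thesis by (simp add: P_def)
qed

lemma symmetric_derivative:
  fixes f :: "'a::euclidean_space \<Rightarrow> 'b::euclidean_space"
  assumes "open S" "Ck_on 2 S f" "x \<in> S"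
  shows "frechet_derivative (\<lambda>y. frechet_derivative f (at y) u) (at x) v =
         frechet_derivative (\<lambda>y. frechet_derivative f (at y) v) (at x) u"
proof (rule euclidean_eqI)
  fix b :: 'b assume "b \<in> Basis"
  note C2 = assms(2)[unfolded numeral_2_eq_2]
  have inner: "frechet_derivative (\<lambda>y. g y \<bullet> b) (at y) w = frechet_derivative g (at y) w \<bullet> b"
    if "(g has_derivative frechet_derivative g (at y)) (at y)" for g :: "'a \<Rightarrow> 'b" and y w
    using frechet_derivative_eqI[OF has_derivative_inner_left[OF that]] by metis
  have "frechet_derivative (\<lambda>y. frechet_derivative (\<lambda>y. f y \<bullet> b) (at y) u) (at x) v =
      frechet_derivative (\<lambda>y. frechet_derivative f (at y) u) (at x) v \<bullet> b" for u v
  proof -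
    have 1: "((\<lambda>y. frechet_derivative f (at y) u \<bullet> b) has_derivative
       (\<lambda>v. frechet_derivative (\<lambda>y. frechet_derivative f (at y) u) (at x) v \<bullet> b)) (at x)"
      by (rule has_derivative_inner_left[OF Ck_on_SucD(1)[OF Ck_on_SucD(2)[OF C2] assms(3)]])
    have "((\<lambda>y. frechet_derivative (\<lambda>y. f y \<bullet> b) (at y) u) has_derivative
       (\<lambda>v. frechet_derivative (\<lambda>y. frechet_derivative f (at y) u) (at x) v \<bullet> b)) (at x)"
      by (rule has_derivative_transform_within_open[OF 1 assms(1,3)])
        (simp add: inner[OF Ck_on_SucD(1)[OF C2]])
    from frechet_derivative_eqI[OF this] show ?thesis by simp
  qed
  moreover have "Ck_on 2 S (\<lambda>y. f y \<bullet> b)"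
    by (rule Ck_on_bounded_linear[OF bounded_linear_inner_left assms(1,2)])
  ultimately show "frechet_derivative (\<lambda>y. frechet_derivative f (at y) u) (at x) v \<bullet> b =
      frechet_derivative (\<lambda>y. frechet_derivative f (at y) v) (at x) u \<bullet> b"
    using symmetric_derivative_real[OF assms(1) _ assms(3)] by metis
qed

lemma norm_vector_scalar_mult: "norm (c *s v) = norm c * norm (v :: 'a::real_normed_field ^ 'n)"
  by (simp add: norm_vec_def norm_mult L2_set_right_distrib)

text \<open>The complex scaling \<open>*s\<close> differs from the real scaling of the normed space;
  as a real bounded bilinear map it obeys the product rules for derivatives and for
  \<open>Ck_on\<close>.\<close>

lemma bounded_bilinear_vector_scalar_mult:
  "bounded_bilinear (\<lambda>c v. c *s (v :: 'a::real_normed_field ^ 'n))"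
proof
  show "\<exists>K. \<forall>a b. norm (a *s b :: 'a ^ 'n) \<le> norm a * norm b * K"
    by (rule exI[of _ 1]) (simp add: norm_vector_scalar_mult)
qed (simp_all add: vec_eq_iff algebra_simps)

lemma bounded_linear_vector_scalar_mult:
  "bounded_linear (\<lambda>v :: 'a::real_normed_field ^ 'n. c *s v)"
  by (rule bounded_bilinear.bounded_linear_right[OF bounded_bilinear_vector_scalar_mult])

lemma bounded_linear_matrix_mult_left:
  "bounded_linear (\<lambda>B :: real^'n^'n. A ** B)"
  by (rule linear_conv_bounded_linear[THEN iffD1], rule linearI)
    (simp_all add: matrix_add_ldistrib matrix_matrix_mult_def vec_eq_iff
      sum_distrib_left sum.distrib algebra_simps)

lemma bounded_linear_matrix_vector_mult:
  "bounded_linear (\<lambda>v :: complex^'n. A *v v)"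
  by (rule linear_conv_bounded_linear[THEN iffD1], rule linearI)
    (simp_all add: matrix_vector_mult_def vec_eq_iff sum.distrib scaleR_sum_right algebra_simps)

section \<open>The matrix exponential\<close>

text \<open>Along a one-parameter subgroup every matrix entry is a real power series in
  \<open>t\<close>, dominated by an exponential series. This reduces differentiation of
  \<open>mat_exp\<close> to termwise differentiation of scalar series.\<close>

lemma mat_exp_powser:
  shows "summable (\<lambda>n. ((((**) A) ^^ n) (mat 1) $ i $ j / fact n) * t ^ n)"
    and "mat_exp (t *\<^sub>R A) $ i $ j = (\<Sum>n. ((((**) A) ^^ n) (mat 1) $ i $ j / fact n) * t ^ n)"
proof -
  let ?P = "\<lambda>A n. (((**) A) ^^ n) (mat 1) :: real^2^2"
  obtain K where K: "K \<ge> 0" "\<And>B :: real^2^2. norm (A ** B) \<le> norm B * K"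
    using bounded_linear.nonneg_bounded[OF bounded_linear_matrix_mult_left[of A]] by blast
  have P: "norm (?P A n) \<le> K ^ n * norm (mat 1 :: real^2^2)" for n
  proof (induction n)
    case (Suc n)
    have "norm (?P A (Suc n)) \<le> norm (?P A n) * K" using K(2)[of "?P A n"] by (simp only: funpow.simps o_apply)
    also have "\<dots> \<le> K ^ n * norm (mat 1 :: real^2^2) * K"
      by (rule mult_right_mono[OF Suc K(1)])
    finally show ?case by (simp add: algebra_simps)
  qed simp
  have scale: "?P (t *\<^sub>R A) n = t ^ n *\<^sub>R ?P A n" for n
    by (induction n) (simp_all add: matrix_matrix_mult_def vec_eq_iff sum_distrib_left algebra_simps)
  have sum: "summable (\<lambda>n. (t ^ n / fact n) *\<^sub>R ?P A n)"
  proof (rule summable_comparison_test')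
    show "summable (\<lambda>n. inverse (fact n) * (\<bar>t\<bar> * K) ^ n * norm (mat 1 :: real^2^2))"
      by (intro summable_mult2 summable_exp)
    fix n
    have "norm ((t ^ n / fact n) *\<^sub>R ?P A n) = \<bar>t\<bar> ^ n / fact n * norm (?P A n)"
      by (simp add: power_abs)
    also have "\<dots> \<le> \<bar>t\<bar> ^ n / fact n * (K ^ n * norm (mat 1 :: real^2^2))"
      by (intro mult_left_mono P) simp
    finally show "norm ((t ^ n / fact n) *\<^sub>R ?P A n) \<le>
        inverse (fact n) * (\<bar>t\<bar> * K) ^ n * norm (mat 1 :: real^2^2)"
      by (simp add: field_simps power_mult_distrib)
  qed
  have lin: "bounded_linear (\<lambda>B :: real^2^2. B $ i $ j)"
    by (rule bounded_linear_compose[OF bounded_linear_vec_nth bounded_linear_vec_nth])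
  show "summable (\<lambda>n. (?P A n $ i $ j / fact n) * t ^ n)"
    using bounded_linear.summable[OF lin sum] by (simp add: field_simps)
  have "mat_exp (t *\<^sub>R A) = (\<Sum>n. (t ^ n / fact n) *\<^sub>R ?P A n)"
    by (simp add: mat_exp_def scale divide_inverse mult.commute)
  then show "mat_exp (t *\<^sub>R A) $ i $ j = (\<Sum>n. (?P A n $ i $ j / fact n) * t ^ n)"
    using bounded_linear.suminf[OF lin sum] by (simp add: field_simps)
qed

lemma mat_exp_0: "mat_exp (0 *\<^sub>R A) = mat 1"
  unfolding vec_eq_iff mat_exp_powser(2)
  using powser_zero[of "\<lambda>n. (((**) A) ^^ n) (mat 1) $ i $ j / fact n" for i j] by simp

lemma mat_exp_deriv:
  "((\<lambda>t. mat_exp (t *\<^sub>R A) $ i $ j) has_real_derivative (A ** mat_exp (t *\<^sub>R A)) $ i $ j) (at t)"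
proof -
  let ?c = "\<lambda>i j n. (((**) A) ^^ n) (mat 1) $ i $ j / fact n"
  have "((\<lambda>t. \<Sum>n. ?c i j n * t ^ n) has_real_derivative (\<Sum>n. diffs (?c i j) n * t ^ n)) (at t)"
    by (rule termdiffs_strong_converges_everywhere) (rule mat_exp_powser)
  moreover have d: "diffs (?c i j) n * t ^ n = (\<Sum>k\<in>UNIV. A $ i $ k * (?c k j n * t ^ n))" for n
    by (simp add: diffs_def matrix_matrix_mult_def sum_divide_distrib sum_distrib_right sum_distrib_left
        field_simps del: of_nat_Suc)
  have "(\<Sum>n. \<Sum>k\<in>UNIV. A $ i $ k * (?c k j n * t ^ n)) =
      (\<Sum>k\<in>UNIV. A $ i $ k * (\<Sum>n. ?c k j n * t ^ n))"
    unfolding suminf_sum[OF summable_mult[OF mat_exp_powser(1)]] suminf_mult[OF mat_exp_powser(1)] ..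
  ultimately show ?thesis
    by (simp only: d mat_exp_powser(2) matrix_matrix_mult_def vec_lambda_beta)
qed

text \<open>The derivative of the determinant along the curve is the trace of \<open>A\<close> times
  the determinant, hence 0. So one-parameter curves of trace zero matrices do not leave
  \<open>SL2R\<close>.\<close>

lemma det_mat_exp:
  assumes "trace A = 0"
  shows "det (mat_exp (t *\<^sub>R A)) = 1"
proof -
  let ?D = "\<lambda>t. det (mat_exp (t *\<^sub>R A))"
  have tr: "A $ 2 $ 2 = - A $ 1 $ 1" using assms by (simp add: trace_def sum_2)
  have "(?D has_real_derivative 0) (at t)" for t
    unfolding det_2
    by (rule DERIV_cong[OF DERIV_diff[OF DERIV_mult[OF mat_exp_deriv mat_exp_deriv]
            DERIV_mult[OF mat_exp_deriv mat_exp_deriv]]])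
      (simp add: matrix_matrix_mult_def sum_2 tr algebra_simps)
  then have "?D t = ?D 0" by (intro DERIV_isconst_all) simp
  also have "\<dots> = 1" unfolding mat_exp_0 by (rule det_I)
  finally show ?thesis .
qed

section \<open>The action on the upper half plane\<close>

lemma carrier_SL2R: "g \<in> carrier SL2R \<longleftrightarrow> det g = 1"
  by (simp add: SL2R_def)

lemma carrier_SL2R_mult: "g \<in> carrier SL2R \<Longrightarrow> h \<in> carrier SL2R \<Longrightarrow> g ** h \<in> carrier SL2R"
  by (simp add: carrier_SL2R det_mul)

lemma open_upper_half_plane: "open upper_half_plane"
  unfolding upper_half_plane_def by (rule open_halfspace_Im_gt)

lemma automorphy_factor_nonzero:
  assumes "det g \<noteq> 0" "\<tau> \<in> upper_half_plane"
  shows "automorphy_factor g \<tau> \<noteq> 0"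
proof
  assume "automorphy_factor g \<tau> = 0"
  then have "g $ 2 $ 1 * Im \<tau> = 0" "g $ 2 $ 1 * Re \<tau> + g $ 2 $ 2 = 0"
    by (auto simp: automorphy_factor_def complex_eq_iff)
  then have "g $ 2 $ 1 = 0" "g $ 2 $ 2 = 0" using assms(2) by (auto simp: upper_half_plane_def)
  then show False using assms(1) by (simp add: det_2)
qed

text \<open>Positive determinant, rather than determinant 1, is an open condition; this allows lifts
  to be extended smoothly to a neighbourhood of \<open>SL2R\<close> in the matrix space.\<close>

lemma moebius_act_upper_half_plane:
  assumes "det g > 0" "\<tau> \<in> upper_half_plane"
  shows "moebius_act g \<tau> \<in> upper_half_plane"
proof -
  have "(cmod (automorphy_factor g \<tau>))\<^sup>2 > 0"
    using automorphy_factor_nonzero[of g \<tau>] assms by simp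
  moreover have "Im (moebius_act g \<tau>) = det g * Im \<tau> / (cmod (automorphy_factor g \<tau>))\<^sup>2"
    unfolding moebius_act_def automorphy_factor_def Im_divide cmod_power2
    by (simp add: det_2 algebra_simps)
  ultimately show ?thesis using assms by (simp add: upper_half_plane_def)
qed

lemma automorphy_factor_mult:
  assumes "automorphy_factor h \<tau> \<noteq> 0"
  shows "automorphy_factor (g ** h) \<tau> = automorphy_factor g (moebius_act h \<tau>) * automorphy_factor h \<tau>"
  using assms unfolding moebius_act_def automorphy_factor_def[of g] automorphy_factor_def[of "g ** h"]
  by (simp add: field_simps matrix_matrix_mult_def sum_2) (simp add: automorphy_factor_def algebra_simps)

lemma moebius_act_mult:
  assumes "automorphy_factor h \<tau> \<noteq> 0"
  shows "moebius_act (g ** h) \<tau> = moebius_act g (moebius_act h \<tau>)"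
proof -
  have "of_real ((g ** h) $ 1 $ 1) * \<tau> + of_real ((g ** h) $ 1 $ 2) =
      (of_real (g $ 1 $ 1) * moebius_act h \<tau> + of_real (g $ 1 $ 2)) * automorphy_factor h \<tau>"
    using assms unfolding moebius_act_def
    by (simp add: field_simps matrix_matrix_mult_def sum_2) (simp add: automorphy_factor_def algebra_simps)
  then show ?thesis
    using assms by (simp add: moebius_act_def[of "g ** h"] automorphy_factor_mult moebius_act_def[of g])
qed

text \<open>Cocycle property of the automorphy factor; with \<open>\<tau> = \<i>\<close> it
  describes both translations of a lift.\<close>

lemma slash_mult:
  assumes "automorphy_factor h \<tau> \<noteq> 0"
  shows "slash k f (g ** h) \<tau> =
    (automorphy_factor h \<tau> powi (- k)) *s slash k f g (moebius_act h \<tau>)"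
  using assms
  by (simp add: slash_def automorphy_factor_mult moebius_act_mult power_int_mult_distrib
      vector_smult_assoc mult.commute)

lemma i_upper_half_plane: "\<i> \<in> upper_half_plane"
  by (simp add: upper_half_plane_def)

lemma group_lift_left_mult:
  assumes "h \<in> carrier SL2R" "\<And>\<tau>. \<tau> \<in> upper_half_plane \<Longrightarrow> slash k f h \<tau> = M *v f \<tau>"
    "g \<in> carrier SL2R"
  shows "group_lift k f (h ** g) = M *v group_lift k f g"
proof -
  have "automorphy_factor g \<i> \<noteq> 0" "moebius_act g \<i> \<in> upper_half_plane"
    using assms(3) automorphy_factor_nonzero[OF _ i_upper_half_plane, of g]
      moebius_act_upper_half_plane[OF _ i_upper_half_plane, of g]
    by (auto simp: carrier_SL2R)
  then show ?thesis
    using assms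
    by (simp add: group_lift_def carrier_SL2R_mult slash_mult slash_def[of k f g] vector_scalar_commute)
qed

text \<open>A rotation fixes the point i, so only its automorphy factor there remains. That number
  is chosen before the weight and the function, so one \<open>c\<close> serves all weight components
  of a vector at once.\<close>

lemma group_lift_right_SO2R:
  assumes "\<kappa> \<in> SO2R"
  shows "\<exists>c. \<forall>k (f :: complex \<Rightarrow> complex^'n). Kact \<kappa> (group_lift k f) = fscale (c powi (- k)) (group_lift k f)"
proof -
  have det: "det \<kappa> = 1" and orth: "transpose \<kappa> ** \<kappa> = mat 1"
    using assms by (auto simp: SO2R_def orthogonal_matrix_def)
  define a b where "a = \<kappa> $ 1 $ 1" and "b = \<kappa> $ 1 $ 2"
  define c d where "c = \<kappa> $ 2 $ 1" and "d = \<kappa> $ 2 $ 2"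
  have 1: "a * d - b * c = 1" using det by (simp add: det_2 a_def b_def c_def d_def)
  have 2: "a * a + c * c = 1" "a * b + c * d = 0" "b * b + d * d = 1"
    using orth unfolding vec_eq_iff forall_2
    by (simp_all add: matrix_matrix_mult_def transpose_def sum_2 mat_def a_def b_def c_def d_def)
  \<comment> \<open>The two squares sum to the squared entries minus twice the determinant, that is
    2 - 2.\<close>
  have "(a - d)\<^sup>2 + (b + c)\<^sup>2 = 0" using 1 2 by (simp add: power2_eq_square algebra_simps)
  then have ab: "d = a" "c = - b" by (auto simp: sum_power2_eq_zero_iff)
  have nz: "automorphy_factor \<kappa> \<i> \<noteq> 0"
    using automorphy_factor_nonzero[OF _ i_upper_half_plane, of \<kappa>] det by simp
  have "moebius_act \<kappa> \<i> = (of_real a * \<i> + of_real b) / automorphy_factor \<kappa> \<i>"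
    by (simp add: moebius_act_def a_def b_def)
  also have "of_real a * \<i> + of_real b = \<i> * automorphy_factor \<kappa> \<i>"
    using ab by (simp add: automorphy_factor_def c_def d_def algebra_simps)
  finally have fix_i: "moebius_act \<kappa> \<i> = \<i>" using nz by simp
  have iff: "g ** \<kappa> \<in> carrier SL2R \<longleftrightarrow> g \<in> carrier SL2R" for g
    using det by (simp add: carrier_SL2R det_mul)
  show ?thesis
    by (intro exI[of _ "automorphy_factor \<kappa> \<i>"] allI ext)
      (simp add: Kact_def fscale_def group_lift_def iff slash_mult[OF nz] fix_i)
qed

section \<open>Weight raising and lowering\<close>

text \<open>A real linear map on the complex numbers splits into a complex linear and a conjugate
  linear part; the Wirtinger derivatives are the two coefficients.\<close>

lemma frechet_derivative_d_tau:
  assumes "(f has_derivative D) (at \<tau>)"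
  shows "D w = w *s d_tau f \<tau> + cnj w *s d_taubar f \<tau>"
proof -
  have D: "frechet_derivative f (at \<tau>) = D" by (rule frechet_derivative_eqI[OF assms])
  have lin: "linear D" by (rule has_derivative_linear[OF assms])
  have "D w = D (Re w *\<^sub>R 1 + Im w *\<^sub>R \<i>)"
    by (rule arg_cong[where f = D]) (simp add: complex_eq_iff)
  also have "\<dots> = Re w *\<^sub>R D 1 + Im w *\<^sub>R D \<i>"
    by (simp only: linear_add[OF lin] linear_scale[OF lin])
  also have "\<dots> = w *s d_tau f \<tau> + cnj w *s d_taubar f \<tau>"
    by (simp add: vec_eq_iff d_tau_def d_taubar_def D complex_eq_iff field_simps)
  finally show ?thesis .
qed

lemma smooth_Ck_on:
  "smooth_on_open S f \<Longrightarrow> Ck_on n S f"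
  by (simp add: smooth_on_open_def)

lemma smooth_has_derivative:
  "smooth_on_open S f \<Longrightarrow> x \<in> S \<Longrightarrow> (f has_derivative frechet_derivative f (at x)) (at x)"
  using Ck_on_SucD(1)[OF smooth_Ck_on] .

lemma Ck_on_frechet_derivative:
  "smooth_on_open S f \<Longrightarrow> Ck_on n S (\<lambda>x. frechet_derivative f (at x) v)"
  using Ck_on_SucD(2)[OF smooth_Ck_on] .

lemma Ck_on_scalar_mult:
  "open S \<Longrightarrow> Ck_on n S u \<Longrightarrow> Ck_on n S f \<Longrightarrow> Ck_on n S (\<lambda>x. u x *s (f x :: complex^'n))"
  by (rule Ck_on_bilinear[OF bounded_bilinear_vector_scalar_mult])

lemma Ck_on_linear:
  fixes L :: "'a::euclidean_space \<Rightarrow> 'b::real_normed_vector"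
  shows "bounded_linear L \<Longrightarrow> open S \<Longrightarrow> Ck_on n S L"
  using Ck_on_bounded_linear[OF _ _ Ck_on_id] .

lemma Ck_on_Im: "Ck_on n upper_half_plane (\<lambda>\<tau>. complex_of_real (Im \<tau>))"
  by (rule Ck_on_linear[OF bounded_linear_compose[OF bounded_linear_of_real bounded_linear_Im]
        open_upper_half_plane])

lemma Ck_on_d_tau:
  assumes "smooth_on_open upper_half_plane f"
  shows "Ck_on n upper_half_plane (d_tau f)" "Ck_on n upper_half_plane (d_taubar f)"
proof -
  have "Ck_on n upper_half_plane (\<lambda>\<tau>. (1 / 2) *s (frechet_derivative f (at \<tau>) 1 + c *s frechet_derivative f (at \<tau>) \<i>))" for c
    by (intro Ck_on_bounded_linear[OF bounded_linear_vector_scalar_mult] open_upper_half_plane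
        Ck_on_add Ck_on_frechet_derivative assms)
  from this[of "- \<i>"] this[of \<i>]
  show "Ck_on n upper_half_plane (d_tau f)" "Ck_on n upper_half_plane (d_taubar f)"
    by (simp_all add: d_tau_def[abs_def] d_taubar_def[abs_def])
qed

lemma smooth_raising_op:
  assumes "smooth_on_open upper_half_plane f"
  shows "smooth_on_open upper_half_plane (raising_op k f)"
proof -
  have "Ck_on n upper_half_plane (raising_op k f)" for n
    unfolding raising_op_def[abs_def]
    by (intro Ck_on_add Ck_on_scalar_mult Ck_on_const Ck_on_d_tau assms open_upper_half_plane
        Ck_on_bilinear[OF bounded_bilinear_mult] Ck_on_inverse Ck_on_Im smooth_Ck_on)
      (auto simp: upper_half_plane_def)
  then show ?thesis by (simp add: smooth_on_open_def open_upper_half_plane)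
qed

lemma smooth_lowering_op:
  assumes "smooth_on_open upper_half_plane f"
  shows "smooth_on_open upper_half_plane (lowering_op k f)"
proof -
  have "Ck_on n upper_half_plane (lowering_op k f)" for n
    unfolding lowering_op_def[abs_def] power2_eq_square of_real_mult
    by (intro Ck_on_scalar_mult Ck_on_const Ck_on_d_tau assms open_upper_half_plane
        Ck_on_bilinear[OF bounded_bilinear_mult] Ck_on_Im)
  then show ?thesis by (simp add: smooth_on_open_def open_upper_half_plane)
qed

lemma group_lift_smooth:
  assumes "smooth_on_open upper_half_plane f"
  shows "group_lift k f \<in> smooth_functions"
proof -
  \<comment> \<open>An open neighbourhood of the whole group on which the defining formula of the
    lift still makes sense; that formula is the smooth extension.\<close>
  let ?U = "{g :: real^2^2. det g > 0}"
  have lin: "bounded_linear (\<lambda>g :: real^2^2. complex_of_real (g $ i $ j))" for i j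
    by (intro bounded_linear_compose[OF bounded_linear_of_real]
        bounded_linear_compose[OF bounded_linear_vec_nth bounded_linear_vec_nth])
  have "continuous_on UNIV (\<lambda>g :: real^2^2. det g)"
    unfolding det_2 by (intro continuous_intros)
  then have U: "open ?U"
    using open_Collect_less[of "\<lambda>g. 0" "\<lambda>g :: real^2^2. det g"] by simp
  have nz: "automorphy_factor g \<i> \<noteq> 0" and uhp: "moebius_act g \<i> \<in> upper_half_plane" if "g \<in> ?U" for g
    using that automorphy_factor_nonzero[OF _ i_upper_half_plane, of g]
      moebius_act_upper_half_plane[OF _ i_upper_half_plane, of g] by auto
  have row: "Ck_on n ?U (\<lambda>g. of_real (g $ i $ 1) * \<i> + of_real (g $ i $ 2))" for n i
    by (intro Ck_on_add Ck_on_bilinear[OF bounded_bilinear_mult] Ck_on_const Ck_on_linear lin U)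
  have j: "Ck_on n ?U (\<lambda>g. automorphy_factor g \<i>)" for n
    using row[of n 2] by (simp add: automorphy_factor_def)
  have "Ck_on n ?U (\<lambda>g. moebius_act g \<i>)" for n
    unfolding moebius_act_def divide_inverse
    by (intro Ck_on_bilinear[OF bounded_bilinear_mult] row Ck_on_inverse U j nz)
  then have "Ck_on n ?U (\<lambda>g. f (moebius_act g \<i>))" for n
    using uhp by (intro Ck_on_compose[OF U _ _ smooth_Ck_on[OF assms]]) auto
  then have "Ck_on n ?U (\<lambda>g. slash k f g \<i>)" for n
    unfolding slash_def by (intro Ck_on_scalar_mult U Ck_on_power_int j nz)
  then have "smooth_on_open ?U (\<lambda>g. slash k f g \<i>)"
    using U by (simp add: smooth_on_open_def)
  then have "\<exists>U F. g \<in> U \<and> smooth_on_open U F \<and> (\<forall>h\<in>U \<inter> carrier SL2R. F h = group_lift k f h)"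
    if "g \<in> carrier SL2R" for g
    using that by (intro exI[of _ ?U] exI[of _ "\<lambda>g. slash k f g \<i>"])
      (auto simp: group_lift_def carrier_SL2R)
  then show ?thesis by (auto simp: smooth_functions_def group_lift_def)
qed

text \<open>The derivative of \<open>\<lambda>g. slash k f g \<i>\<close> along \<open>g Z\<close>, with \<open>j\<close> the automorphy factor at
  \<open>\<i>\<close>, extended complex linearly in \<open>Z\<close>: for real \<open>Z\<close> the coefficient of \<open>d_taubar\<close> is the conjugate
  of that of \<open>d_tau\<close>.\<close>

definition lift_derivative ::
    "int \<Rightarrow> (complex \<Rightarrow> complex^'n) \<Rightarrow> complex^2^2 \<Rightarrow> real^2^2 \<Rightarrow> complex^'n" where
  "lift_derivative k f Z g = (let c = of_real (g $ 2 $ 1); d = of_real (g $ 2 $ 2);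
      j = automorphy_factor g \<i>; z = moebius_act g \<i>;
      P = Z $ 1 $ 1; Q = Z $ 1 $ 2; R = Z $ 2 $ 1 in
    (- of_int k * j powi (- k - 1) * (\<i> * (c * P + d * R) + c * Q - d * P)) *s f z
    + j powi (- k) *s (((2 * \<i> * P + Q + R) / j\<^sup>2) *s d_tau f z
        + ((- 2 * \<i> * P + Q + R) / (cnj j)\<^sup>2) *s d_taubar f z))"

lemma group_lift_has_vector_derivative:
  assumes f: "smooth_on_open upper_half_plane f" and g: "g \<in> carrier SL2R" and A: "trace A = 0"
  shows "((\<lambda>t. group_lift k f (g ** mat_exp (t *\<^sub>R A))) has_vector_derivative
    lift_derivative k f (\<chi> i j. of_real (A $ i $ j)) g) (at 0)"
proof -
  define E where "E t = g ** mat_exp (t *\<^sub>R A)" for t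
  have E: "E t \<in> carrier SL2R" for t
    using g det_mat_exp[OF A] by (simp add: E_def carrier_SL2R det_mul)
  have E0: "E 0 = g" by (simp only: E_def mat_exp_0 matrix_mul_rid)
  have dE: "((\<lambda>t. E t $ i $ j) has_real_derivative (g ** A) $ i $ j) (at 0)" for i j
  proof -
    have "((\<lambda>t. \<Sum>k\<in>UNIV. g $ i $ k * mat_exp (t *\<^sub>R A) $ k $ j) has_real_derivative
        (\<Sum>k\<in>UNIV. g $ i $ k * (A ** mat_exp (0 *\<^sub>R A)) $ k $ j)) (at 0)"
      by (intro DERIV_sum DERIV_cmult mat_exp_deriv)
    then show ?thesis
      unfolding E_def mat_exp_0 matrix_mul_rid by (simp add: matrix_matrix_mult_def)
  qed
  have tr: "A $ 2 $ 2 = - A $ 1 $ 1" using A by (simp add: trace_def sum_2)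
  define a b c d where "a = g $ 1 $ 1" and "b = g $ 1 $ 2" and "c = g $ 2 $ 1" and "d = g $ 2 $ 2"
  define p q r where "p = A $ 1 $ 1" and "q = A $ 1 $ 2" and "r = A $ 2 $ 1"
  note defs = a_def b_def c_def d_def p_def q_def r_def
  define j z where "j = automorphy_factor g \<i>" and "z = moebius_act g \<i>"
  have nz: "j \<noteq> 0" and z: "z \<in> upper_half_plane"
    using g automorphy_factor_nonzero[OF _ i_upper_half_plane, of g]
      moebius_act_upper_half_plane[OF _ i_upper_half_plane, of g]
    by (auto simp: carrier_SL2R j_def z_def)
  \<comment> \<open>Along the curve the matrix has derivative \<open>g ** A\<close>. Its second row
    gives the derivative \<open>j'\<close> of the automorphy factor, its first row the derivative
    \<open>n'\<close> of the numerator; the entry \<open>A $ 2 $ 2\<close> is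
    \<open>- p\<close>.\<close>
  define j' where "j' = \<i> * of_real (c * p + d * r) + of_real (c * q - d * p)"
  define n' where "n' = \<i> * of_real (a * p + b * r) + of_real (a * q - b * p)"
  \<comment> \<open>The flow of \<open>A\<close> moves \<open>\<tau>\<close> with velocity
    \<open>q + 2 p \<tau> - r \<tau>^2\<close>, which at i equals \<open>2 \<i> p + q + r\<close>;
    applying \<open>g\<close> multiplies it by the derivative of its Moebius map at i,
    \<open>1 / j^2\<close>.\<close>
  define w where "w = (2 * \<i> * of_real p + of_real q + of_real r) / j\<^sup>2"
  have drow: "((\<lambda>t. complex_of_real (E t $ i $ 1) * \<i> + of_real (E t $ i $ 2)) has_vector_derivative
      of_real ((g ** A) $ i $ 1) * \<i> + of_real ((g ** A) $ i $ 2)) (at 0)" for i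
    by (intro has_vector_derivative_add has_vector_derivative_of_real
        bounded_linear.has_vector_derivative[OF bounded_linear_mult_left]
        has_real_derivative_iff_has_vector_derivative[THEN iffD1] dE)
  have dj: "((\<lambda>t. automorphy_factor (E t) \<i>) has_vector_derivative j') (at 0)"
    using drow[of 2] by (simp add: automorphy_factor_def j'_def defs matrix_matrix_mult_def sum_2 tr
        algebra_simps)
  have dn: "((\<lambda>t. complex_of_real (E t $ 1 $ 1) * \<i> + of_real (E t $ 1 $ 2)) has_vector_derivative n') (at 0)"
    using drow[of 1] by (simp add: n'_def defs matrix_matrix_mult_def sum_2 tr algebra_simps)
  have jE0: "automorphy_factor (E 0) \<i> = j" by (simp add: E0 j_def)
  have dinv: "((\<lambda>t. inverse (automorphy_factor (E t) \<i>)) has_vector_derivative - j' / j\<^sup>2) (at 0)"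
  proof -
    have "(inverse has_field_derivative - (inverse j)\<^sup>2) (at (automorphy_factor (E 0) \<i>))"
      unfolding jE0 using DERIV_inverse[OF nz] by (simp add: power2_eq_square)
    from field_vector_diff_chain_at[OF dj this] show ?thesis
      by (simp add: o_def divide_inverse power_inverse)
  qed
  have dz: "((\<lambda>t. moebius_act (E t) \<i>) has_vector_derivative w) (at 0)"
  proof -
    have det: "a * d - b * c = 1" using g by (simp add: carrier_SL2R det_2 defs)
    have "((\<lambda>t. moebius_act (E t) \<i>) has_vector_derivative
        (of_real a * \<i> + of_real b) * (- j' / j\<^sup>2) + n' * inverse j) (at 0)"
      using bounded_bilinear.has_vector_derivative[OF bounded_bilinear_mult dn dinv]
      unfolding jE0 by (simp add: moebius_act_def divide_inverse E0 a_def b_def)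
    also have "(of_real a * \<i> + of_real b) * (- j' / j\<^sup>2) + n' * inverse j =
        (n' * j - (of_real a * \<i> + of_real b) * j') / j\<^sup>2"
      using nz by (simp add: field_simps power2_eq_square)
    also have "n' * j - (of_real a * \<i> + of_real b) * j' =
        of_real (a * d - b * c) * (2 * \<i> * of_real p + of_real q + of_real r)"
      by (simp add: n'_def j'_def j_def automorphy_factor_def c_def[symmetric] d_def[symmetric]
          complex_eq_iff algebra_simps)
    finally show ?thesis by (simp add: det w_def)
  qed
  have dpow: "((\<lambda>t. automorphy_factor (E t) \<i> powi (- k)) has_vector_derivative
      - of_int k * j powi (- k - 1) * j') (at 0)"
  proof -
    have "((\<lambda>x. x powi (- k)) has_field_derivative of_int (- k) * j powi (- k - 1) * 1) (at j)"
      by (rule DERIV_power_int[OF DERIV_ident disjI2[OF nz]])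
    then have "((\<lambda>x. x powi (- k)) has_field_derivative of_int (- k) * j powi (- k - 1))
        (at (automorphy_factor (E 0) \<i>))" by (simp add: jE0)
    from field_vector_diff_chain_at[OF dj this] show ?thesis by (simp add: o_def algebra_simps)
  qed
  have df: "((\<lambda>t. f (moebius_act (E t) \<i>)) has_vector_derivative
      w *s d_tau f z + cnj w *s d_taubar f z) (at 0)"
  proof -
    have zE0: "moebius_act (E 0) \<i> = z" by (simp add: E0 z_def)
    note D = smooth_has_derivative[OF f z]
    have "((f \<circ> (\<lambda>t. moebius_act (E t) \<i>)) has_vector_derivative frechet_derivative f (at z) w) (at 0)"
      by (rule vector_derivative_diff_chain_within[OF dz])
        (simp add: zE0 has_derivative_at_withinI[OF D])
    then show ?thesis by (simp add: o_def frechet_derivative_d_tau[OF D])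
  qed
  have "((\<lambda>t. automorphy_factor (E t) \<i> powi (- k) *s f (moebius_act (E t) \<i>)) has_vector_derivative
      j powi (- k) *s (w *s d_tau f z + cnj w *s d_taubar f z) +
      (- of_int k * j powi (- k - 1) * j') *s f z) (at 0)"
    using bounded_bilinear.has_vector_derivative[OF bounded_bilinear_vector_scalar_mult dpow df]
    by (simp add: E0 j_def z_def)
  then show ?thesis
    using E unfolding E_def[symmetric] lift_derivative_def Let_def
    by (simp add: group_lift_def slash_def j_def[symmetric] z_def[symmetric] w_def j'_def
        defs algebra_simps)
qed

text \<open>The three coefficients are the coordinates of \<open>Z\<close> in the basis H, X, Y.
  Treating all of \<open>Z\<close> in one computation gives the actions of the basis elements and
  also the reduction of any \<open>gact Z\<close> to them.\<close>

lemma gact_group_lift: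
  assumes f: "smooth_on_open upper_half_plane f" and Z: "Z \<in> sl2C"
  shows "gact Z (group_lift k f) =
    fscale (- \<i> * (Z $ 2 $ 1 - Z $ 1 $ 2) / 2) (fscale (of_int k) (group_lift k f))
    + fscale (Z $ 1 $ 1 - \<i> * (Z $ 2 $ 1 + Z $ 1 $ 2) / 2) (group_lift (k + 2) (raising_op k f))
    + fscale (Z $ 1 $ 1 + \<i> * (Z $ 2 $ 1 + Z $ 1 $ 2) / 2) (group_lift (k - 2) (lowering_op k f))"
proof
  fix g
  define P Q R where "P = Z $ 1 $ 1" and "Q = Z $ 1 $ 2" and "R = Z $ 2 $ 1"
  define ZR ZI where "ZR = (\<chi> i j. Re (Z $ i $ j))" and "ZI = (\<chi> i j. Im (Z $ i $ j))"
  show "gact Z (group_lift k f) g = (fscale (- \<i> * (Z $ 2 $ 1 - Z $ 1 $ 2) / 2) (fscale (of_int k) (group_lift k f))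
    + fscale (Z $ 1 $ 1 - \<i> * (Z $ 2 $ 1 + Z $ 1 $ 2) / 2) (group_lift (k + 2) (raising_op k f))
    + fscale (Z $ 1 $ 1 + \<i> * (Z $ 2 $ 1 + Z $ 1 $ 2) / 2) (group_lift (k - 2) (lowering_op k f))) g"
  proof (cases "g \<in> carrier SL2R")
    case False
    then show ?thesis by (simp add: gact_def lie_deriv_def fscale_def group_lift_def)
  next
    case g: True
    have tr: "trace ZR = 0" "trace ZI = 0"
      using Z by (simp_all add: sl2C_def trace_def sum_2 ZR_def ZI_def complex_eq_iff)
    define c d where "c = g $ 2 $ 1" and "d = g $ 2 $ 2"
    define j z where "j = automorphy_factor g \<i>" and "z = moebius_act g \<i>"
    have nz: "j \<noteq> 0"
      using g automorphy_factor_nonzero[OF _ i_upper_half_plane, of g]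
      by (auto simp: carrier_SL2R j_def)
    have j: "j = of_real c * \<i> + of_real d" "cnj j = - of_real c * \<i> + of_real d"
      by (auto simp: j_def automorphy_factor_def c_def d_def)
    \<comment> \<open>This turns the powers of the imaginary part in the raising and lowering
      operators into powers of \<open>j * cnj j\<close>.\<close>
    have "Im z = 1 / (cmod j)\<^sup>2"
      using g unfolding z_def moebius_act_def j_def[symmetric] Im_divide j cmod_power2
      by (simp add: carrier_SL2R det_2 c_def d_def algebra_simps)
    then have Im: "complex_of_real (Im z) = 1 / (j * cnj j)"
      by (simp only: of_real_divide of_real_1 complex_norm_square)
    have "gact Z (group_lift k f) g =
        lift_derivative k f (\<chi> i j. of_real (ZR $ i $ j)) g + \<i> *s lift_derivative k f (\<chi> i j. of_real (ZI $ i $ j)) g"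
      using g by (simp add: gact_def lie_deriv_def fscale_def ZR_def[symmetric] ZI_def[symmetric]
          vector_derivative_at[OF group_lift_has_vector_derivative[OF f g tr(1)]]
          vector_derivative_at[OF group_lift_has_vector_derivative[OF f g tr(2)]])
    also have "\<dots> = lift_derivative k f Z g"
    proof -
      have Z_eq: "Z $ i $ j = of_real (ZR $ i $ j) + \<i> * of_real (ZI $ i $ j)" for i j
        by (simp add: ZR_def ZI_def complex_eq_iff)
      show ?thesis
        unfolding lift_derivative_def Let_def Z_eq[of 1 1] Z_eq[of 1 2] Z_eq[of 2 1]
        by (simp add: vec_eq_iff add_divide_distrib diff_divide_distrib algebra_simps)
    qed
    also have "\<dots> = (- of_int k * j powi (- k - 1) * (\<i> * (of_real c * P + of_real d * R) + of_real c * Q - of_real d * P)) *s f z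
    + j powi (- k) *s (((2 * \<i> * P + Q + R) / j\<^sup>2) *s d_tau f z
        + ((- 2 * \<i> * P + Q + R) / (cnj j)\<^sup>2) *s d_taubar f z)"
      by (simp add: lift_derivative_def Let_def j_def z_def P_def Q_def R_def c_def d_def)
    also have "\<dots> = (- \<i> * (R - Q) / 2) *s (of_int k *s (j powi (- k) *s f z))
      + (P - \<i> * (R + Q) / 2) *s (j powi (- (k + 2)) *s raising_op k f z)
      + (P + \<i> * (R + Q) / 2) *s (j powi (- (k - 2)) *s lowering_op k f z)"
    proof -
      have pw: "j powi (- k - 1) = j powi (- k) / j" "j powi (- (k + 2)) = j powi (- k) / j\<^sup>2"
        "j powi (- (k - 2)) = j powi (- k) * j\<^sup>2"
        using nz power_int_diff[of j "- k" 1] power_int_diff[of j "- k" 2] power_int_add[of j "- k" 2]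
        by (auto simp: algebra_simps)
      \<comment> \<open>Coefficient of \<open>f z\<close>. Writing the derivative of the automorphy
        factor in terms of \<open>j\<close> and \<open>cnj j\<close> separates the H part from the
        zeroth order term of the raising operator. \<open>T\<close> and \<open>B\<close> below are
        the coefficients of \<open>d_tau f z\<close> and \<open>d_taubar f z\<close>.\<close>
      have F: "- of_int k * (e / j) * (\<i> * (of_real c * P + of_real d * R) + of_real c * Q - of_real d * P) =
         (- \<i> * (R - Q) / 2) * (of_int k * e) + (P - \<i> * (R + Q) / 2) * (e / j\<^sup>2 * (of_int k * (j * cnj j)))" for e
      proof -
        have "- (\<i> * (of_real c * P + of_real d * R) + of_real c * Q - of_real d * P) =
          (- \<i> * (R - Q) / 2) * j + (P - \<i> * (R + Q) / 2) * cnj j"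
          unfolding j by (simp add: field_simps)
        then have "- of_int k * (e / j) * (\<i> * (of_real c * P + of_real d * R) + of_real c * Q - of_real d * P) =
          of_int k * (e / j) * ((- \<i> * (R - Q) / 2) * j + (P - \<i> * (R + Q) / 2) * cnj j)"
          by (metis minus_mult_left minus_mult_right)
        also have "\<dots> = (- \<i> * (R - Q) / 2) * (of_int k * e) + (P - \<i> * (R + Q) / 2) * (e / j\<^sup>2 * (of_int k * (j * cnj j)))"
          using nz by (simp add: field_simps power2_eq_square)
        finally show ?thesis .
      qed
      have T: "e * ((2 * \<i> * P + Q + R) / j\<^sup>2) = (P - \<i> * (R + Q) / 2) * (e / j\<^sup>2 * (2 * \<i>))" for e
        using nz by (simp add: field_simps)
      have B: "e * ((- 2 * \<i> * P + Q + R) / (cnj j)\<^sup>2) =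
         (P + \<i> * (R + Q) / 2) * (e * j\<^sup>2 * (- 2 * \<i> * (1 / (j * cnj j))\<^sup>2))" for e
        using nz by (simp add: field_simps power2_eq_square)
      have collect: "x * u + e * (t * v + b * w) =
          x1 * (m * (e * u)) + x2 * (g * (h * v + m * y * u)) + x3 * (p * (q * w))"
        if "x = x1 * (m * e) + x2 * (g * (m * y))" "e * t = x2 * (g * h)" "e * b = x3 * (p * q)"
        for x u e t v b w x1 x2 x3 m g h y p q :: complex
      proof -
        have "x * u + e * (t * v + b * w) = x * u + (e * t) * v + (e * b) * w"
          by (simp add: algebra_simps)
        also have "\<dots> = x1 * (m * (e * u)) + x2 * (g * (h * v + m * y * u)) + x3 * (p * (q * w))"
          unfolding that by (simp add: algebra_simps)
        finally show ?thesis .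
      qed
      have inv: "inverse (1 / (j * cnj j)) = j * cnj j" by simp
      show ?thesis
        unfolding vec_eq_iff raising_op_def lowering_op_def of_real_power Im inv pw
          vector_add_component vector_smult_component
        by (intro allI collect F T B)
    qed
    finally show ?thesis
      unfolding plus_fun_def fscale_def group_lift_def slash_def j_def z_def P_def Q_def R_def
      by (simp only: g if_True)
  qed
qed

lemma smooth_second_derivative:
  "smooth_on_open S f \<Longrightarrow> x \<in> S \<Longrightarrow> ((\<lambda>x. frechet_derivative f (at x) v) has_derivative
     frechet_derivative (\<lambda>x. frechet_derivative f (at x) v) (at x)) (at x)"
  using Ck_on_SucD(1)[OF Ck_on_frechet_derivative] .

text \<open>The relation [X, Y] = H in weight \<open>k\<close>. The second order terms agree because
  mixed derivatives do. On the left, the shift of the weight to \<open>k - 2\<close> cancels the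
  derivative of y^2, so the first order terms agree too. The remaining multiple of \<open>f\<close>
  is what the lowering operator makes of the coefficient k / y.\<close>

lemma raising_lowering_commutator:
  assumes f: "smooth_on_open upper_half_plane f" and \<tau>: "\<tau> \<in> upper_half_plane"
  shows "raising_op (k - 2) (lowering_op k f) \<tau> =
    lowering_op (k + 2) (raising_op k f) \<tau> + of_int k *s f \<tau>"
proof -
  define D where "D v = frechet_derivative f (at \<tau>) v" for v
  define D2 where "D2 u v = frechet_derivative (\<lambda>x. frechet_derivative f (at x) u) (at \<tau>) v" for u v
  have sym: "D2 \<i> 1 = D2 1 \<i>"
    unfolding D2_def
    by (rule symmetric_derivative[OF open_upper_half_plane smooth_Ck_on[OF f] \<tau>])
  have y: "Im \<tau> \<noteq> 0" using \<tau> by (auto simp: upper_half_plane_def)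
  note dD = smooth_second_derivative[OF f \<tau>]
  have dp: "(d_tau f has_derivative (\<lambda>v. (1 / 2) *s (D2 1 v - \<i> *s D2 \<i> v))) (at \<tau>)"
    unfolding d_tau_def[abs_def] D2_def
    by (intro bounded_linear.has_derivative[OF bounded_linear_vector_scalar_mult]
        has_derivative_diff dD)
  have dq: "(d_taubar f has_derivative (\<lambda>v. (1 / 2) *s (D2 1 v + \<i> *s D2 \<i> v))) (at \<tau>)"
    unfolding d_taubar_def[abs_def] D2_def
    by (intro bounded_linear.has_derivative[OF bounded_linear_vector_scalar_mult]
        has_derivative_add dD)
  have du: "((\<lambda>\<tau>. - 2 * \<i> * complex_of_real ((Im \<tau>)\<^sup>2)) has_derivative
      (\<lambda>v. - 2 * \<i> * complex_of_real (2 * Im \<tau> * Im v))) (at \<tau>)"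
    by (auto intro!: derivative_eq_intros simp: fun_eq_iff ac_simps)
  have dv: "((\<lambda>\<tau>. of_int k * inverse (complex_of_real (Im \<tau>))) has_derivative
      (\<lambda>v. of_int k * - (inverse (of_real (Im \<tau>)) * of_real (Im v) * inverse (of_real (Im \<tau>))))) (at \<tau>)"
    using y by (auto intro!: derivative_eq_intros)
  note bil = bounded_bilinear.FDERIV[OF bounded_bilinear_vector_scalar_mult]
  have dL: "frechet_derivative (lowering_op k f) (at \<tau>) =
     (\<lambda>v. (- 2 * \<i> * of_real ((Im \<tau>)\<^sup>2)) *s ((1 / 2) *s (D2 1 v + \<i> *s D2 \<i> v)) +
          (- 2 * \<i> * complex_of_real (2 * Im \<tau> * Im v)) *s d_taubar f \<tau>)"
    unfolding lowering_op_def[abs_def] by (rule frechet_derivative_eqI[OF bil[OF du dq]])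
  have dR: "frechet_derivative (raising_op k f) (at \<tau>) =
     (\<lambda>v. (2 * \<i>) *s ((1 / 2) *s (D2 1 v - \<i> *s D2 \<i> v)) +
        ((of_int k * inverse (of_real (Im \<tau>))) *s D v +
         (of_int k * - (inverse (of_real (Im \<tau>)) * of_real (Im v) * inverse (of_real (Im \<tau>)))) *s f \<tau>))"
    unfolding raising_op_def[abs_def] D_def
    by (rule frechet_derivative_eqI[OF has_derivative_add[OF
          bounded_linear.has_derivative[OF bounded_linear_vector_scalar_mult dp]
          bil[OF dv smooth_has_derivative[OF f \<tau>]]]])
  define Y where "Y = complex_of_real (Im \<tau>)"
  have Y: "Y \<noteq> 0" using y by (simp add: Y_def)
  show ?thesis
    unfolding raising_op_def[of "k - 2"] lowering_op_def[of "k + 2"] d_tau_def[of "lowering_op k f"]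
      d_taubar_def[of "raising_op k f"] dL dR
    unfolding raising_op_def lowering_op_def d_tau_def d_taubar_def D_def[symmetric] sym
    using Y
    by (simp add: vec_eq_iff Y_def[symmetric] power2_eq_square)
      (simp add: field_simps)
qed

section \<open>The Lie algebra action on curve-differentiable functions\<close>

text \<open>\<open>vector_derivative\<close> is meaningful only where a derivative exists, so the
  linearity of \<open>gact\<close> is stated for such functions. They form a subspace that contains
  all lifts.\<close>

definition curve_differentiable :: "(real^2^2 \<Rightarrow> complex^'n) \<Rightarrow> bool" where
  "curve_differentiable \<phi> \<longleftrightarrow> (\<forall>g\<in>carrier SL2R. \<forall>A. trace A = 0 \<longrightarrow>
     (\<lambda>t. \<phi> (g ** mat_exp (t *\<^sub>R A))) differentiable at 0)"

lemma lie_deriv_works: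
  assumes "curve_differentiable \<phi>" "g \<in> carrier SL2R" "trace A = 0"
  shows "((\<lambda>t. \<phi> (g ** mat_exp (t *\<^sub>R A))) has_vector_derivative lie_deriv A \<phi> g) (at 0)"
  using assms by (simp add: curve_differentiable_def lie_deriv_def vector_derivative_works[symmetric])

lemma lie_deriv_eqI:
  assumes "g \<in> carrier SL2R"
    "((\<lambda>t. \<phi> (g ** mat_exp (t *\<^sub>R A))) has_vector_derivative v) (at 0)"
  shows "lie_deriv A \<phi> g = v"
  using assms by (simp add: lie_deriv_def vector_derivative_at)

lemma trace_Re_Im:
  assumes "Z \<in> sl2C"
  shows "trace (\<chi> i j. Re (Z $ i $ j)) = 0" "trace (\<chi> i j. Im (Z $ i $ j)) = 0"
  using assms by (simp_all add: sl2C_def trace_def sum_2 complex_eq_iff)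

lemma curve_differentiable_group_lift:
  "smooth_on_open upper_half_plane f \<Longrightarrow> curve_differentiable (group_lift k f)"
  unfolding curve_differentiable_def
  using group_lift_has_vector_derivative[of f _ _ k] differentiableI_vector by blast

lemma lie_deriv_add:
  assumes "curve_differentiable \<phi>" "curve_differentiable \<psi>" "trace A = 0"
  shows "lie_deriv A (\<phi> + \<psi>) = lie_deriv A \<phi> + lie_deriv A \<psi>"
proof
  fix g
  show "lie_deriv A (\<phi> + \<psi>) g = (lie_deriv A \<phi> + lie_deriv A \<psi>) g"
  proof (cases "g \<in> carrier SL2R")
    case True
    show ?thesis
      using has_vector_derivative_add[OF lie_deriv_works[OF assms(1) True assms(3)]
          lie_deriv_works[OF assms(2) True assms(3)]]
      by (intro lie_deriv_eqI[OF True]) simp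
  qed (simp add: lie_deriv_def)
qed

lemma lie_deriv_scale:
  assumes "curve_differentiable \<phi>" "trace A = 0"
  shows "lie_deriv A (fscale c \<phi>) = fscale c (lie_deriv A \<phi>)"
proof
  fix g
  show "lie_deriv A (fscale c \<phi>) g = fscale c (lie_deriv A \<phi>) g"
  proof (cases "g \<in> carrier SL2R")
    case True
    show ?thesis
      using bounded_linear.has_vector_derivative[OF bounded_linear_vector_scalar_mult
          lie_deriv_works[OF assms(1) True assms(2)], of c]
      by (intro lie_deriv_eqI[OF True]) (simp add: fscale_def)
  qed (simp add: lie_deriv_def fscale_def)
qed

lemma gact_add:
  assumes "curve_differentiable \<phi>" "curve_differentiable \<psi>" "Z \<in> sl2C"
  shows "gact Z (\<phi> + \<psi>) = gact Z \<phi> + gact Z \<psi>"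
  unfolding gact_def
  by (simp add: lie_deriv_add[OF assms(1,2)] trace_Re_Im[OF assms(3)] fscale.scale_right_distrib)

lemma gact_scale:
  assumes "curve_differentiable \<phi>" "Z \<in> sl2C"
  shows "gact Z (fscale c \<phi>) = fscale c (gact Z \<phi>)"
  unfolding gact_def
  by (simp add: lie_deriv_scale[OF assms(1)] trace_Re_Im[OF assms(2)] fscale.scale_right_distrib
      mult.commute)

text \<open>The Lie algebra differentiates right translations, which commute with left translations;
  the constant matrix \<open>B\<close> passes through the derivative.\<close>

lemma gact_equivariant:
  assumes "curve_differentiable \<phi>" "Z \<in> sl2C" "h \<in> carrier SL2R"
    "\<And>g. g \<in> carrier SL2R \<Longrightarrow> \<phi> (h ** g) = B *v \<phi> g" "g \<in> carrier SL2R"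
  shows "gact Z \<phi> (h ** g) = B *v gact Z \<phi> g"
proof -
  have *: "lie_deriv A \<phi> (h ** g) = B *v lie_deriv A \<phi> g" if "trace A = 0" for A
  proof (rule lie_deriv_eqI[OF carrier_SL2R_mult[OF assms(3,5)]])
    have "g ** mat_exp (t *\<^sub>R A) \<in> carrier SL2R" for t
      using assms(5) det_mat_exp[OF that] by (simp add: carrier_SL2R det_mul)
    then have "\<phi> (h ** g ** mat_exp (t *\<^sub>R A)) = B *v \<phi> (g ** mat_exp (t *\<^sub>R A))" for t
      using assms(4) by (simp add: matrix_mul_assoc[symmetric])
    then show "((\<lambda>t. \<phi> (h ** g ** mat_exp (t *\<^sub>R A))) has_vector_derivative
        B *v lie_deriv A \<phi> g) (at 0)"
      using bounded_linear.has_vector_derivative[OF bounded_linear_matrix_vector_mult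
          lie_deriv_works[OF assms(1,5) that]] by simp
  qed
  show ?thesis
    by (simp add: gact_def fscale_def * trace_Re_Im[OF assms(2)] matrix_vector_right_distrib
        vector_scalar_commute)
qed

lemma curve_differentiable_subspace: "fscale.subspace {\<phi>. curve_differentiable \<phi>}"
proof (rule fscale.subspaceI; clarsimp)
  show "curve_differentiable 0" by (simp add: curve_differentiable_def)
next
  fix \<phi> \<psi> :: "real^2^2 \<Rightarrow> complex^'n" assume "curve_differentiable \<phi>" "curve_differentiable \<psi>"
  then show "curve_differentiable (\<phi> + \<psi>)"
    by (simp add: curve_differentiable_def)
next
  fix c and \<phi> :: "real^2^2 \<Rightarrow> complex^'n" assume *: "curve_differentiable \<phi>"
  show "curve_differentiable (fscale c \<phi>)"
    unfolding curve_differentiable_def fscale_def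
    using bounded_linear.has_vector_derivative[OF bounded_linear_vector_scalar_mult
          lie_deriv_works[OF *]] differentiableI_vector by blast
qed

lemma Ck_on_subset: "S \<subseteq> S' \<Longrightarrow> Ck_on n S' f \<Longrightarrow> Ck_on n S f"
  by (induction n arbitrary: f) (auto intro: continuous_on_subset)

lemma smooth_functions_subspace: "fscale.subspace smooth_functions"
proof (rule fscale.subspaceI)
  show "0 \<in> (smooth_functions :: (real^2^2 \<Rightarrow> complex^'n) set)"
    unfolding smooth_functions_def
    by (auto intro!: exI[of _ UNIV] exI[of _ "\<lambda>x. 0"] Ck_on_const simp: smooth_on_open_def)
next
  fix \<phi> \<psi> :: "real^2^2 \<Rightarrow> complex^'n" assume *: "\<phi> \<in> smooth_functions" "\<psi> \<in> smooth_functions"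
  have "\<exists>U F. g \<in> U \<and> smooth_on_open U F \<and> (\<forall>h\<in>U \<inter> carrier SL2R. F h = (\<phi> + \<psi>) h)"
    if g: "g \<in> carrier SL2R" for g
  proof -
    obtain U F where U: "g \<in> U" "smooth_on_open U F" "\<forall>h\<in>U \<inter> carrier SL2R. F h = \<phi> h"
      using *(1) g by (force simp: smooth_functions_def)
    obtain V G where V: "g \<in> V" "smooth_on_open V G" "\<forall>h\<in>V \<inter> carrier SL2R. G h = \<psi> h"
      using *(2) g by (force simp: smooth_functions_def)
    have "smooth_on_open (U \<inter> V) (\<lambda>h. F h + G h)"
      using U(2) V(2) unfolding smooth_on_open_def
      by (auto intro!: Ck_on_add intro: Ck_on_subset[OF Int_lower1] Ck_on_subset[OF Int_lower2])
    then show ?thesis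
      using U V by (intro exI[of _ "U \<inter> V"] exI[of _ "\<lambda>h. F h + G h"]) auto
  qed
  then show "\<phi> + \<psi> \<in> smooth_functions" using * by (simp add: smooth_functions_def)
next
  fix c and \<phi> :: "real^2^2 \<Rightarrow> complex^'n" assume *: "\<phi> \<in> smooth_functions"
  have "\<exists>U F. g \<in> U \<and> smooth_on_open U F \<and> (\<forall>h\<in>U \<inter> carrier SL2R. F h = fscale c \<phi> h)"
    if g: "g \<in> carrier SL2R" for g
  proof -
    obtain U F where U: "g \<in> U" "smooth_on_open U F" "\<forall>h\<in>U \<inter> carrier SL2R. F h = \<phi> h"
      using * g by (force simp: smooth_functions_def)
    have "smooth_on_open U (\<lambda>h. c *s F h)"
      using U(2) unfolding smooth_on_open_def
      by (auto intro!: Ck_on_bounded_linear[OF bounded_linear_vector_scalar_mult])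
    then show ?thesis
      using U by (intro exI[of _ U] exI[of _ "\<lambda>h. c *s F h"]) (auto simp: fscale_def)
  qed
  then show "fscale c \<phi> \<in> smooth_functions" using * by (simp add: smooth_functions_def fscale_def)
qed

text \<open>No transformation law under a subgroup is imposed here: this space only carries the
  weight and the smoothness. Equivariance is recovered for the generated module in
  \<open>M_equivariant\<close>.\<close>

definition lifts :: "int \<Rightarrow> (real^2^2 \<Rightarrow> complex^'n) set" where
  "lifts n = {group_lift n f | f. smooth_on_open upper_half_plane f}"

lemma lifts_subspace: "fscale.subspace (lifts n)"
proof (rule fscale.subspaceI)
  have "group_lift n (\<lambda>\<tau>. 0) = (0 :: real^2^2 \<Rightarrow> complex^'n)"
    by (simp add: group_lift_def slash_def fun_eq_iff)
  moreover have "smooth_on_open upper_half_plane (\<lambda>\<tau>. 0 :: complex^'n)"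
    by (simp add: smooth_on_open_def Ck_on_const open_upper_half_plane)
  ultimately show "0 \<in> (lifts n :: (real^2^2 \<Rightarrow> complex^'n) set)"
    unfolding lifts_def by (metis (mono_tags, lifting) mem_Collect_eq)
next
  fix \<phi> \<psi> :: "real^2^2 \<Rightarrow> complex^'n" assume "\<phi> \<in> lifts n" "\<psi> \<in> lifts n"
  then obtain f g where f: "\<phi> = group_lift n f" "smooth_on_open upper_half_plane f"
    and g: "\<psi> = group_lift n g" "smooth_on_open upper_half_plane g" by (auto simp: lifts_def)
  have "\<phi> + \<psi> = group_lift n (\<lambda>\<tau>. f \<tau> + g \<tau>)"
    by (simp add: f g group_lift_def slash_def fun_eq_iff vector_add_ldistrib)
  moreover have "smooth_on_open upper_half_plane (\<lambda>\<tau>. f \<tau> + g \<tau>)"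
    using f g by (simp add: smooth_on_open_def Ck_on_add)
  ultimately show "\<phi> + \<psi> \<in> lifts n" by (auto simp: lifts_def)
next
  fix c and \<phi> :: "real^2^2 \<Rightarrow> complex^'n" assume "\<phi> \<in> lifts n"
  then obtain f where f: "\<phi> = group_lift n f" "smooth_on_open upper_half_plane f"
    by (auto simp: lifts_def)
  have "fscale c \<phi> = group_lift n (\<lambda>\<tau>. c *s f \<tau>)"
    by (simp add: f fscale_def group_lift_def slash_def fun_eq_iff mult.commute)
  moreover have "smooth_on_open upper_half_plane (\<lambda>\<tau>. c *s f \<tau>)"
    using f(2) unfolding smooth_on_open_def
    by (intro conjI allI Ck_on_bounded_linear[OF bounded_linear_vector_scalar_mult]) blast+
  ultimately show "fscale c \<phi> \<in> lifts n" by (auto simp: lifts_def)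
qed

lemma elt_sl2C: "elt_H \<in> sl2C" "elt_X \<in> sl2C" "elt_Y \<in> sl2C"
  by (simp_all add: sl2C_def trace_def sum_2 elt_H_def elt_X_def elt_Y_def)

lemma gact_elt_group_lift:
  assumes "smooth_on_open upper_half_plane f"
  shows "gact elt_H (group_lift k f) = fscale (of_int k) (group_lift k f)"
    and "gact elt_X (group_lift k f) = group_lift (k + 2) (raising_op k f)"
    and "gact elt_Y (group_lift k f) = group_lift (k - 2) (lowering_op k f)"
  unfolding gact_group_lift[OF assms elt_sl2C(1)] gact_group_lift[OF assms elt_sl2C(2)]
    gact_group_lift[OF assms elt_sl2C(3)]
  by (simp_all add: elt_H_def elt_X_def elt_Y_def)

lemma gact_elt_commutator:
  assumes "\<phi> \<in> lifts n"
  shows "gact elt_X (gact elt_Y \<phi>) = gact elt_Y (gact elt_X \<phi>) + fscale (of_int n) \<phi>"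
proof -
  obtain f where f: "\<phi> = group_lift n f" "smooth_on_open upper_half_plane f"
    using assms by (auto simp: lifts_def)
  have "moebius_act g \<i> \<in> upper_half_plane" if "g \<in> carrier SL2R" for g
    using that moebius_act_upper_half_plane[OF _ i_upper_half_plane, of g]
    by (simp add: carrier_SL2R)
  then have "group_lift n (raising_op (n - 2) (lowering_op n f)) =
      group_lift n (lowering_op (n + 2) (raising_op n f)) + fscale (of_int n) (group_lift n f)"
    by (auto simp: fun_eq_iff group_lift_def slash_def fscale_def vector_add_ldistrib
        raising_lowering_commutator[OF f(2)] mult.commute)
  then show ?thesis
    using f by (simp add: gact_elt_group_lift smooth_raising_op smooth_lowering_op)
qed

section \<open>Weight modules generated by one weight vector\<close>

text \<open>An abstract setting for spaces of lifts. Additivity and homogeneity are demanded only on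
  the span of the weight spaces, where the derivatives are known to exist.\<close>

locale weight_module = vector_space sc
  for sc :: "complex \<Rightarrow> 'v::ab_group_add \<Rightarrow> 'v" +
  fixes W :: "int \<Rightarrow> 'v set" and X Y H :: "'v \<Rightarrow> 'v"
    and k :: int and l d :: nat and \<phi> :: 'v
  assumes W_subspace: "subspace (W n)"
    and X_W: "v \<in> W n \<Longrightarrow> X v \<in> W (n + 2)"
    and Y_W: "v \<in> W n \<Longrightarrow> Y v \<in> W (n - 2)"
    and H_W: "v \<in> W n \<Longrightarrow> H v = sc (of_int n) v"
    and XYH_add: "f \<in> {X, Y, H} \<Longrightarrow> u \<in> span (\<Union>(range W)) \<Longrightarrow> v \<in> span (\<Union>(range W)) \<Longrightarrow>
        f (u + v) = f u + f v"
    and XYH_scale: "f \<in> {X, Y, H} \<Longrightarrow> v \<in> span (\<Union>(range W)) \<Longrightarrow> f (sc a v) = sc a (f v)"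
    and commutator: "v \<in> W n \<Longrightarrow> X (Y v) = Y (X v) + sc (of_int n) v"
    and gen_W: "\<phi> \<in> W k"
    and gen_nilpotent: "((\<lambda>v. X (Y v)) ^^ (d + 1)) \<phi> = 0"
    and l_eq: "int l = \<bar>k - 1\<bar>"
begin

section \<open>Linear algebra on the span of the weight spaces\<close>

definition T :: "'v set" where "T = span (\<Union>(range W))"

lemma W_T: "v \<in> W n \<Longrightarrow> v \<in> T"
  unfolding T_def by (auto intro: span_base)

lemma subspace_T: "subspace T"
  by (simp add: T_def)

text \<open>Linearity restricted to \<open>T\<close>; the operators at hand are functions on the
  whole type and nothing is known about them outside \<open>T\<close>.\<close>

definition lin :: "('v \<Rightarrow> 'v) \<Rightarrow> bool" where
  "lin f \<longleftrightarrow> (\<forall>u\<in>T. \<forall>v\<in>T. f (u + v) = f u + f v) \<and> (\<forall>a. \<forall>v\<in>T. f (sc a v) = sc a (f v))"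

lemma lin_XYH: "lin X" "lin Y" "lin H"
  using XYH_add XYH_scale by (auto simp: lin_def T_def)

lemma lin_add: "lin f \<Longrightarrow> u \<in> T \<Longrightarrow> v \<in> T \<Longrightarrow> f (u + v) = f u + f v"
  and lin_scale: "lin f \<Longrightarrow> v \<in> T \<Longrightarrow> f (sc a v) = sc a (f v)"
  by (auto simp: lin_def)

lemma lin_0: "lin f \<Longrightarrow> f 0 = 0"
  using lin_scale[of f 0 0] subspace_0[OF subspace_T] by simp

lemma lin_diff: "lin f \<Longrightarrow> u \<in> T \<Longrightarrow> v \<in> T \<Longrightarrow> f (u - v) = f u - f v"
  using lin_add[of f "u - v" v] subspace_diff[OF subspace_T, of u v] by simp

lemma lin_sum:
  assumes "lin f" "finite I" "\<And>i. i \<in> I \<Longrightarrow> v i \<in> T"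
  shows "f (sum v I) = (\<Sum>i\<in>I. f (v i))"
  using assms(2,3)
  by (induction I rule: finite_induct)
    (auto simp: lin_0 lin_add assms(1) subspace_sum[OF subspace_T])

lemma lin_image_subspace:
  assumes "lin f" "subspace S" "S \<subseteq> T"
  shows "subspace (f ` S)"
proof (rule subspaceI)
  show "0 \<in> f ` S"
    using lin_0[OF assms(1)] subspace_0[OF assms(2)] by (metis image_eqI)
next
  fix x y assume "x \<in> f ` S" "y \<in> f ` S"
  then obtain u v where "x = f u" "y = f v" "u \<in> S" "v \<in> S" by auto
  then show "x + y \<in> f ` S"
    using assms lin_add[of f u v] subspace_add[OF assms(2), of u v] by (metis image_eqI subsetD)
next
  fix a x assume "x \<in> f ` S"
  then obtain u where "x = f u" "u \<in> S" by auto
  then show "sc a x \<in> f ` S"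
    using assms lin_scale[of f u a] subspace_scale[OF assms(2), of u a]
    by (metis image_eqI subsetD)
qed

lemma lin_image_span:
  assumes "lin f" "S \<subseteq> T"
  shows "f ` span S \<subseteq> span (f ` S)"
proof -
  have "x \<in> span S \<Longrightarrow> f x \<in> span (f ` S) \<and> x \<in> T" for x
  proof (induction x rule: span_induct_alt)
    case base
    then show ?case by (simp add: lin_0[OF assms(1)] span_zero subspace_0[OF subspace_T])
  next
    case (step c x y)
    have "x \<in> T" "y \<in> T" using step assms(2) by auto
    then have "f (sc c x + y) = sc c (f x) + f y"
      using lin_add[OF assms(1)] lin_scale[OF assms(1)] subspace_scale[OF subspace_T] by simp
    then show ?case
      using step \<open>x \<in> T\<close> by (simp add: span_add span_base span_scale subspace_add subspace_scale subspace_T)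
  qed
  then show ?thesis by auto
qed

definition N :: "'v \<Rightarrow> 'v" where "N v = X (Y v)"

lemma XY_pow_W:
  "v \<in> W n \<Longrightarrow> (X ^^ i) v \<in> W (n + 2 * int i)"
  "v \<in> W n \<Longrightarrow> (Y ^^ i) v \<in> W (n - 2 * int i)"
proof -
  assume v: "v \<in> W n"
  show "(X ^^ i) v \<in> W (n + 2 * int i)"
  proof (induction i)
    case (Suc i)
    from X_W[OF this] show ?case by (simp add: algebra_simps)
  qed (simp add: v)
  show "(Y ^^ i) v \<in> W (n - 2 * int i)"
  proof (induction i)
    case (Suc i)
    from Y_W[OF this] show ?case by (simp add: algebra_simps)
  qed (simp add: v)
qed

lemma N_W: "v \<in> W n \<Longrightarrow> N v \<in> W n"
  unfolding N_def using X_W[OF Y_W] by force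

lemma N_pow_W: "v \<in> W n \<Longrightarrow> (N ^^ i) v \<in> W n"
  by (induction i) (auto intro: N_W)

lemma XY_T: "v \<in> T \<Longrightarrow> X v \<in> T" "v \<in> T \<Longrightarrow> Y v \<in> T" "v \<in> T \<Longrightarrow> H v \<in> T"
proof -
  have "f v \<in> T" if "lin f" "\<And>n w. w \<in> W n \<Longrightarrow> f w \<in> T" "v \<in> T" for f
  proof -
    have "f v \<in> span (f ` \<Union>(range W))"
      using lin_image_span[OF that(1), of "\<Union>(range W)"] that(3) W_T by (auto simp: T_def)
    moreover have "span (f ` \<Union>(range W)) \<subseteq> T"
      by (rule span_minimal) (auto intro: that subspace_T)
    ultimately show ?thesis by auto
  qed
  note * = this
  show "v \<in> T \<Longrightarrow> X v \<in> T" "v \<in> T \<Longrightarrow> Y v \<in> T" "v \<in> T \<Longrightarrow> H v \<in> T"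
    by (rule *[OF lin_XYH(1) W_T[OF X_W]] *[OF lin_XYH(2) W_T[OF Y_W]] *[OF lin_XYH(3)];
        simp add: H_W W_T subspace_scale[OF subspace_T])+
qed

lemma pow_T: "(\<And>v. v \<in> T \<Longrightarrow> f v \<in> T) \<Longrightarrow> v \<in> T \<Longrightarrow> (f ^^ i) v \<in> T"
  by (induction i) auto

lemma lin_pow: "lin f \<Longrightarrow> (\<And>v. v \<in> T \<Longrightarrow> f v \<in> T) \<Longrightarrow> lin (f ^^ i)"
proof (induction i)
  case 0
  then show ?case by (auto simp: lin_def)
next
  case (Suc i)
  then show ?case by (simp add: lin_def pow_T)
qed

lemma N_T: "v \<in> T \<Longrightarrow> N v \<in> T"
  by (simp add: N_def XY_T)

lemma lin_N: "lin N"
  using lin_XYH XY_T by (simp add: lin_def N_def)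

lemmas lin_X_pow = lin_pow[OF lin_XYH(1) XY_T(1)]
lemmas lin_Y_pow = lin_pow[OF lin_XYH(2) XY_T(2)]
lemmas lin_N_pow = lin_pow[OF lin_N N_T]

section \<open>The cyclic space at the weight of the generator\<close>

definition U :: "'v set" where "U = span ((\<lambda>j. (N ^^ j) \<phi>) ` {..d})"

lemma subspace_U: "subspace U"
  by (simp add: U_def)

lemma gen_U: "\<phi> \<in> U"
  unfolding U_def by (rule span_base) (auto intro!: image_eqI[of _ _ 0])

lemma U_W: "U \<subseteq> W k"
  unfolding U_def by (rule span_minimal) (auto intro: N_pow_W gen_W W_subspace)

lemma U_T: "u \<in> U \<Longrightarrow> u \<in> T"
  using U_W W_T by auto

lemma N_pow_gen: "j > d \<Longrightarrow> (N ^^ j) \<phi> = 0"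
proof -
  assume "j > d"
  then have "(N ^^ j) \<phi> = (N ^^ (j - (d + 1))) ((N ^^ (d + 1)) \<phi>)"
    by (metis Suc_eq_plus1 Suc_leI comp_apply funpow_add le_add_diff_inverse2)
  also have "(N ^^ (d + 1)) \<phi> = 0"
    using gen_nilpotent unfolding N_def[abs_def] .
  finally show ?thesis by (simp add: lin_0[OF lin_N_pow])
qed

lemma N_pow_gen_U: "(N ^^ j) \<phi> \<in> U"
  by (cases "j \<le> d") (auto simp: N_pow_gen U_def span_zero intro: span_base)

lemma N_U: "u \<in> U \<Longrightarrow> N u \<in> U"
proof -
  assume "u \<in> U"
  then have "N u \<in> span (N ` (\<lambda>j. (N ^^ j) \<phi>) ` {..d})"
    using lin_image_span[OF lin_N, of "(\<lambda>j. (N ^^ j) \<phi>) ` {..d}"] W_T[OF N_pow_W[OF gen_W]]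
    unfolding U_def by blast
  moreover have "\<dots> \<subseteq> U"
  proof (rule span_minimal[OF _ subspace_U], intro subsetI)
    fix x assume "x \<in> N ` (\<lambda>j. (N ^^ j) \<phi>) ` {..d}"
    then obtain j where "x = (N ^^ Suc j) \<phi>" by auto
    then show "x \<in> U" using N_pow_gen_U by blast
  qed
  ultimately show ?thesis by auto
qed

lemma N_pow_U: "u \<in> U \<Longrightarrow> (N ^^ j) u \<in> U"
  by (induction j) (auto intro: N_U)

lemma N_nilpotent_U: "u \<in> U \<Longrightarrow> (N ^^ (d + 1)) u = 0"
proof -
  assume "u \<in> U"
  then have "(N ^^ (d + 1)) u \<in> span ((N ^^ (d + 1)) ` (\<lambda>j. (N ^^ j) \<phi>) ` {..d})"
    using lin_image_span[OF lin_N_pow, of "(\<lambda>j. (N ^^ j) \<phi>) ` {..d}" "d + 1"]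
      W_T[OF N_pow_W[OF gen_W]]
    unfolding U_def by blast
  moreover have "\<dots> \<subseteq> {0}"
  proof (rule span_minimal)
    show "(N ^^ (d + 1)) ` (\<lambda>j. (N ^^ j) \<phi>) ` {..d} \<subseteq> {0}"
    proof (intro subsetI)
      fix x assume "x \<in> (N ^^ (d + 1)) ` (\<lambda>j. (N ^^ j) \<phi>) ` {..d}"
      then obtain j where x: "x = (N ^^ (d + 1)) ((N ^^ j) \<phi>)" by blast
      have "(N ^^ (d + 1)) ((N ^^ j) \<phi>) = (N ^^ (d + 1 + j)) \<phi>"
        by (simp only: funpow_add o_apply)
      then show "x \<in> {0}" unfolding x by (simp add: N_pow_gen del: funpow.simps)
    qed
  qed auto
  ultimately show ?thesis by auto
qed

section \<open>The Casimir operator\<close>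

text \<open>On weight \<open>n\<close> the element H^2 - 2H - (l^2 - 1) acts as
  \<open>4 * s n\<close>. The zeros \<open>1 - int l\<close> and \<open>1 + int l\<close> are the
  only weights at which the arguments for bijectivity of X below break down.\<close>

definition s :: "int \<Rightarrow> complex" where
  "s n = of_int ((n - 1)\<^sup>2 - (int l)\<^sup>2) / 4"

text \<open>On weight \<open>n\<close> this is a quarter of the shifted Casimir element \<open>C - (l\<^sup>2 - 1)\<close>.\<close>

definition cas :: "int \<Rightarrow> 'v \<Rightarrow> 'v" where
  "cas n v = N v + sc (s n) v"

lemma s_k: "s k = 0"
  unfolding s_def l_eq by simp

lemma s_add2: "s (n + 2) = s n + of_int n"
  unfolding s_def by (simp add: field_simps power2_eq_square)

lemma lin_cas: "lin (cas n)"
  using lin_N unfolding lin_def cas_def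
  by (auto simp: scale_right_distrib algebra_simps)

lemma cas_T: "v \<in> T \<Longrightarrow> cas n v \<in> T"
  unfolding cas_def by (intro subspace_add subspace_T N_T subspace_scale)

lemma cas_k: "cas k = N"
  by (simp add: fun_eq_iff cas_def s_k)

text \<open>By \<open>s_add2\<close> the commutator shifts the constant from \<open>s n\<close> to
  \<open>s (n + 2)\<close>. So \<open>Y X\<close> on weight \<open>n\<close> and \<open>X Y\<close>
  on weight \<open>n + 2\<close> involve the same constant.\<close>

lemma YX_eq: "v \<in> W n \<Longrightarrow> Y (X v) = cas n v - sc (s (n + 2)) v"
  using commutator[of v n] by (simp add: cas_def N_def s_add2 algebra_simps)

lemma XY_eq: "X (Y v) = cas n v - sc (s n) v"
  by (simp add: cas_def N_def)

lemma cas_X: "v \<in> W n \<Longrightarrow> cas (n + 2) (X v) = X (cas n v)"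
proof -
  assume v: "v \<in> W n"
  have "X (Y (X v)) = X (cas n v - sc (s (n + 2)) v)" using YX_eq[OF v] by simp
  also have "\<dots> = X (cas n v) - sc (s (n + 2)) (X v)"
    using W_T[OF v] by (simp add: lin_diff[OF lin_XYH(1)] lin_scale[OF lin_XYH(1)] cas_T
        subspace_scale[OF subspace_T])
  finally show ?thesis by (simp add: cas_def N_def)
qed

lemma cas_Y: "v \<in> W n \<Longrightarrow> cas (n - 2) (Y v) = Y (cas n v)"
proof -
  assume v: "v \<in> W n"
  have "Y (X (Y v)) = cas (n - 2) (Y v) - sc (s n) (Y v)" using YX_eq[OF Y_W[OF v]] by simp
  moreover have "Y (X (Y v)) = Y (cas n v) - sc (s n) (Y v)"
    unfolding XY_eq[of v n]
    using W_T[OF v] by (simp add: lin_diff[OF lin_XYH(2)] lin_scale[OF lin_XYH(2)] cas_T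
        subspace_scale[OF subspace_T])
  ultimately show ?thesis by simp
qed

lemma cas_X_pow: "v \<in> W n \<Longrightarrow> cas (n + 2 * int i) ((X ^^ i) v) = (X ^^ i) (cas n v)"
proof (induction i)
  case (Suc i)
  have eq: "n + 2 * int (Suc i) = n + 2 * int i + 2" by simp
  show ?case
    unfolding eq using cas_X[OF XY_pow_W(1)[OF Suc.prems, of i]] Suc by simp
qed simp

lemma cas_Y_pow: "v \<in> W n \<Longrightarrow> cas (n - 2 * int i) ((Y ^^ i) v) = (Y ^^ i) (cas n v)"
proof (induction i)
  case (Suc i)
  have eq: "n - 2 * int (Suc i) = n - 2 * int i - 2" by simp
  show ?case
    unfolding eq using cas_Y[OF XY_pow_W(2)[OF Suc.prems, of i]] Suc by simp
qed simp

section \<open>The weight spaces of the generated module\<close>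

text \<open>Defined as images of \<open>U\<close>, so that finite dimension and nilpotency of the
  Casimir operator are inherited from \<open>U\<close>; \<open>weight_eq\<close> later identifies
  them with the full weight spaces of the module.\<close>

definition Mw :: "int \<Rightarrow> 'v set" where
  "Mw n = (if odd (n - k) then {0}
     else if n \<ge> k then (X ^^ nat ((n - k) div 2)) ` U
     else (Y ^^ nat ((k - n) div 2)) ` U)"

lemma Mw_up: "Mw (k + 2 * int i) = (X ^^ i) ` U"
  by (simp add: Mw_def)

lemma Mw_down: "Mw (k - 2 * int i) = (Y ^^ i) ` U"
  by (cases "i = 0") (auto simp: Mw_def)

text \<open>With \<open>Suc i\<close> in the second case, weight \<open>k\<close> itself falls only
  under the first.\<close>

lemma Mw_cases:
  obtains (up) i where "n = k + 2 * int i" | (down) i where "n = k - 2 * int (Suc i)"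
    | (odd) "odd (n - k)"
proof (cases "odd (n - k)")
  case False
  then obtain q where q: "n - k = 2 * q" by blast
  show ?thesis
  proof (cases "q \<ge> 0")
    case True
    then show ?thesis using that(1)[of "nat q"] q by simp
  next
    case False
    then show ?thesis using that(2)[of "nat (-q-1)"] q by simp
  qed
qed (use that in blast)

lemma Mw_odd: "odd (n - k) \<Longrightarrow> Mw n = {0}"
  by (simp add: Mw_def)

lemma Mw_k: "Mw k = U"
  using Mw_up[of 0] by simp

lemma Mw_W: "v \<in> Mw n \<Longrightarrow> v \<in> W n"
proof (cases n rule: Mw_cases)
  case (up i)
  then show "v \<in> Mw n \<Longrightarrow> v \<in> W n" using U_W by (auto simp: Mw_up intro!: XY_pow_W)
next
  case (down i)
  then show "v \<in> Mw n \<Longrightarrow> v \<in> W n"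
    using U_W unfolding down Mw_down by (auto intro!: XY_pow_W simp del: funpow.simps of_nat_Suc)
next
  case odd
  then show "v \<in> Mw n \<Longrightarrow> v \<in> W n" using subspace_0[OF W_subspace] by (auto simp: Mw_odd)
qed

lemma Mw_T: "v \<in> Mw n \<Longrightarrow> v \<in> T"
  using Mw_W W_T by blast

lemma subspace_Mw: "subspace (Mw n)"
proof -
  have "U \<subseteq> T" using U_T by auto
  then show ?thesis
    by (cases n rule: Mw_cases)
      (simp_all only: simp_thms Mw_up Mw_down Mw_odd lin_image_subspace[OF lin_X_pow subspace_U]
        lin_image_subspace[OF lin_Y_pow subspace_U] subspace_single_0)
qed

lemma Mw_finite_dim: "finite_dim sc (Mw n)"
proof -
  let ?B = "(\<lambda>j. (N ^^ j) \<phi>) ` {..d}"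
  have *: "finite_dim sc (f ` U)" if "lin f" for f
  proof -
    have "?B \<subseteq> T" using W_T[OF N_pow_W[OF gen_W]] by auto
    then have "f ` U \<subseteq> span (f ` ?B)" unfolding U_def by (rule lin_image_span[OF that])
    then show ?thesis unfolding finite_dim_def by (intro exI[of _ "f ` ?B"] conjI) simp_all
  qed
  have "finite_dim sc {0}"
    unfolding finite_dim_def by (rule exI[of _ "{}"]) auto
  then show ?thesis
    by (cases n rule: Mw_cases)
      (simp_all only: simp_thms Mw_up Mw_down Mw_odd *[OF lin_X_pow] *[OF lin_Y_pow])
qed

lemma cas_Mw: "v \<in> Mw n \<Longrightarrow> cas n v \<in> Mw n"
proof (cases n rule: Mw_cases)
  case (up i)
  assume "v \<in> Mw n"
  then obtain u where "v = (X ^^ i) u" "u \<in> U" unfolding up Mw_up by auto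
  then show ?thesis using cas_X_pow[of u k i] U_W N_U unfolding up Mw_up by (auto simp: cas_k)
next
  case (down i)
  assume "v \<in> Mw n"
  then obtain u where "v = (Y ^^ Suc i) u" "u \<in> U" unfolding down Mw_down by auto
  then show ?thesis using cas_Y_pow[of u k "Suc i"] U_W N_U unfolding down Mw_down
    by (auto simp: cas_k simp del: of_nat_Suc funpow.simps)
next
  case odd
  assume "v \<in> Mw n"
  then show ?thesis using odd lin_0[OF lin_cas] by (auto simp: Mw_odd)
qed

text \<open>From weight \<open>k\<close> upwards this is the construction. Below \<open>k\<close> a
  vector has the form \<open>Y w\<close>, and X undoes the step: \<open>X (Y w)\<close> is the
  Casimir operator minus a scalar, applied to \<open>w\<close>.\<close>

lemma X_Mw: "v \<in> Mw n \<Longrightarrow> X v \<in> Mw (n + 2)"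
proof (cases n rule: Mw_cases)
  case (up i)
  assume "v \<in> Mw n"
  then obtain u where "v = (X ^^ i) u" "u \<in> U" unfolding up Mw_up by auto
  moreover have n: "n + 2 = k + 2 * int (Suc i)" using up by simp
  ultimately show ?thesis unfolding n Mw_up by (intro image_eqI[of _ _ u]) auto
next
  case (down i)
  assume "v \<in> Mw n"
  then obtain u where u: "v = Y ((Y ^^ i) u)" "u \<in> U" unfolding down Mw_down by auto
  define w where "w = (Y ^^ i) u"
  have n: "n + 2 = k - 2 * int i" using down by simp
  have w: "w \<in> Mw (n + 2)" unfolding n Mw_down w_def using u by auto
  have "X v = cas (n + 2) w - sc (s (n + 2)) w"
    using u XY_eq[of w "n + 2"] by (simp add: w_def)
  then show ?thesis using cas_Mw[OF w] w subspace_Mw by (simp add: subspace_diff subspace_scale)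
next
  case odd
  then have "odd (n + 2 - k)" by presburger
  moreover assume "v \<in> Mw n"
  ultimately show ?thesis using odd lin_0[OF lin_XYH(1)] by (auto simp: Mw_odd)
qed

lemma Y_Mw: "v \<in> Mw n \<Longrightarrow> Y v \<in> Mw (n - 2)"
proof (cases n rule: Mw_cases)
  case (up i)
  assume v: "v \<in> Mw n"
  show ?thesis
  \<comment> \<open>At weight \<open>k\<close> itself Y opens the descending chain; above it, Y
    undoes a step of X.\<close>
  proof (cases i)
    case 0
    then show ?thesis using v up Mw_down[of 1] by (auto simp: Mw_k)
  next
    case (Suc j)
    then obtain u where u: "v = X ((X ^^ j) u)" "u \<in> U" using v unfolding up Mw_up by auto
    define w where "w = (X ^^ j) u"
    have n: "n - 2 = k + 2 * int j" using up Suc by simp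
    have w: "w \<in> Mw (n - 2)" unfolding n Mw_up w_def using u by auto
    have "Y v = cas (n - 2) w - sc (s n) w"
      using u YX_eq[OF Mw_W[OF w]] by (simp add: w_def)
    then show ?thesis using cas_Mw[OF w] w subspace_Mw by (simp add: subspace_diff subspace_scale)
  qed
next
  case (down i)
  assume "v \<in> Mw n"
  then obtain u where "v = (Y ^^ Suc i) u" "u \<in> U" unfolding down Mw_down by blast
  moreover have n: "n - 2 = k - 2 * int (Suc (Suc i))" using down by simp
  ultimately show ?thesis unfolding n Mw_down by (intro image_eqI[of _ _ u]) auto
next
  case odd
  then have "odd (n - 2 - k)" by presburger
  moreover assume "v \<in> Mw n"
  ultimately show ?thesis using odd lin_0[OF lin_XYH(2)] by (auto simp: Mw_odd)
qed

text \<open>Powers of X and Y intertwine \<open>N\<close> on \<open>U\<close> with the Casimir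
  operator on \<open>Mw n\<close>, so the exponent \<open>d + 1\<close> carries over to every
  weight.\<close>

lemma cas_nilpotent: "v \<in> Mw n \<Longrightarrow> (cas n ^^ (d + 1)) v = 0"
proof (cases n rule: Mw_cases)
  case (up i)
  assume "v \<in> Mw n"
  then obtain u where u: "v = (X ^^ i) u" "u \<in> U" unfolding up Mw_up by auto
  have "(cas n ^^ j) v = (X ^^ i) ((N ^^ j) u)" for j
  proof (induction j)
    case (Suc j)
    have "(N ^^ j) u \<in> W k" using U_W N_pow_U[OF u(2)] by auto
    then have "cas n ((X ^^ i) ((N ^^ j) u)) = (X ^^ i) (N ((N ^^ j) u))"
      unfolding up by (simp only: cas_X_pow cas_k)
    then show ?case by (simp only: funpow.simps(2) o_apply Suc)
  qed (simp add: u)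
  then show ?thesis using N_nilpotent_U[OF u(2)] lin_0[OF lin_X_pow] by metis
next
  case (down i)
  assume "v \<in> Mw n"
  then obtain u where u: "v = (Y ^^ Suc i) u" "u \<in> U" unfolding down Mw_down by blast
  have "(cas n ^^ j) v = (Y ^^ Suc i) ((N ^^ j) u)" for j
  proof (induction j)
    case (Suc j)
    have "(N ^^ j) u \<in> W k" using U_W N_pow_U[OF u(2)] by auto
    then have "cas n ((Y ^^ Suc i) ((N ^^ j) u)) = (Y ^^ Suc i) (N ((N ^^ j) u))"
      unfolding down by (simp only: cas_Y_pow cas_k)
    then show ?case by (simp only: funpow.simps(2)[of j] o_apply Suc)
  qed (simp add: u)
  then show ?thesis using N_nilpotent_U[OF u(2)] lin_0[OF lin_Y_pow] by metis
next
  case odd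
  assume "v \<in> Mw n"
  then have "v = 0" using odd by (simp add: Mw_odd)
  show ?thesis unfolding \<open>v = 0\<close> by (rule lin_0[OF lin_pow[OF lin_cas cas_T]])
qed

section \<open>Bijectivity of X away from the exceptional weights\<close>

lemma cas_eigen_0:
  assumes "v \<in> Mw n" "cas n v = sc c v" "c \<noteq> 0"
  shows "v = 0"
proof -
  have "(cas n ^^ j) v = sc (c ^ j) v" for j
  proof (induction j)
    case (Suc j)
    then show ?case
      using assms(2) by (simp add: lin_scale[OF lin_cas Mw_T[OF assms(1)]] mult.commute)
  qed simp
  from this[of "d + 1"] cas_nilpotent[OF assms(1)] have "sc (c ^ (d + 1)) v = 0" by simp
  then show ?thesis using assms(3) by simp
qed

text \<open>A nilpotent operator minus a nonzero scalar is onto; the solution is built by induction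
  on the number of applications that annihilate \<open>v\<close>.\<close>

lemma cas_shift_surj:
  assumes "v \<in> Mw n" "c \<noteq> 0"
  obtains w where "w \<in> Mw n" "cas n w - sc c w = v"
proof -
  have "\<exists>w\<in>Mw n. cas n w - sc c w = v" if "(cas n ^^ j) v = 0" "v \<in> Mw n" for j v
    using that
  proof (induction j arbitrary: v)
    case 0
    then show ?case
      using subspace_0[OF subspace_Mw] lin_0[OF lin_cas] by (intro bexI[of _ 0]) auto
  next
    case (Suc j)
    have "(cas n ^^ j) (cas n v) = 0" using Suc.prems by (metis comp_apply funpow_Suc_right)
    then obtain w where w: "w \<in> Mw n" "cas n w - sc c w = cas n v"
      using Suc.IH cas_Mw Suc.prems by blast
    \<comment> \<open>A solution \<open>w\<close> for the right-hand side \<open>cas n v\<close>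
      gives, after subtracting \<open>v\<close>, a solution for \<open>sc c v\<close>; dividing by
      \<open>c\<close> solves the equation for \<open>v\<close>.\<close>
    have "cas n (w - v) - sc c (w - v) = sc c v"
      using w Mw_T[OF w(1)] Mw_T[OF Suc.prems(2)]
      by (simp add: lin_diff[OF lin_cas] scale_right_diff_distrib algebra_simps)
    moreover have "w - v \<in> Mw n" using w Suc.prems subspace_Mw by (simp add: subspace_diff)
    moreover have "cas n (sc (inverse c) (w - v)) - sc c (sc (inverse c) (w - v)) =
        sc (inverse c) (cas n (w - v) - sc c (w - v))"
      unfolding lin_scale[OF lin_cas Mw_T[OF \<open>w - v \<in> Mw n\<close>]]
        scale_right_diff_distrib[of _ "cas n (w - v)"] scale_left_commute[of _ c] ..
    ultimately have "cas n (sc (inverse c) (w - v)) - sc c (sc (inverse c) (w - v)) = v"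
      using assms(2) by simp
    then show ?case using \<open>w - v \<in> Mw n\<close> subspace_scale[OF subspace_Mw] by blast
  qed
  then show thesis using cas_nilpotent[OF assms(1)] assms(1) that by blast
qed

text \<open>\<open>Y X\<close> on \<open>Mw n\<close> and \<open>X Y\<close> on
  \<open>Mw (n + 2)\<close> are both the Casimir operator minus the nonzero scalar
  \<open>s (n + 2)\<close>. The first gives injectivity of X, the second surjectivity.\<close>

lemma X_bij:
  assumes "s (n + 2) \<noteq> 0"
  shows "bij_betw X (Mw n) (Mw (n + 2))"
proof (rule bij_betwI')
  fix x y assume x: "x \<in> Mw n" and y: "y \<in> Mw n"
  show "(X x = X y) = (x = y)"
  proof
    assume eq: "X x = X y"
    have xy: "x - y \<in> Mw n" using x y subspace_Mw by (simp add: subspace_diff)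
    have "X (x - y) = 0" using eq Mw_T[OF x] Mw_T[OF y] by (simp add: lin_diff[OF lin_XYH(1)])
    then have "cas n (x - y) = sc (s (n + 2)) (x - y)"
      using YX_eq[OF Mw_W[OF xy]] lin_0[OF lin_XYH(2)] by simp
    then show "x = y" using cas_eigen_0[OF xy _ assms] by simp
  qed simp
next
  fix x assume "x \<in> Mw n"
  then show "X x \<in> Mw (n + 2)" by (rule X_Mw)
next
  fix y assume "y \<in> Mw (n + 2)"
  then obtain w where w: "w \<in> Mw (n + 2)" "cas (n + 2) w - sc (s (n + 2)) w = y"
    using cas_shift_surj assms by blast
  then have "y = X (Y w)" using XY_eq by simp
  moreover have "Y w \<in> Mw n" using Y_Mw[OF w(1)] by simp
  ultimately show "\<exists>x\<in>Mw n. y = X x" by blast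
qed

lemma X_pow_bij:
  assumes "\<And>j. 1 \<le> j \<Longrightarrow> j \<le> i \<Longrightarrow> s (n + 2 * int j) \<noteq> 0"
  shows "bij_betw (X ^^ i) (Mw n) (Mw (n + 2 * int i))"
  using assms
proof (induction i)
  case (Suc i)
  have eq: "n + 2 * int (Suc i) = n + 2 * int i + 2" by simp
  have "bij_betw X (Mw (n + 2 * int i)) (Mw (n + 2 * int i + 2))"
    using Suc.prems[of "Suc i"] by (intro X_bij) (simp add: algebra_simps)
  moreover have "bij_betw (X ^^ i) (Mw n) (Mw (n + 2 * int i))"
    by (rule Suc.IH) (use Suc.prems in auto)
  ultimately show ?case
    unfolding eq funpow.simps(2) by (rule bij_betw_trans[rotated])
qed (simp add: bij_betw_def)

section \<open>The generated module and its weight decomposition\<close>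

definition M :: "'v set" where "M = span (\<Union>(range Mw))"

lemma subspace_M: "subspace M"
  by (simp add: M_def)

lemma Mw_M: "v \<in> Mw n \<Longrightarrow> v \<in> M"
  unfolding M_def by (auto intro: span_base)

lemma M_T: "v \<in> M \<Longrightarrow> v \<in> T"
  using span_minimal[of "\<Union>(range Mw)" T] Mw_T subspace_T unfolding M_def by blast

lemma gen_M: "\<phi> \<in> M"
  using Mw_M[of \<phi> k] gen_U by (simp add: Mw_k)

lemma stable_M:
  assumes "lin f" "\<And>n v. v \<in> Mw n \<Longrightarrow> f v \<in> M"
  shows "v \<in> M \<Longrightarrow> f v \<in> M"
proof -
  assume "v \<in> M"
  then have "f v \<in> span (f ` \<Union>(range Mw))"
    using lin_image_span[OF assms(1), of "\<Union>(range Mw)"] Mw_T unfolding M_def by blast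
  moreover have "\<dots> \<subseteq> M"
    by (rule span_minimal[OF _ subspace_M]) (use assms(2) in auto)
  ultimately show ?thesis by blast
qed

lemma XYH_M: "v \<in> M \<Longrightarrow> X v \<in> M" "v \<in> M \<Longrightarrow> Y v \<in> M" "v \<in> M \<Longrightarrow> H v \<in> M"
  by (rule stable_M[OF lin_XYH(1) Mw_M[OF X_Mw]] stable_M[OF lin_XYH(2) Mw_M[OF Y_Mw]]
      stable_M[OF lin_XYH(3)]; simp add: H_W[OF Mw_W] Mw_M subspace_scale[OF subspace_M])+

lemma M_least:
  assumes "subspace A" "\<And>v. v \<in> A \<Longrightarrow> X v \<in> A" "\<And>v. v \<in> A \<Longrightarrow> Y v \<in> A" "\<phi> \<in> A"
  shows "M \<subseteq> A"
proof -
  have pow: "(\<And>v. v \<in> A \<Longrightarrow> f v \<in> A) \<Longrightarrow> v \<in> A \<Longrightarrow> (f ^^ i) v \<in> A" for f v i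
    by (induction i) auto
  have "U \<subseteq> A" unfolding U_def
    by (rule span_minimal[OF _ assms(1)]) (auto intro!: pow assms simp: N_def)
  then have "Mw n \<subseteq> A" for n
    by (cases n rule: Mw_cases)
      (use subspace_0[OF assms(1)] in \<open>auto simp only: simp_thms Mw_up Mw_down Mw_odd intro!: pow assms(2,3)\<close>)
  then show ?thesis unfolding M_def by (intro span_minimal[OF _ assms(1)]) auto
qed

lemma H_sum:
  assumes "finite I" "\<And>n. n \<in> I \<Longrightarrow> v n \<in> W n"
  shows "H (sum v I) = (\<Sum>n\<in>I. sc (of_int n) (v n))"
proof -
  have "H (sum v I) = (\<Sum>n\<in>I. H (v n))"
    by (rule lin_sum[OF lin_XYH(3) assms(1) W_T[OF assms(2)]])
  also have "\<dots> = (\<Sum>n\<in>I. sc (of_int n) (v n))"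
    by (rule sum.cong[OF refl H_W[OF assms(2)]])
  finally show ?thesis .
qed

text \<open>Eigenvectors of H for distinct eigenvalues: applying H minus \<open>m\<close> removes
  the component of weight \<open>m\<close> and multiplies the others by nonzero scalars.\<close>

lemma weight_independent:
  assumes "finite I" "\<And>n. n \<in> I \<Longrightarrow> v n \<in> W n" "sum v I = 0" "n \<in> I"
  shows "v n = 0"
  using assms
proof (induction I arbitrary: v n rule: finite_induct)
  case (insert m I)
  have v: "v n \<in> W n" if "n \<in> insert m I" for n using insert that by auto
  have "H (sum v (insert m I)) = (\<Sum>n\<in>insert m I. sc (of_int n) (v n))"
    by (rule H_sum) (use insert.hyps v in auto)
  then have "(\<Sum>n\<in>insert m I. sc (of_int n) (v n)) = 0"
    using insert.prems lin_0[OF lin_XYH(3)] by simp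
  moreover have "(\<Sum>n\<in>insert m I. sc (of_int m) (v n)) = 0"
    using insert.prems by (simp add: scale_sum_right[symmetric] del: sum.insert)
  ultimately have "(\<Sum>n\<in>insert m I. sc (of_int n) (v n) - sc (of_int m) (v n)) = 0"
    by (simp add: sum_subtractf del: sum.insert)
  then have "(\<Sum>n\<in>I. sc (of_int (n - m)) (v n)) = 0"
    using insert.hyps by (simp add: scale_left_diff_distrib)
  then have "sc (of_int (n - m)) (v n) = 0" if "n \<in> I" for n
    using insert.IH[of "\<lambda>n. sc (of_int (n - m)) (v n)" n] that v
      subspace_scale[OF W_subspace] by simp
  then have I: "v n = 0" if "n \<in> I" for n
    using that insert.hyps(2) by (metis of_int_eq_0_iff right_minus_eq scale_eq_0_iff)
  then have "v m = 0" using insert.prems insert.hyps by simp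
  then show ?case using I insert.prems by auto
qed simp

definition decomposes :: "'v \<Rightarrow> (int \<Rightarrow> 'v) \<Rightarrow> bool" where
  "decomposes v c \<longleftrightarrow> (\<forall>n. c n \<in> Mw n) \<and> finite {n. c n \<noteq> 0} \<and> v = sum c {n. c n \<noteq> 0}"

lemma decomposes_ex: "v \<in> M \<Longrightarrow> \<exists>c. decomposes v c"
  unfolding M_def
proof (induction v rule: span_induct_alt)
  case base
  show ?case
    by (rule exI[of _ "\<lambda>n. 0"]) (auto simp: decomposes_def subspace_0[OF subspace_Mw])
next
  case (step a x y)
  then obtain c n where c: "decomposes y c" and n: "x \<in> Mw n" by auto
  let ?c = "c(n := c n + sc a x)" and ?I = "insert n {n. c n \<noteq> 0}"
  have sub: "{m. ?c m \<noteq> 0} \<subseteq> ?I" by auto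
  have fin: "finite ?I" using c by (simp add: decomposes_def)
  have "sum ?c {m. ?c m \<noteq> 0} = sum ?c ?I"
    using sub fin by (intro sum.mono_neutral_left) auto
  also have "\<dots> = ?c n + sum ?c (?I - {n})"
    using fin by (intro sum.remove) auto
  also have "sum ?c (?I - {n}) = sum c (?I - {n})" by (intro sum.cong) auto
  also have "?c n + \<dots> = sc a x + (c n + sum c (?I - {n}))" by (simp add: algebra_simps)
  also have "c n + sum c (?I - {n}) = sum c ?I"
    using fin by (intro sum.remove[symmetric]) auto
  also have "\<dots> = sum c {n. c n \<noteq> 0}"
    using fin by (intro sum.mono_neutral_right) auto
  finally have "sum ?c {m. ?c m \<noteq> 0} = sc a x + y" using c by (simp add: decomposes_def)
  moreover have "\<forall>m. ?c m \<in> Mw m"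
    using c n subspace_Mw by (auto simp: decomposes_def subspace_add subspace_scale)
  moreover have "finite {m. ?c m \<noteq> 0}" using sub fin finite_subset by blast
  ultimately show ?case unfolding decomposes_def by metis
qed

lemma decomposes_unique:
  assumes "decomposes v c" "decomposes v c'"
  shows "c = c'"
proof
  fix n
  let ?I = "{n. c n \<noteq> 0} \<union> {n. c' n \<noteq> 0}"
  have fin: "finite ?I" using assms by (simp add: decomposes_def)
  have "sum c {n. c n \<noteq> 0} = sum c ?I" "sum c' {n. c' n \<noteq> 0} = sum c' ?I"
    using fin by (auto intro!: sum.mono_neutral_left)
  then have "(\<Sum>n\<in>?I. c n - c' n) = 0"
    using assms by (simp add: decomposes_def sum_subtractf)
  then have "n \<in> ?I \<Longrightarrow> c n - c' n = 0"
    using weight_independent[OF fin, of "\<lambda>n. c n - c' n" n] assms Mw_W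
      subspace_diff[OF W_subspace] by (auto simp: decomposes_def)
  then show "c n = c' n" by (cases "n \<in> ?I") auto
qed

lemma weight_eq: "{v \<in> M. H v = sc (of_int n) v} = Mw n"
proof (intro equalityI subsetI)
  fix v assume "v \<in> Mw n"
  then show "v \<in> {v \<in> M. H v = sc (of_int n) v}" using Mw_M H_W Mw_W by auto
next
  fix v assume "v \<in> {v \<in> M. H v = sc (of_int n) v}"
  then have v: "v \<in> M" "H v = sc (of_int n) v" by auto
  obtain c where c: "decomposes v c" using decomposes_ex v by auto
  define I where "I = {n. c n \<noteq> 0}"
  have cI: "finite I" "v = sum c I" "\<And>m. c m \<in> Mw m" using c by (auto simp: decomposes_def I_def)
  have "H v = (\<Sum>m\<in>I. sc (of_int m) (c m))"
    using H_sum[OF cI(1) Mw_W[OF cI(3)]] cI(2) by simp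
  moreover have "sc (of_int n) v = (\<Sum>m\<in>I. sc (of_int n) (c m))"
    using cI by (simp add: scale_sum_right)
  ultimately have "(\<Sum>m\<in>I. sc (of_int (m - n)) (c m)) = 0"
    using v(2) by (simp add: scale_left_diff_distrib sum_subtractf)
  then have "sc (of_int (m - n)) (c m) = 0" if "m \<in> I" for m
    using weight_independent[OF cI(1), of "\<lambda>m. sc (of_int (m - n)) (c m)" m] that
      subspace_scale[OF W_subspace Mw_W[OF cI(3)]] by simp
  then have "c m = 0" if "m \<noteq> n" for m
    using that unfolding I_def by (metis (mono_tags, lifting) mem_Collect_eq of_int_eq_0_iff right_minus_eq scale_eq_0_iff)
  then have "I \<subseteq> {n}" by (auto simp: I_def)
  then have "v = 0 \<or> v = c n" using cI(2) by (auto simp: subset_singleton_iff)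
  then show "v \<in> Mw n" using cI(3) subspace_0[OF subspace_Mw] by auto
qed

section \<open>Indecomposability\<close>

text \<open>Modulo \<open>N U\<close> the space \<open>U\<close> is spanned by
  \<open>\<phi>\<close>; the scalar \<open>a\<close> plays the role of the residue in the local
  ring.\<close>

lemma U_rep:
  assumes "w \<in> U"
  shows "\<exists>a. \<exists>z\<in>U. w = sc a \<phi> + N z"
proof -
  have "w \<in> span ((\<lambda>j. (N ^^ j) \<phi>) ` {..d})" using assms by (simp add: U_def)
  then show ?thesis
  proof (induction w rule: span_induct_alt)
    case base
    show ?case
      by (rule exI[of _ 0], rule bexI[of _ 0]) (auto simp: lin_0[OF lin_N] subspace_0[OF subspace_U])
  next
    case (step c x y)
    then obtain a z j where z: "z \<in> U" "y = sc a \<phi> + N z" and x: "x = (N ^^ j) \<phi>" by auto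
    show ?case
    proof (cases j)
      case 0
      then show ?thesis using z x
        by (intro exI[of _ "a + c"] bexI[of _ z]) (auto simp: scale_left_distrib algebra_simps)
    next
      case (Suc i)
      then have "sc c x + y = sc a \<phi> + N (sc c ((N ^^ i) \<phi>) + z)"
        using z x U_T N_pow_gen_U[of i]
        by (simp add: lin_add[OF lin_N] lin_scale[OF lin_N] subspace_scale[OF subspace_T])
      moreover have "sc c ((N ^^ i) \<phi>) + z \<in> U"
        using z N_pow_gen_U[of i] subspace_U by (simp add: subspace_add subspace_scale)
      ultimately show ?thesis by blast
    qed
  qed
qed

lemma N_pow_rep:
  assumes "u \<in> U" "z \<in> U"
  shows "(N ^^ i) (sc a u + N z) = sc a ((N ^^ i) u) + (N ^^ Suc i) z"
proof -
  have "(N ^^ i) (sc a u + N z) = (N ^^ i) (sc a u) + (N ^^ i) (N z)"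
    by (rule lin_add[OF lin_N_pow subspace_scale[OF subspace_T U_T[OF assms(1)]]
          U_T[OF N_U[OF assms(2)]]])
  also have "(N ^^ i) (sc a u) = sc a ((N ^^ i) u)"
    by (rule lin_scale[OF lin_N_pow U_T[OF assms(1)]])
  also have "(N ^^ i) (N z) = (N ^^ Suc i) z" by (simp only: funpow_Suc_right o_apply)
  finally show ?thesis .
qed

text \<open>The components of \<open>\<phi>\<close> in two complementary summands lie in \<open>U\<close>, and the leading coefficient
  \<open>a\<close> of one of them is a unit; as \<open>N\<close> is nilpotent, that summand contains \<open>\<phi>\<close>.\<close>

lemma summand_trivial:
  assumes A: "subspace A" "\<And>v. v \<in> A \<Longrightarrow> X v \<in> A" "\<And>v. v \<in> A \<Longrightarrow> Y v \<in> A" "\<And>v. v \<in> A \<Longrightarrow> H v \<in> A"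
    and B: "subspace B" "\<And>v. v \<in> B \<Longrightarrow> X v \<in> B" "\<And>v. v \<in> B \<Longrightarrow> Y v \<in> B" "\<And>v. v \<in> B \<Longrightarrow> H v \<in> B"
    and AB: "A \<inter> B = {0}" "{u + v | u v. u \<in> A \<and> v \<in> B} = M"
  shows "A = {0} \<or> B = {0}"
proof -
  have AM: "A \<subseteq> M" and BM: "B \<subseteq> M"
    using AB(2) subspace_0[OF A(1)] subspace_0[OF B(1)] by force+
  obtain u v where uv: "u \<in> A" "v \<in> B" "\<phi> = u + v" using AB(2) gen_M by blast
  have T: "u \<in> T" "v \<in> T" using uv AM BM M_T by auto
  have "H \<phi> = sc (of_int k) \<phi>" by (rule H_W[OF gen_W])
  \<comment> \<open>One side lies in \<open>A\<close> and the other in \<open>B\<close>, so both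
    vanish: each component of \<open>\<phi>\<close> has weight \<open>k\<close> itself and hence
    lies in \<open>U\<close>.\<close>
  then have "H u - sc (of_int k) u = sc (of_int k) v - H v"
    using T by (simp add: uv lin_add[OF lin_XYH(3)] scale_right_distrib algebra_simps)
  moreover have "H u - sc (of_int k) u \<in> A"
    using A uv by (simp add: subspace_diff subspace_scale)
  moreover have "sc (of_int k) v - H v \<in> B"
    using B uv by (simp add: subspace_diff subspace_scale)
  ultimately have "H u - sc (of_int k) u \<in> A \<inter> B" "sc (of_int k) v - H v \<in> A \<inter> B" by auto
  then have "H u = sc (of_int k) u" "H v = sc (of_int k) v" using AB(1) by auto
  then have "u \<in> {v \<in> M. H v = sc (of_int k) v}" "v \<in> {v \<in> M. H v = sc (of_int k) v}"
    using uv(1,2) AM BM by auto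
  then have U: "u \<in> U" "v \<in> U" unfolding weight_eq Mw_k .
  have gen_in: "\<phi> \<in> S"
    if S: "subspace S" "\<And>v. v \<in> S \<Longrightarrow> X v \<in> S" "\<And>v. v \<in> S \<Longrightarrow> Y v \<in> S"
      and w: "w \<in> S" "w \<in> U" "w = sc a \<phi> + N z" "z \<in> U" and a: "a \<noteq> 0" for S w a z
  proof -
    \<comment> \<open>Descending induction from exponent \<open>d + 1\<close>, where the image of
      \<open>U\<close> is 0. If the image under power \<open>i + 1\<close> lies in \<open>S\<close>,
      then power \<open>i\<close> applied to \<open>w\<close> shows the same for power
      \<open>i\<close> of \<open>\<phi>\<close>, and \<open>U_rep\<close> extends this to all of
      \<open>U\<close>.\<close>
    have "\<forall>y\<in>U. (N ^^ i) y \<in> S" if "i \<le> d + 1" for i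
      using that
    proof (induction rule: inc_induct)
      case base
      show ?case using N_nilpotent_U subspace_0[OF S(1)] by simp
    next
      case (step i)
      have "(N ^^ i) w \<in> S" by (induction i) (auto simp: w(1) N_def S)
      then have "sc a ((N ^^ i) \<phi>) + (N ^^ Suc i) z \<in> S"
        unfolding w(3) N_pow_rep[OF gen_U w(4)] .
      then have "sc a ((N ^^ i) \<phi>) + (N ^^ Suc i) z - (N ^^ Suc i) z \<in> S"
        using step.IH w(4) by (intro subspace_diff[OF S(1)]) blast+
      then have "sc (inverse a) (sc a ((N ^^ i) \<phi>)) \<in> S"
        unfolding add_diff_cancel_right' by (rule subspace_scale[OF S(1)])
      moreover have "sc (inverse a) (sc a ((N ^^ i) \<phi>)) = (N ^^ i) \<phi>" using a by simp
      ultimately have gi: "(N ^^ i) \<phi> \<in> S" by (simp only:)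
      show ?case
      proof
        fix y assume "y \<in> U"
        then obtain b z' where z': "z' \<in> U" and y: "y = sc b \<phi> + N z'" using U_rep by blast
        show "(N ^^ i) y \<in> S"
          unfolding y N_pow_rep[OF gen_U z']
          using gi step.IH z' by (intro subspace_add subspace_scale S(1)) blast+
      qed
    qed
    from this[of 0] show ?thesis using gen_U by simp
  qed
  obtain a z b z' where ab: "z \<in> U" "u = sc a \<phi> + N z" "z' \<in> U" "v = sc b \<phi> + N z'"
    using U_rep[OF U(1)] U_rep[OF U(2)] by blast
  consider "a \<noteq> 0" | "b \<noteq> 0" | "a = 0" "b = 0" by blast
  then show ?thesis
  proof cases
    case 1
    have gen: "\<phi> \<in> A" by (rule gen_in[OF A(1) _ _ uv(1) U(1) ab(2,1) 1]) (erule A(2,3))+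
    have "M \<subseteq> A" by (rule M_least[OF A(1) _ _ gen]) (erule A(2,3))+
    then show ?thesis using AB BM by auto
  next
    case 2
    have gen: "\<phi> \<in> B" by (rule gen_in[OF B(1) _ _ uv(2) U(2) ab(4,3) 2]) (erule B(2,3))+
    have "M \<subseteq> B" by (rule M_least[OF B(1) _ _ gen]) (erule B(2,3))+
    then show ?thesis using AB AM by auto
  next
    case 3
    have y: "z + z' \<in> U" using ab subspace_U by (simp add: subspace_add)
    have "\<phi> = (sc a \<phi> + N z) + (sc b \<phi> + N z')"
      unfolding ab(2,4)[symmetric] by (rule uv(3))
    then have "\<phi> = N z + N z'" by (simp only: 3 scale_zero_left add_0)
    then have eq: "\<phi> = N (z + z')" using ab(1,3) U_T by (simp only: lin_add[OF lin_N])
    \<comment> \<open>If neither component has a leading coefficient, \<open>\<phi>\<close> lies in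
      \<open>N U\<close>. Then \<open>U = N U\<close>, so \<open>\<phi>\<close> lies in the image of
      every power of \<open>N\<close> and is 0, and the module is 0.\<close>
    have "\<exists>y\<in>U. \<phi> = (N ^^ j) y" for j
    proof (induction j)
      case 0
      show ?case using gen_U by auto
    next
      case (Suc j)
      then obtain w where w: "w \<in> U" "\<phi> = (N ^^ j) w" by blast
      obtain c x where x: "x \<in> U" "w = sc c \<phi> + N x" using U_rep[OF w(1)] by blast
      have "sc c \<phi> + N x = N (sc c (z + z') + x)"
        unfolding lin_add[OF lin_N subspace_scale[OF subspace_T U_T[OF y]] U_T[OF x(1)]]
          lin_scale[OF lin_N U_T[OF y]] eq[symmetric] ..
      with x(2) have "w = N (sc c (z + z') + x)" by (rule trans)
      then have "(N ^^ j) w = (N ^^ Suc j) (sc c (z + z') + x)"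
        by (simp only: funpow_Suc_right o_apply)
      moreover have "sc c (z + z') + x \<in> U"
        using y x(1) subspace_U by (simp add: subspace_add subspace_scale)
      ultimately show ?case by (intro bexI trans[OF w(2)])
    qed
    then obtain w where w: "w \<in> U" "\<phi> = (N ^^ (d + 1)) w" by blast
    have "\<phi> = 0" by (rule trans[OF w(2) N_nilpotent_U[OF w(1)]])
    have "M \<subseteq> {0}"
      by (rule M_least) (auto simp: \<open>\<phi> = 0\<close> lin_0[OF lin_XYH(1)] lin_0[OF lin_XYH(2)])
    then have "A \<subseteq> {0}" using AM by blast
    then show ?thesis using subspace_0[OF A(1)] by blast
  qed
qed

end

section \<open>The quiver representations\<close>

text \<open>A path that starts in \<open>S\<close> is back at its starting vertex after every two
  arrows, and each round trip acts as \<open>c i\<close>. \<open>S\<close> is a parameter because in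
  the Gelfand quiver only the middle vertex has this property.\<close>

lemma long_paths_vanish:
  assumes zero: "\<And>e. e \<in> arcs Q \<Longrightarrow> arrow V e 0 = (0::'v::ab_group_add)"
    and two: "\<And>i e e' v. i \<in> S \<Longrightarrow> v \<in> vspace V i \<Longrightarrow> e \<in> arcs Q \<Longrightarrow> e' \<in> arcs Q \<Longrightarrow>
        tail Q e = i \<Longrightarrow> tail Q e' = head Q e \<Longrightarrow>
        head Q e' = i \<and> arrow V e' (arrow V e v) = c i v \<and> c i v \<in> vspace V i"
    and "i \<in> S" "v \<in> vspace V i" "(c i ^^ m) v = 0"
      "set p \<subseteq> arcs Q" "pre_digraph.cas Q i p j" "length p \<ge> 2 * m"
  shows "path_map V p v = 0"
  using assms(4-)
proof (induction m arbitrary: v p)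
  case 0
  have "path_map V p 0 = 0" if "set p \<subseteq> arcs Q" for p
    using that by (induction p) (auto simp: path_map_def zero)
  then show ?case using 0 by simp
next
  case (Suc m)
  then obtain e e' q where p: "p = e # e' # q"
    by (cases p; cases "tl p") auto
  then have e: "e \<in> arcs Q" "e' \<in> arcs Q" "tail Q e = i" "tail Q e' = head Q e"
    "pre_digraph.cas Q (head Q e') q j" "set q \<subseteq> arcs Q" "length q \<ge> 2 * m"
    using Suc.prems by (auto simp: pre_digraph.cas.simps)
  have st: "head Q e' = i" "arrow V e' (arrow V e v) = c i v" "c i v \<in> vspace V i"
    using two[OF assms(3) Suc.prems(1) e(1-4)] by auto
  have "(c i ^^ m) (c i v) = 0" using Suc.prems(2) by (simp only: funpow_Suc_right o_apply)
  from Suc.IH[OF st(3) this e(6) _ e(7)] e(5) st show ?case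
    by (simp add: p path_map_def)
qed

context weight_module
begin

lemma U_generated:
  assumes "subspace S" "\<phi> \<in> S" "\<And>v. v \<in> S \<Longrightarrow> v \<in> U \<Longrightarrow> N v \<in> S"
  shows "U \<subseteq> S"
proof -
  have "(N ^^ j) \<phi> \<in> S" for j
    by (induction j) (simp_all add: assms N_pow_gen_U)
  then show ?thesis unfolding U_def by (intro span_minimal[OF _ assms(1)]) blast
qed

text \<open>Here \<open>l = 0\<close>, and \<open>s\<close> vanishes at weight 1. Hence the round
  trips at both vertices are Casimir operators without a scalar term, and nilpotent. The generator
  sits at the vertex of weight 1.\<close>

lemma two_cyclic_rep_cyclic:
  fixes V :: "(vertex, arrow_name, 'v) quiver_rep"
  assumes k: "k = 1"
    and V: "vspace V V_minus = Mw (-1)" "vspace V V_plus = Mw 1"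
      "arrow V Arr_a = X" "arrow V Arr_b = Y"
  shows "cyclic_quiver_rep sc two_cyclic_quiver {} V"
proof -
  let ?Q = two_cyclic_quiver
  define w :: "vertex \<Rightarrow> int" where "w i = (if i = V_minus then -1 else 1)" for i
  have l: "l = 0" using l_eq k by simp
  have s1: "s 1 = 0" using s_k k by simp
  have X: "X v \<in> Mw 1" if "v \<in> Mw (-1)" for v using X_Mw[OF that] by simp
  have Y: "Y v \<in> Mw (-1)" if "v \<in> Mw 1" for v using Y_Mw[OF that] by simp
  have YX: "Y (X v) = cas (-1) v" if "v \<in> Mw (-1)" for v
    using YX_eq[OF Mw_W[OF that]] s1 by simp
  have XY: "X (Y v) = cas 1 v" for v
    using XY_eq[of v 1] s1 by simp
  have "nilpotent_quiver_rep sc ?Q {} V"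
    unfolding nilpotent_quiver_rep_def
  proof (intro conjI)
    show "\<forall>i\<in>verts ?Q. subspace (vspace V i) \<and> finite_dim sc (vspace V i)"
      by (auto simp: two_cyclic_quiver_def V subspace_Mw Mw_finite_dim)
    show "\<forall>e\<in>arcs ?Q. arrow V e \<in> vspace V (tail ?Q e) \<rightarrow> vspace V (head ?Q e) \<and>
        (\<forall>u\<in>vspace V (tail ?Q e). \<forall>v\<in>vspace V (tail ?Q e).
           arrow V e (u + v) = arrow V e u + arrow V e v) \<and>
        (\<forall>c. \<forall>v\<in>vspace V (tail ?Q e). arrow V e (sc c v) = sc c (arrow V e v))"
      by (auto simp: two_cyclic_quiver_def V X Y Mw_T lin_add[OF lin_XYH(1)] lin_add[OF lin_XYH(2)]
          lin_scale[OF lin_XYH(1)] lin_scale[OF lin_XYH(2)])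
    have "path_map V p v = 0"
      if "pre_digraph.awalk ?Q i p j" "length p \<ge> 2 * (d + 1)" "v \<in> vspace V i" for i p j v
    proof (rule long_paths_vanish[where Q = ?Q and S = "verts ?Q" and c = "\<lambda>i. cas (w i)"])
      show "arrow V e 0 = 0" if "e \<in> arcs ?Q" for e
        using that by (auto simp: two_cyclic_quiver_def V lin_0[OF lin_XYH(1)] lin_0[OF lin_XYH(2)])
      show "head ?Q e' = i \<and> arrow V e' (arrow V e v) = cas (w i) v \<and> cas (w i) v \<in> vspace V i"
        if "v \<in> vspace V i" "e \<in> arcs ?Q" "e' \<in> arcs ?Q" "tail ?Q e = i" "tail ?Q e' = head ?Q e"
        for i e e' v
        using that by (auto simp: two_cyclic_quiver_def V w_def XY YX cas_Mw)
      show "i \<in> verts ?Q" "set p \<subseteq> arcs ?Q" "pre_digraph.cas ?Q i p j"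
        using that(1) by (auto simp: pre_digraph.awalk_def)
      then show "(cas (w i) ^^ (d + 1)) v = 0"
        using that(3) by (intro cas_nilpotent) (auto simp: two_cyclic_quiver_def V w_def)
    qed (use that in auto)
    then show "\<exists>N. \<forall>i p j. pre_digraph.awalk ?Q i p j \<and> length p \<ge> N \<longrightarrow>
        (\<forall>v\<in>vspace V i. path_map V p v = 0)" by blast
  qed auto
  moreover have "W j = vspace V j"
    if W: "quiver_subrep sc ?Q V W" "\<phi> \<in> W V_plus" and j: "j \<in> verts ?Q" for W j
  proof -
    have sub: "subspace (W V_plus)" "W V_plus \<subseteq> Mw 1" "W V_minus \<subseteq> Mw (-1)"
      and ar: "\<And>v. v \<in> W V_minus \<Longrightarrow> X v \<in> W V_plus" "\<And>v. v \<in> W V_plus \<Longrightarrow> Y v \<in> W V_minus"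
      using W(1) by (auto simp: quiver_subrep_def two_cyclic_quiver_def V)
    have U: "U \<subseteq> W V_plus"
      by (rule U_generated[OF sub(1) W(2)]) (auto simp: N_def ar)
    moreover have "Mw 1 = U" "Mw (-1) = Y ` U" using Mw_k Mw_down[of 1] k by auto
    ultimately have "Mw 1 \<subseteq> W V_plus" "Mw (-1) \<subseteq> W V_minus" using ar by auto
    then show ?thesis using j sub by (auto simp: two_cyclic_quiver_def V)
  qed
  moreover have "\<phi> \<in> vspace V V_plus" "V_plus \<in> verts ?Q"
    using gen_U Mw_k k by (auto simp: V two_cyclic_quiver_def)
  ultimately show ?thesis unfolding cyclic_quiver_rep_def by blast
qed

text \<open>Both round trips at the middle vertex equal \<open>cas st\<close>, one because
  \<open>s st = 0\<close>, the other because \<open>s pl = 0\<close> and powers of X commute with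
  the Casimir operator. This yields the relation and nilpotency together.\<close>

lemma gelfand_rep_cyclic:
  fixes V :: "(vertex, arrow_name, 'v) quiver_rep"
  assumes k: "k \<noteq> 1"
    and V: "vspace V V_minus = Mw (- int l - 1)" "vspace V V_star = Mw (- int l + 1)"
      "vspace V V_plus = Mw (int l + 1)"
      "arrow V Arr_a_minus = X" "arrow V Arr_b_minus = Y" "arrow V Arr_b_plus = X ^^ l"
      "arrow V Arr_a_plus = (\<lambda>v. inv_into (Mw (- int l + 1)) (X ^^ (l - 1)) (Y v))"
  shows "cyclic_quiver_rep sc gelfand_quiver gelfand_relations V"
proof -
  let ?Q = gelfand_quiver
  \<comment> \<open>\<open>md\<close> is not a vertex: it is the weight that X^(l - 1) identifies
    with the weight \<open>st\<close>.\<close>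
  define mi st md pl where defs: "mi = - int l - 1" "st = - int l + 1" "md = int l - 1" "pl = int l + 1"
  define m where "m = l - 1"
  define a where "a v = inv_into (Mw st) (X ^^ m) (Y v)" for v
  note V = V[folded defs m_def, folded a_def[abs_def]]
  have shift: "mi + 2 = st" "st - 2 = mi" "pl - 2 = md" "md + 2 = pl" by (simp_all add: defs)
  have l: "l \<ge> 1" using l_eq k by simp
  have s0: "s st = 0" "s pl = 0" by (auto simp: s_def defs)
  \<comment> \<open>At these weights \<open>4 * s\<close> equals \<open>4 * j * (j - l)\<close>,
    whose zeros are the excluded ends \<open>j = 0\<close> and \<open>j = l\<close>.\<close>
  have s_ne: "s (st + 2 * int j) \<noteq> 0" if "1 \<le> j" "j \<le> m" for j
  proof -
    have "(st + 2 * int j - 1)\<^sup>2 - (int l)\<^sup>2 = 4 * int j * (int j - int l)"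
      by (simp add: defs power2_eq_square algebra_simps)
    moreover have "4 * int j * (int j - int l) \<noteq> 0" using that l by (simp add: m_def)
    ultimately show ?thesis unfolding s_def by (simp del: of_int_diff of_int_power of_int_mult)
  qed
  have md: "st + 2 * int m = md" using l by (simp add: defs m_def)
  have bij: "bij_betw (X ^^ m) (Mw st) (Mw md)"
    using X_pow_bij[of m st, OF s_ne] by (simp add: md)
  have X: "X v \<in> Mw st" if "v \<in> Mw mi" for v using X_Mw[OF that] by (simp add: shift)
  have Y: "Y v \<in> Mw mi" if "v \<in> Mw st" for v using Y_Mw[OF that] by (simp add: shift)
  have Yp: "Y v \<in> Mw md" if "v \<in> Mw pl" for v using Y_Mw[OF that] by (simp add: shift)
  have Xl_eq: "(X ^^ l) v = X ((X ^^ m) v)" for v using l by (cases l) (auto simp: m_def)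
  have Xl: "(X ^^ l) v \<in> Mw pl" if "v \<in> Mw st" for v
    using X_Mw[of "(X ^^ m) v" md] bij_betwE[OF bij] that by (auto simp: Xl_eq shift)
  have a_mem: "a v \<in> Mw st" and Xa: "(X ^^ m) (a v) = Y v"
    if "v \<in> Mw pl" for v
    using Yp[OF that] bij unfolding a_def
    by (auto simp: bij_betw_def intro!: inv_into_into f_inv_into_f)
  \<comment> \<open>Characterizes \<open>a v\<close> as the unique preimage of \<open>Y v\<close>;
    the linearity of \<open>a\<close> and the second round trip follow from it without touching
    \<open>inv_into\<close>.\<close>
  have a_eq: "a v = u" if "u \<in> Mw st" "(X ^^ m) u = Y v" for u v
    using that bij unfolding a_def by (metis bij_betw_def inv_into_f_f)
  have XY: "X (Y v) = cas st v" for v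
    using XY_eq[of v st] s0 by simp
  have aX: "a ((X ^^ l) v) = cas st v" if v: "v \<in> Mw st" for v
  proof (rule a_eq)
    show "cas st v \<in> Mw st" by (rule cas_Mw[OF v])
    have "(X ^^ m) (cas st v) = cas md ((X ^^ m) v)"
      using cas_X_pow[OF Mw_W[OF v], of m] unfolding md by simp
    also have "\<dots> = Y (X ((X ^^ m) v))"
    proof -
      have "(X ^^ m) v \<in> W md" using bij_betwE[OF bij] v Mw_W by auto
      from YX_eq[OF this] show ?thesis using s0 by (simp add: shift)
    qed
    finally show "(X ^^ m) (cas st v) = Y ((X ^^ l) v)" by (simp add: Xl_eq)
  qed
  have a_add: "a (u + v) = a u + a v" if "u \<in> Mw pl" "v \<in> Mw pl" for u v
    using that a_mem[OF that(1)] a_mem[OF that(2)]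
    by (intro a_eq) (simp_all add: subspace_add[OF subspace_Mw] lin_add[OF lin_X_pow]
        lin_add[OF lin_XYH(2)] Mw_T Xa)
  have a_scale: "a (sc c v) = sc c (a v)" if "v \<in> Mw pl" for c v
    using that a_mem[OF that]
    by (intro a_eq) (simp_all add: subspace_scale[OF subspace_Mw] lin_scale[OF lin_X_pow]
        lin_scale[OF lin_XYH(2)] Mw_T Xa)
  have a_0: "a 0 = 0"
    using a_scale[OF subspace_0[OF subspace_Mw], of 0] by simp
  have zero: "arrow V e 0 = 0" if "e \<in> arcs ?Q" for e
    using that by (auto simp: gelfand_quiver_def V lin_0[OF lin_XYH(1)] lin_0[OF lin_XYH(2)]
        lin_0[OF lin_X_pow] a_0)
  have maps: "arrow V e \<in> vspace V (tail ?Q e) \<rightarrow> vspace V (head ?Q e)" if "e \<in> arcs ?Q" for e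
    using that by (auto simp: gelfand_quiver_def V X Y Xl a_mem)
  have "nilpotent_quiver_rep sc ?Q gelfand_relations V"
    unfolding nilpotent_quiver_rep_def
  proof (intro conjI)
    show "\<forall>i\<in>verts ?Q. subspace (vspace V i) \<and> finite_dim sc (vspace V i)"
      by (auto simp: gelfand_quiver_def V subspace_Mw Mw_finite_dim)
    show "\<forall>e\<in>arcs ?Q. arrow V e \<in> vspace V (tail ?Q e) \<rightarrow> vspace V (head ?Q e) \<and>
        (\<forall>u\<in>vspace V (tail ?Q e). \<forall>v\<in>vspace V (tail ?Q e).
           arrow V e (u + v) = arrow V e u + arrow V e v) \<and>
        (\<forall>c. \<forall>v\<in>vspace V (tail ?Q e). arrow V e (sc c v) = sc c (arrow V e v))"
      by (auto simp: gelfand_quiver_def V X Y Xl a_mem Mw_T lin_add[OF lin_XYH(1)] lin_add[OF lin_XYH(2)]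
        lin_scale[OF lin_XYH(1)] lin_scale[OF lin_XYH(2)] lin_add[OF lin_X_pow]
        lin_scale[OF lin_X_pow] a_add a_scale)
    show "\<forall>(p, q)\<in>gelfand_relations. \<forall>i j. pre_digraph.awalk ?Q i p j \<and> pre_digraph.awalk ?Q i q j \<longrightarrow>
        (\<forall>v\<in>vspace V i. path_map V p v = path_map V q v)"
      by (auto simp: gelfand_relations_def pre_digraph.awalk_def pre_digraph.cas.simps
          path_map_def gelfand_quiver_def V XY aX)
    have star: "path_map V p v = 0"
      if "set p \<subseteq> arcs ?Q" "pre_digraph.cas ?Q V_star p j" "length p \<ge> 2 * (d + 1)"
        "v \<in> vspace V V_star" for p j v
    proof (rule long_paths_vanish[where Q = ?Q and S = "{V_star}" and c = "\<lambda>i. cas st"])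
      show "head ?Q e' = i \<and> arrow V e' (arrow V e v) = cas st v \<and>
          cas st v \<in> vspace V i"
        if "i \<in> {V_star}" "v \<in> vspace V i" "e \<in> arcs ?Q" "e' \<in> arcs ?Q" "tail ?Q e = i"
          "tail ?Q e' = head ?Q e" for i e e' v
        using that by (auto simp: gelfand_quiver_def V XY aX cas_Mw)
      show "(cas st ^^ (d + 1)) v = 0"
        by (rule cas_nilpotent) (use that V in auto)
    qed (use that zero in auto)
    \<comment> \<open>The extra 1 pays for the first arrow of a path that starts at an outer vertex;
      that arrow always ends at the middle vertex.\<close>
    have "path_map V p v = 0"
      if p: "pre_digraph.awalk ?Q i p j" "length p \<ge> 2 * (d + 1) + 1" "v \<in> vspace V i" for i p j v
    proof (cases "i = V_star")
      case True
      then show ?thesis using star[of p j v] p by (auto simp: pre_digraph.awalk_def)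
    next
      case False
      obtain e q where q: "p = e # q" using p(2) by (cases p) auto
      then have e: "e \<in> arcs ?Q" "tail ?Q e = i" "set q \<subseteq> arcs ?Q" "pre_digraph.cas ?Q (head ?Q e) q j"
        using p(1) by (auto simp: pre_digraph.awalk_def pre_digraph.cas.simps)
      have h: "head ?Q e = V_star" using e(1,2) False by (auto simp: gelfand_quiver_def)
      have "arrow V e v \<in> vspace V V_star" using maps[OF e(1)] p(3) e(2) h by auto
      from star[OF e(3) _ _ this] e(4) h p(2) show ?thesis by (simp add: q path_map_def)
    qed
    then show "\<exists>N. \<forall>i p j. pre_digraph.awalk ?Q i p j \<and> length p \<ge> N \<longrightarrow>
        (\<forall>v\<in>vspace V i. path_map V p v = 0)" by blast
  qed
  moreover have "\<exists>i\<in>verts ?Q. \<exists>v\<in>vspace V i.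
        \<forall>W. quiver_subrep sc ?Q V W \<and> v \<in> W i \<longrightarrow> (\<forall>j\<in>verts ?Q. W j = vspace V j)"
  proof -
    have subrep: "subspace (W V_star)" "subspace (W V_plus)"
       "W V_star \<subseteq> Mw st" "W V_minus \<subseteq> Mw mi" "W V_plus \<subseteq> Mw pl"
       "\<And>v. v \<in> W V_minus \<Longrightarrow> X v \<in> W V_star" "\<And>v. v \<in> W V_star \<Longrightarrow> Y v \<in> W V_minus"
       "\<And>v. v \<in> W V_star \<Longrightarrow> (X ^^ l) v \<in> W V_plus" "\<And>v. v \<in> W V_plus \<Longrightarrow> a v \<in> W V_star"
      if "quiver_subrep sc ?Q V W" for W
      using that by (auto simp: quiver_subrep_def gelfand_quiver_def V)
    consider (star) "k = st" | (plus) "k = pl" using l_eq unfolding defs by linarith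
    then show ?thesis
    proof cases
      \<comment> \<open>Weight \<open>k = 1 - l\<close>: the outer vertices carry the images of
        \<open>U\<close> under \<open>Y\<close> and \<open>X^l\<close>, which are themselves
        arrows.\<close>
      case star
      have Ueq: "Mw st = U" "Mw mi = Y ` U" "Mw pl = (X ^^ l) ` U"
        using Mw_k Mw_down[of 1] Mw_up[of l] unfolding star
        by (simp_all add: shift) (simp add: defs)
      have "W j = vspace V j"
        if W: "quiver_subrep sc ?Q V W" "\<phi> \<in> W V_star" and j: "j \<in> verts ?Q" for W j
      proof -
        note sub = subrep[OF W(1)]
        have "U \<subseteq> W V_star"
          by (rule U_generated[OF sub(1) W(2)]) (auto simp: N_def sub(6,7))
        then have "Mw st \<subseteq> W V_star" "Mw mi \<subseteq> W V_minus" "Mw pl \<subseteq> W V_plus"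
          using sub(7,8) by (auto simp: Ueq)
        then show ?thesis using j sub(3-5) by (auto simp: gelfand_quiver_def V)
      qed
      moreover have "\<phi> \<in> vspace V V_star" using gen_U by (simp add: V Ueq)
      moreover have "V_star \<in> verts ?Q" by (simp add: gelfand_quiver_def)
      ultimately show ?thesis by blast
    next
      \<comment> \<open>Weight \<open>k = 1 + l\<close>: now \<open>N\<close> is the path going to
        the middle vertex along \<open>a\<close> and back along \<open>X^l\<close>, and the other
        vertices are reached through \<open>a\<close> and then \<open>Y\<close>.\<close>
      case plus
      have Ueq: "Mw pl = U" "Mw md = Y ` U"
        using Mw_k Mw_down[of 1] unfolding plus by (simp_all add: shift)
      have "mi = k - 2 * int (Suc l)" "st = k - 2 * int l" using plus by (auto simp: defs)
      then have minus: "Mw mi = Y ` Mw st"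
        by (simp only: Mw_down) (simp add: image_image)
      have "W j = vspace V j"
        if W: "quiver_subrep sc ?Q V W" "\<phi> \<in> W V_plus" and j: "j \<in> verts ?Q" for W j
      proof -
        note sub = subrep[OF W(1)]
        have "N v \<in> W V_plus" if "v \<in> W V_plus" for v
        proof -
          have "N v = (X ^^ l) (a v)" using Xa[of v] sub(5) that by (auto simp: N_def Xl_eq)
          then show ?thesis using sub(8,9) that by simp
        qed
        then have U: "U \<subseteq> W V_plus" by (intro U_generated[OF sub(2) W(2)]) auto
        have st: "Mw st \<subseteq> W V_star"
        proof
          fix u assume u: "u \<in> Mw st"
          \<comment> \<open>Pushing \<open>u\<close> up to weight \<open>md\<close> lands in
            \<open>Y\<close> applied to \<open>U\<close>, so \<open>u\<close> is the value of
            \<open>a\<close> at a vector of \<open>U\<close>.\<close>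
          then have "(X ^^ m) u \<in> Y ` U" using bij_betwE[OF bij] by (auto simp: Ueq)
          then obtain v where "v \<in> U" "(X ^^ m) u = Y v" by auto
          then show "u \<in> W V_star" using a_eq[OF u] U sub(9) by blast
        qed
        then have "Mw mi \<subseteq> W V_minus" using sub(7) by (auto simp: minus)
        then show ?thesis using j st U sub(3-5) by (auto simp: gelfand_quiver_def V Ueq)
      qed
      moreover have "\<phi> \<in> vspace V V_plus" using gen_U by (simp add: V Ueq)
      moreover have "V_plus \<in> verts ?Q" by (simp add: gelfand_quiver_def)
      ultimately show ?thesis by blast
    qed
  qed
  ultimately show ?thesis unfolding cyclic_quiver_rep_def by blast
qed

end

section \<open>The module of a Maass form\<close>

context weight_module
begin

lemma lin_plus: "lin f \<Longrightarrow> lin g \<Longrightarrow> lin (\<lambda>v. f v + g v)"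
  by (simp add: lin_def scale_right_distrib algebra_simps)

lemma lin_scaled: "lin f \<Longrightarrow> lin (\<lambda>v. sc a (f v))"
  by (simp add: lin_def scale_right_distrib scale_left_commute)

lemma lin_eqI:
  assumes "lin f" "lin g" "\<And>n v. v \<in> W n \<Longrightarrow> f v = g v" "v \<in> T"
  shows "f v = g v"
proof -
  have "f v = g v \<and> v \<in> T"
    using assms(4) unfolding T_def
  proof (induction v rule: span_induct_alt)
    case base
    show ?case by (simp add: lin_0[OF assms(1)] lin_0[OF assms(2)] span_zero)
  next
    case (step a x y)
    then obtain n where x: "x \<in> W n" by auto
    have "y \<in> T" using step by (simp add: T_def)
    then show ?case
      using step subspace_scale[OF subspace_T W_T[OF x], of a] assms(3)[OF x] W_T[OF x]
        subspace_add[OF subspace_T]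
      by (simp add: lin_add[OF assms(1)] lin_add[OF assms(2)] lin_scale[OF assms(1)]
          lin_scale[OF assms(2)] T_def[symmetric])
  qed
  then show ?thesis by simp
qed

section \<open>Operators preserving the module\<close>

text \<open>The properties on \<open>M\<close> that pass through sums, scalings and compositions,
  and so hold for all of \<open>Ug\<close>, although its elements are operators on arbitrary
  functions.\<close>

definition endo :: "('v \<Rightarrow> 'v) \<Rightarrow> bool" where
  "endo D \<longleftrightarrow> (\<forall>v\<in>M. D v \<in> M) \<and> (\<forall>u\<in>M. \<forall>v\<in>M. D (u + v) = D u + D v) \<and>
     (\<forall>a. \<forall>v\<in>M. D (sc a v) = sc a (D v))"

lemma endo_id: "endo (\<lambda>v. v)"
  by (simp add: endo_def)

lemma endo_lin: "lin f \<Longrightarrow> (\<And>v. v \<in> M \<Longrightarrow> f v \<in> M) \<Longrightarrow> endo f"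
  using M_T by (simp add: endo_def lin_def)

lemma endo_plus: "endo D \<Longrightarrow> endo E \<Longrightarrow> endo (\<lambda>v. D v + E v)"
  by (simp add: endo_def subspace_add[OF subspace_M] scale_right_distrib algebra_simps)

lemma endo_scaled: "endo D \<Longrightarrow> endo (\<lambda>v. sc a (D v))"
  by (simp add: endo_def subspace_scale[OF subspace_M] scale_right_distrib scale_left_commute)

lemma endo_comp: "endo D \<Longrightarrow> endo E \<Longrightarrow> endo (\<lambda>v. D (E v))"
  by (simp add: endo_def)

lemma endo_M: "endo D \<Longrightarrow> v \<in> M \<Longrightarrow> D v \<in> M"
  by (simp add: endo_def)

lemma endo_sum:
  assumes "endo D" "finite I" "\<And>i. i \<in> I \<Longrightarrow> c i \<in> M"
  shows "D (sum c I) = (\<Sum>i\<in>I. D (c i))"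
  using assms(2,3)
proof (induction I rule: finite_induct)
  case empty
  have "D (sc 0 0) = sc 0 (D 0)"
    using assms(1) subspace_0[OF subspace_M] unfolding endo_def by blast
  then show ?case by simp
next
  case (insert i I)
  then show ?case using assms(1) by (simp add: endo_def subspace_sum[OF subspace_M])
qed

lemma endo_Mw:
  assumes "endo D" "D (H v) = H (D v)" "v \<in> Mw n"
  shows "D v \<in> Mw n"
proof -
  have "H (D v) = sc (of_int n) (D v)"
    using assms Mw_M[OF assms(3)] H_W[OF Mw_W[OF assms(3)]] by (simp add: endo_def)
  then have "D v \<in> {w \<in> M. H w = sc (of_int n) w}"
    using endo_M[OF assms(1) Mw_M[OF assms(3)]] by simp
  then show ?thesis by (simp only: weight_eq)
qed

end

section \<open>The lift of a Maass form as generator\<close>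

locale maass_lift =
  fixes \<Gamma> :: "(real^2^2) set" and \<rho> :: "real^2^2 \<Rightarrow> complex^'n^'n"
    and k :: int and d :: nat and f :: "complex \<Rightarrow> complex^'n"
  assumes \<Gamma>_SL2R: "\<Gamma> \<subseteq> carrier SL2R"
    and f_smooth: "smooth_on_open upper_half_plane f"
    and f_equivariant: "\<gamma> \<in> \<Gamma> \<Longrightarrow> \<tau> \<in> upper_half_plane \<Longrightarrow> slash k f \<gamma> \<tau> = \<rho> \<gamma> *v f \<tau>"
    and f_polyharmonic: "\<tau> \<in> upper_half_plane \<Longrightarrow> (laplace_op k ^^ (d + 1)) f \<tau> = 0"
    and f_nonzero: "\<exists>\<tau>\<in>upper_half_plane. f \<tau> \<noteq> 0"
begin

abbreviation "X \<equiv> gact elt_X :: (real^2^2 \<Rightarrow> complex^'n) \<Rightarrow> _"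
abbreviation "Y \<equiv> gact elt_Y :: (real^2^2 \<Rightarrow> complex^'n) \<Rightarrow> _"
abbreviation "H \<equiv> gact elt_H :: (real^2^2 \<Rightarrow> complex^'n) \<Rightarrow> _"
abbreviation "\<phi> \<equiv> group_lift k f"

lemma span_lifts_curve_differentiable:
  "v \<in> fscale.span (\<Union>(range lifts)) \<Longrightarrow> curve_differentiable (v :: real^2^2 \<Rightarrow> complex^'n)"
  using fscale.span_minimal[OF _ curve_differentiable_subspace, of "\<Union>(range lifts)"]
    curve_differentiable_group_lift
  by (fastforce simp: lifts_def)

lemma moebius_i: "g \<in> carrier SL2R \<Longrightarrow> moebius_act g \<i> \<in> upper_half_plane"
  using moebius_act_upper_half_plane[OF _ i_upper_half_plane, of g] by (simp add: carrier_SL2R)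

lemma XY_group_lift:
  assumes "smooth_on_open upper_half_plane h"
  shows "X (Y (group_lift k h)) = fscale (- 1) (group_lift k (laplace_op k h))"
  using assms
  by (simp add: gact_elt_group_lift smooth_lowering_op)
    (simp add: fun_eq_iff fscale_def group_lift_def slash_def laplace_op_def vec_eq_iff)

lemma smooth_laplace_op:
  assumes "smooth_on_open upper_half_plane (h :: complex \<Rightarrow> complex^'n)"
  shows "smooth_on_open upper_half_plane (laplace_op k h)"
proof -
  have "smooth_on_open upper_half_plane (raising_op (k - 2) (lowering_op k h))"
    by (intro smooth_raising_op smooth_lowering_op assms)
  then have "Ck_on n upper_half_plane (\<lambda>\<tau>. - raising_op (k - 2) (lowering_op k h) \<tau>)" for n
    by (intro Ck_on_bounded_linear[OF bounded_linear_minus[OF bounded_linear_ident]]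
        open_upper_half_plane smooth_Ck_on)
  then show ?thesis
    by (simp add: smooth_on_open_def open_upper_half_plane laplace_op_def[abs_def])
qed

text \<open>Smoothness is carried along in the induction, since each further application of X and Y
  is known only on lifts of smooth functions.\<close>

lemma XY_pow_group_lift:
  "smooth_on_open upper_half_plane ((laplace_op k ^^ j) f) \<and>
   ((\<lambda>v. X (Y v)) ^^ j) \<phi> = fscale ((- 1) ^ j) (group_lift k ((laplace_op k ^^ j) f))"
proof (induction j)
  case 0
  then show ?case by (simp add: f_smooth)
next
  case (Suc j)
  define h where "h = (laplace_op k ^^ j) f"
  have h: "smooth_on_open upper_half_plane h" using Suc by (simp add: h_def)
  have "Y (fscale c (group_lift k h)) = fscale c (group_lift (k - 2) (lowering_op k h))" for c
    using h by (simp add: gact_scale curve_differentiable_group_lift elt_sl2C gact_elt_group_lift)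
  then have "X (Y (fscale c (group_lift k h))) = fscale c (X (Y (group_lift k h)))" for c
    using h by (simp add: gact_scale curve_differentiable_group_lift elt_sl2C gact_elt_group_lift
        smooth_lowering_op)
  then show ?case
    using Suc smooth_laplace_op[OF h] by (simp add: XY_group_lift[OF h] h_def[symmetric])
qed

sublocale weight_module fscale lifts X Y H k "nat \<bar>k - 1\<bar>" d \<phi>
proof
  fix n and v :: "real^2^2 \<Rightarrow> complex^'n" assume "v \<in> lifts n"
  then obtain h where h: "v = group_lift n h" "smooth_on_open upper_half_plane h"
    by (auto simp: lifts_def)
  show "X v \<in> lifts (n + 2)" "Y v \<in> lifts (n - 2)" "H v = fscale (of_int n) v"
    using smooth_raising_op[OF h(2)] smooth_lowering_op[OF h(2)]
    unfolding h(1) gact_elt_group_lift[OF h(2)] lifts_def by blast+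
  show "X (Y v) = Y (X v) + fscale (of_int n) v"
    using \<open>v \<in> lifts n\<close> by (rule gact_elt_commutator)
next
  fix F and u v :: "real^2^2 \<Rightarrow> complex^'n" and a
  assume F: "F \<in> {X, Y, H}" and v: "v \<in> fscale.span (\<Union>(range lifts))"
  show "F (fscale a v) = fscale a (F v)"
    using F by (auto simp: gact_scale span_lifts_curve_differentiable[OF v] elt_sl2C)
  assume u: "u \<in> fscale.span (\<Union>(range lifts))"
  show "F (u + v) = F u + F v"
    using F by (auto simp: gact_add span_lifts_curve_differentiable[OF u]
        span_lifts_curve_differentiable[OF v] elt_sl2C)
next
  show "fscale.subspace (lifts n :: (real^2^2 \<Rightarrow> complex^'n) set)" for n
    by (rule lifts_subspace)
  show "\<phi> \<in> lifts k" using f_smooth by (auto simp: lifts_def)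
  have "group_lift k ((laplace_op k ^^ (d + 1)) f) = 0"
    using f_polyharmonic moebius_i by (auto simp: fun_eq_iff group_lift_def slash_def)
  then show "((\<lambda>v. X (Y v)) ^^ (d + 1)) \<phi> = 0"
    using XY_pow_group_lift[of "d + 1"] by simp
qed simp

lemma T_curve_differentiable: "v \<in> T \<Longrightarrow> curve_differentiable v"
  using span_lifts_curve_differentiable by (simp add: T_def)

lemma lin_gact: "Z \<in> sl2C \<Longrightarrow> lin (gact Z)"
  by (simp add: lin_def gact_add gact_scale T_curve_differentiable)

text \<open>The coordinate formula extends from single lifts to their span by linearity. With it,
  stability under X, Y and H gives stability under all of \<open>sl2C\<close>.\<close>

lemma gact_T:
  assumes "v \<in> T" "Z \<in> sl2C"
  shows "gact Z v = fscale (- \<i> * (Z $ 2 $ 1 - Z $ 1 $ 2) / 2) (H v)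
    + fscale (Z $ 1 $ 1 - \<i> * (Z $ 2 $ 1 + Z $ 1 $ 2) / 2) (X v)
    + fscale (Z $ 1 $ 1 + \<i> * (Z $ 2 $ 1 + Z $ 1 $ 2) / 2) (Y v)"
proof (rule lin_eqI[OF lin_gact[OF assms(2)] _ _ assms(1)])
  fix n and w :: "real^2^2 \<Rightarrow> complex^'n" assume "w \<in> lifts n"
  then obtain h where h: "w = group_lift n h" "smooth_on_open upper_half_plane h"
    by (auto simp: lifts_def)
  show "gact Z w = fscale (- \<i> * (Z $ 2 $ 1 - Z $ 1 $ 2) / 2) (H w)
    + fscale (Z $ 1 $ 1 - \<i> * (Z $ 2 $ 1 + Z $ 1 $ 2) / 2) (X w)
    + fscale (Z $ 1 $ 1 + \<i> * (Z $ 2 $ 1 + Z $ 1 $ 2) / 2) (Y w)"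
    unfolding h(1) gact_elt_group_lift[OF h(2)] by (rule gact_group_lift[OF h(2) assms(2)])
qed (intro lin_plus lin_scaled lin_XYH)

lemma gact_M: "v \<in> M \<Longrightarrow> Z \<in> sl2C \<Longrightarrow> gact Z v \<in> M"
  unfolding gact_T[OF M_T]
  by (intro fscale.subspace_add fscale.subspace_scale subspace_M XYH_M)

lemma Ug_endo: "D \<in> Ug \<Longrightarrow> endo D"
proof (induction rule: Ug.induct)
  case (lie Z)
  show ?case by (rule endo_lin[OF lin_gact[OF lie] gact_M[OF _ lie]])
qed (rule endo_id endo_plus endo_scaled endo_comp; assumption)+

section \<open>Automorphy and finiteness conditions\<close>

lemma M_smooth: "M \<subseteq> smooth_functions"
proof -
  have "Mw n \<subseteq> smooth_functions" for n
    using Mw_W group_lift_smooth by (fastforce simp: lifts_def)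
  then show ?thesis
    unfolding M_def by (intro fscale.span_minimal[OF _ smooth_functions_subspace]) auto
qed

text \<open>A rotation multiplies each weight component by a scalar, so the whole orbit of
  \<open>v\<close> stays in the span of its finitely many components.\<close>

lemma Kact_M:
  assumes "decomposes v c" "\<kappa> \<in> SO2R"
  shows "Kact \<kappa> v \<in> fscale.span (c ` {n. c n \<noteq> 0})"
proof -
  let ?I = "{n. c n \<noteq> 0}"
  have fin: "finite ?I" and v: "v = sum c ?I" and c: "\<And>n. c n \<in> Mw n"
    using assms(1) by (auto simp: decomposes_def)
  obtain x where x: "\<And>n h. Kact \<kappa> (group_lift n h :: real^2^2 \<Rightarrow> complex^'n) = fscale (x powi (- n)) (group_lift n h)"
    using group_lift_right_SO2R[OF assms(2)] by metis
  have Kc: "Kact \<kappa> (c n) = fscale (x powi (- n)) (c n)" for n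
  proof -
    obtain h where "c n = group_lift n h" using Mw_W[OF c[of n]] by (auto simp: lifts_def)
    then show ?thesis using x by simp
  qed
  have "Kact \<kappa> (sum c J) = (\<Sum>n\<in>J. Kact \<kappa> (c n))" if "finite J" for J
    using that by (induction J rule: finite_induct) (auto simp: Kact_def fun_eq_iff)
  then have "Kact \<kappa> v = (\<Sum>n\<in>?I. Kact \<kappa> (c n))" using fin v by simp
  also have "\<dots> = (\<Sum>n\<in>?I. fscale (x powi (- n)) (c n))" by (simp only: Kc)
  also have "\<dots> \<in> fscale.span (c ` ?I)"
    by (intro fscale.span_sum fscale.span_scale fscale.span_base) auto
  finally show ?thesis .
qed

text \<open>A central operator commutes with H on smooth functions and therefore keeps the
  weight.\<close>

lemma center_Ug_Mw:
  assumes "D \<in> center_Ug" "v \<in> Mw n"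
  shows "D v \<in> Mw n"
proof (rule endo_Mw[OF Ug_endo _ assms(2)])
  have "v \<in> smooth_functions" using M_smooth Mw_M[OF assms(2)] by auto
  then show "D (H v) = H (D v)"
    using assms(1) Ug.lie[OF elt_sl2C(1)] unfolding center_Ug_def by blast
  show "D \<in> Ug" using assms(1) by (simp add: center_Ug_def)
qed

text \<open>Minimality of \<open>M\<close> applied to the space of equivariant functions in
  \<open>T\<close>; membership in \<open>T\<close> ensures that the derivatives occurring in
  \<open>gact_equivariant\<close> exist.\<close>

lemma M_equivariant:
  assumes "v \<in> M" "h \<in> \<Gamma>" "g \<in> carrier SL2R"
  shows "v (h ** g) = \<rho> h *v v g"
proof -
  let ?A = "{v \<in> T. \<forall>h\<in>\<Gamma>. \<forall>g\<in>carrier SL2R. v (h ** g) = \<rho> h *v v g}"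
  have stable: "gact Z v \<in> ?A" if "Z \<in> sl2C" "gact Z v \<in> T" "v \<in> ?A" for Z v
    using that gact_equivariant[OF T_curve_differentiable that(1)] \<Gamma>_SL2R by auto
  have "M \<subseteq> ?A"
  proof (rule M_least)
    show "fscale.subspace ?A"
    proof (rule fscale.subspaceI)
      show "0 \<in> ?A" using fscale.subspace_0[OF subspace_T] by simp
      show "u + v \<in> ?A" if "u \<in> ?A" "v \<in> ?A" for u v
        using that fscale.subspace_add[OF subspace_T, of u v]
        by (simp add: matrix_vector_right_distrib)
      show "fscale a v \<in> ?A" if "v \<in> ?A" for a v
      proof -
        have "fscale a v \<in> T" using that fscale.subspace_scale[OF subspace_T] by blast
        moreover have "fscale a v (h ** g) = \<rho> h *v fscale a v g"
          if "h \<in> \<Gamma>" "g \<in> carrier SL2R" for h g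
          using that \<open>v \<in> ?A\<close> by (simp add: fscale_def vector_scalar_commute)
        ultimately show ?thesis by blast
      qed
    qed
    show "X v \<in> ?A" "Y v \<in> ?A" if "v \<in> ?A" for v
      using stable[OF elt_sl2C(2) _ that] stable[OF elt_sl2C(3) _ that] that XY_T by auto
    show "\<phi> \<in> ?A"
      using U_T[OF gen_U] group_lift_left_mult[OF _ f_equivariant] \<Gamma>_SL2R by auto
  qed
  then show ?thesis using assms by auto
qed

lemma M_automorphic: "M \<subseteq> automorphic_functions \<Gamma> \<rho>"
proof
  fix v assume v: "v \<in> M"
  obtain c where c: "decomposes v c" using decomposes_ex[OF v] by blast
  define I where "I = {n. c n \<noteq> 0}"
  have I: "finite I" "v = sum c I" "\<And>n. c n \<in> Mw n" using c by (auto simp: decomposes_def I_def)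
  have "finite_dim fscale {Kact \<kappa> v | \<kappa>. \<kappa> \<in> SO2R}"
    unfolding finite_dim_def
    using Kact_M[OF c] I(1) unfolding I_def by (intro exI[of _ "c ` {n. c n \<noteq> 0}"]) auto
  moreover have "finite_dim fscale {D v | D. D \<in> center_Ug}"
  proof -
    obtain B where B: "\<And>n. finite (B n)" "\<And>n. Mw n \<subseteq> fscale.span (B n)"
      using Mw_finite_dim unfolding finite_dim_def by metis
    have "D v \<in> fscale.span (\<Union>n\<in>I. B n)" if "D \<in> center_Ug" for D
    proof -
      have "D \<in> Ug" using that by (simp add: center_Ug_def)
      then have "D v = (\<Sum>n\<in>I. D (c n))"
        unfolding I(2) by (rule endo_sum[OF Ug_endo I(1) Mw_M[OF I(3)]])
      also have "\<dots> \<in> fscale.span (\<Union>n\<in>I. B n)"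
      proof (rule fscale.span_sum)
        fix n assume "n \<in> I"
        then have "fscale.span (B n) \<subseteq> fscale.span (\<Union>n\<in>I. B n)"
          by (intro fscale.span_mono) auto
        then show "D (c n) \<in> fscale.span (\<Union>n\<in>I. B n)"
          using center_Ug_Mw[OF that I(3)] B(2) by blast
      qed
      finally show ?thesis .
    qed
    then show ?thesis
      unfolding finite_dim_def using B(1) I(1) by (intro exI[of _ "\<Union>n\<in>I. B n"]) auto
  qed
  ultimately show "v \<in> automorphic_functions \<Gamma> \<rho>"
    using v M_smooth M_equivariant[OF v] by (auto simp: automorphic_functions_def)
qed

lemma gK_submodule_M: "gK_submodule \<Gamma> \<rho> M"
  unfolding gK_submodule_def
proof (intro conjI ballI)
  fix \<kappa> v assume "\<kappa> \<in> SO2R" "v \<in> M"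
  then obtain c where c: "decomposes v c" using decomposes_ex by blast
  then have "fscale.span (c ` {n. c n \<noteq> 0}) \<subseteq> M"
    using Mw_M by (intro fscale.span_minimal[OF _ subspace_M]) (auto simp: decomposes_def)
  then show "Kact \<kappa> v \<in> M" using Kact_M[OF c \<open>\<kappa> \<in> SO2R\<close>] by auto
qed (use M_automorphic subspace_M gact_M in auto)

lemma generated_module_eq: "generated_module \<Gamma> \<rho> \<phi> = M"
proof
  show "generated_module \<Gamma> \<rho> \<phi> \<subseteq> M"
    using gK_submodule_M gen_M by (auto simp: generated_module_def)
  have "M \<subseteq> A" if "gK_submodule \<Gamma> \<rho> A" "\<phi> \<in> A" for A
    by (rule M_least) (use that elt_sl2C in \<open>auto simp: gK_submodule_def\<close>)
  then show "M \<subseteq> generated_module \<Gamma> \<rho> \<phi>" by (auto simp: generated_module_def)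
qed

lemma weight_space_eq: "weight_space M n = Mw n"
  unfolding weight_space_def by (rule weight_eq)

lemma M_nonzero: "M \<noteq> {0}"
proof -
  obtain \<tau> where \<tau>: "Im \<tau> > 0" "f \<tau> \<noteq> 0" using f_nonzero by (auto simp: upper_half_plane_def)
  \<comment> \<open>The upper triangular matrix of determinant 1 that moves i to
    \<open>\<tau>\<close>; there the lift is a nonzero multiple of \<open>f \<tau>\<close>.\<close>
  define g :: "real^2^2" where
    "g = vector [vector [sqrt (Im \<tau>), Re \<tau> / sqrt (Im \<tau>)], vector [0, 1 / sqrt (Im \<tau>)]]"
  have "sqrt (Im \<tau>) * sqrt (Im \<tau>) = Im \<tau>" using \<tau>(1) by simp
  then have "moebius_act g \<i> = \<tau>" "automorphy_factor g \<i> \<noteq> 0" "g \<in> carrier SL2R"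
    using \<tau>(1) by (auto simp: g_def moebius_act_def automorphy_factor_def carrier_SL2R det_2
        complex_eq_iff field_simps Re_divide Im_divide)
  then have "\<phi> g \<noteq> 0" using \<tau>(2) by (simp add: group_lift_def slash_def)
  then have "\<phi> \<noteq> 0" by auto
  then show ?thesis using gen_M by auto
qed

text \<open>Finite generation with the single generator \<open>\<phi>\<close>: the right-hand side
  is a subspace stable under X and Y, so minimality of \<open>M\<close> gives one inclusion, and
  \<open>Ug_endo\<close> the other.\<close>

lemma M_eq_Ug: "M = {D \<phi> | D. D \<in> Ug}" (is "_ = ?A")
proof
  have A: "v \<in> ?A \<longleftrightarrow> (\<exists>D\<in>Ug. v = D \<phi>)" for v by auto
  have stable: "gact Z v \<in> ?A" if v: "v \<in> ?A" and Z: "Z \<in> sl2C" for v Z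
  proof -
    obtain D where D: "D \<in> Ug" "v = D \<phi>" using v unfolding A by (elim bexE)
    show ?thesis
      unfolding A D(2) by (rule bexI[OF _ Ug.mult[OF Ug.lie[OF Z] D(1)]]) (rule refl)
  qed
  show "M \<subseteq> ?A"
  proof (rule M_least)
    show "fscale.subspace ?A"
    proof (rule fscale.subspaceI)
      have "fscale 0 \<phi> \<in> ?A" unfolding A by (rule bexI[OF _ Ug.scale[OF Ug.one]]) (rule refl)
      then show "0 \<in> ?A" by (simp only: fscale.scale_zero_left)
    next
      fix u v assume "u \<in> ?A" "v \<in> ?A"
      then obtain D E where D: "D \<in> Ug" "u = D \<phi>" and E: "E \<in> Ug" "v = E \<phi>"
        unfolding A by (elim bexE)
      show "u + v \<in> ?A"
        unfolding A D(2) E(2) by (rule bexI[OF _ Ug.add[OF D(1) E(1)]]) (rule refl)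
    next
      fix a v assume "v \<in> ?A"
      then obtain D where D: "D \<in> Ug" "v = D \<phi>" unfolding A by (elim bexE)
      show "fscale a v \<in> ?A"
        unfolding A D(2) by (rule bexI[OF _ Ug.scale[OF D(1)]]) (rule refl)
    qed
    show "X v \<in> ?A" "Y v \<in> ?A" if "v \<in> ?A" for v by (rule stable[OF that], rule elt_sl2C)+
    show "\<phi> \<in> ?A" unfolding A by (rule bexI[OF _ Ug.one]) (rule refl)
  qed
  show "?A \<subseteq> M"
  proof
    fix v assume "v \<in> ?A"
    then obtain D where D: "D \<in> Ug" "v = D \<phi>" unfolding A by (elim bexE)
    show "v \<in> M" unfolding D(2) by (rule endo_M[OF Ug_endo[OF D(1)] gen_M])
  qed
qed

lemma harish_chandra_module_M: "harish_chandra_module \<Gamma> \<rho> M"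
  unfolding harish_chandra_module_def weight_space_eq
proof (intro conjI allI ballI gK_submodule_M Mw_finite_dim)
  have "{D v | D v. D \<in> Ug \<and> v \<in> {\<phi>}} = {D \<phi> | D. D \<in> Ug}" by simp
  then have "M = fscale.span {D v | D v. D \<in> Ug \<and> v \<in> {\<phi>}}"
    using fscale.span_eq_iff[THEN iffD2, OF subspace_M] by (simp only: M_eq_Ug[symmetric])
  then show "\<exists>S. finite S \<and> S \<subseteq> M \<and> M = fscale.span {D v | D v. D \<in> Ug \<and> v \<in> S}"
    using gen_M by (intro exI[of _ "{\<phi>}"] conjI) simp_all
next
  fix v assume "v \<in> M"
  then have "\<exists>!c. decomposes v c"
    using decomposes_ex decomposes_unique by (intro ex_ex1I)
  then show "\<exists>!c. (\<forall>n. c n \<in> Mw n) \<and> finite {n. c n \<noteq> 0} \<and> v = sum c {n. c n \<noteq> 0}"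
    by (simp only: decomposes_def)
qed

lemma gK_submodule_stable:
  "gK_submodule \<Gamma> \<rho> A \<Longrightarrow> v \<in> A \<Longrightarrow> Z \<in> sl2C \<Longrightarrow> gact Z v \<in> A"
  by (simp add: gK_submodule_def)

lemma indecomposable_module_M: "indecomposable_module \<Gamma> \<rho> M"
  unfolding indecomposable_module_def
proof (intro conjI allI impI M_nonzero)
  fix A B assume "gK_submodule \<Gamma> \<rho> A \<and> gK_submodule \<Gamma> \<rho> B \<and> A \<inter> B = {0} \<and>
    {u + v | u v. u \<in> A \<and> v \<in> B} = M"
  then have A: "gK_submodule \<Gamma> \<rho> A" and B: "gK_submodule \<Gamma> \<rho> B"
    and AB: "A \<inter> B = {0}" "{u + v | u v. u \<in> A \<and> v \<in> B} = M"
    by (simp_all only: simp_thms)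
  show "A = {0} \<or> B = {0}"
  proof (rule summand_trivial[OF _ _ _ _ _ _ _ _ AB])
    show "fscale.subspace A" "fscale.subspace B"
      using A B by (simp_all add: gK_submodule_def)
    show "X v \<in> A" "Y v \<in> A" "H v \<in> A" if "v \<in> A" for v
      by (rule gK_submodule_stable[OF A that], rule elt_sl2C)+
    show "X v \<in> B" "Y v \<in> B" "H v \<in> B" if "v \<in> B" for v
      by (rule gK_submodule_stable[OF B that], rule elt_sl2C)+
  qed
qed

lemma cyclic_rep_of_module:
  "cyclic_quiver_rep fscale (quiver_of_weight k) (relations_of_weight k) (rep_of_module k M)"
proof (cases "k = 1")
  case True
  have "cyclic_quiver_rep fscale two_cyclic_quiver {} (two_cyclic_rep_of M)"
    by (rule two_cyclic_rep_cyclic[OF True]) (simp_all add: two_cyclic_rep_of_def weight_space_eq)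
  then show ?thesis
    unfolding quiver_of_weight_def relations_of_weight_def rep_of_module_def if_P[OF True] .
next
  case False
  have "cyclic_quiver_rep fscale gelfand_quiver gelfand_relations (gelfand_rep_of (nat \<bar>k - 1\<bar>) M)"
    by (rule gelfand_rep_cyclic[OF False]) (simp_all add: gelfand_rep_of_def weight_space_eq)
  then show ?thesis
    unfolding quiver_of_weight_def relations_of_weight_def rep_of_module_def if_not_P[OF False] .
qed

end

theorem theorem3p7:
  fixes \<Gamma> :: "(real^2^2) set"
    and \<rho> :: "real^2^2 \<Rightarrow> complex^'n^'n"
    and k :: int and d :: nat
    and f :: "complex \<Rightarrow> complex^'n"
  assumes "subgroup \<Gamma> SL2Z"
    and "finite (rcosets\<^bsub>SL2Z\<^esub> \<Gamma>)"
    and "\<rho> \<in> hom (SL2Z\<lparr>carrier := \<Gamma>\<rparr>) GL"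
    and "polyharmonic_weak_maass_form \<Gamma> \<rho> k d f"
    and "\<exists>\<tau>\<in>upper_half_plane. f \<tau> \<noteq> 0"
    and "exact_depth k d f"
  shows "cyclic_quiver_rep fscale (quiver_of_weight k) (relations_of_weight k)
           (rep_of_module k (generated_module \<Gamma> \<rho> (group_lift k f)))
         \<and> harish_chandra_module \<Gamma> \<rho> (generated_module \<Gamma> \<rho> (group_lift k f))
         \<and> indecomposable_module \<Gamma> \<rho> (generated_module \<Gamma> \<rho> (group_lift k f))"
proof -
  have "\<Gamma> \<subseteq> carrier SL2Z" using assms(1) by (rule subgroup.subset)
  also have "carrier SL2Z \<subseteq> carrier SL2R" by (auto simp: SL2Z_def SL2R_def)
  finally interpret maass_lift \<Gamma> \<rho> k d f
    using assms(4,5) by unfold_locales (auto simp: polyharmonic_weak_maass_form_def)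
  show ?thesis
    unfolding generated_module_eq
    using cyclic_rep_of_module harish_chandra_module_M indecomposable_module_M by blast
qed

end
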